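(* For $L\in\mathbb N$, $k\ge 0$ and $t>0$, let $X_{t,k}^{(L)}$ be the position at time $t$ of the $L$-th (i.e. the middle) particle of the Bessel process of type $A_{N-1}$ with $N=2L-1$ particles and multiplicity $k$, started in $0\in\mathbb R^N$. Then, for each $t>0$, $$\frac{2\sqrt L}{\sqrt{t\ln L}}\cdot X_{t,k}^{(L)}$$ tends in distribution to the standard normal distribution when first the limit $k\to\infty$ and then the limit $L\to\infty$ is taken; that is, for each fixed $L\ge2$ these random variables converge in distribution for $k\to\infty$ to some probability distribution $\rho_L$ on $\mathbb R$, and $\rho_L$ converges weakly to $N(0,1)$ for $L\to\infty$.
   Context: $C_N^A:=\{x\in\mathbb R^N: x_1\ge x_2\ge\dots\ge x_N\}$. The Bessel process of type $A_{N-1}$ with multiplicity $k\ge 0$ is the diffusion $(X_{t,k})_{t\ge0}$ on $C_N^A$ (with reflecting boundary) with generator $$L_Af=\tfrac12\Delta f+k\sum_{i=1}^N\Bigl(\sum_{j\ne i}\frac{1}{x_i-x_j}\Bigr)\frac{\partial}{\partial x_i}f .$$ When started in $0\in C_N^A$, $X_{t,k}$ has, for $t>0$, the density $$\frac{c_k^A}{t^{\gamma_A+N/2}}e^{-\|y\|^2/(2t)}\prod_{i<j}(y_i-y_j)^{2k}$$ on $C_N^A$, where $\gamma_A=kN(N-1)/2$ and $$c_k^A=\Bigl(\int_{C_N^A}e^{-\|y\|^2/2}\prod_{i<j}(y_i-y_j)^{2k}\,dy\Bigr)^{-1}=\frac{N!}{(2\pi)^{N/2}}\prod_{j=1}^N\frac{\Gamma(1+k)}{\Gamma(1+jk)}.$$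 The $L$-th particle is the $L$-th coordinate of $X_{t,k}\in C_N^A$. *)

theory Defs
  imports "HOL-Probability.Probability"
begin

text \<open>
  The dimension N varies inside the theorem, so a point of the Euclidean space \<open>\<real>\<^sup>N\<close> is an
  extensional function \<open>nat \<Rightarrow> real\<close> on the index set \<open>{1..N}\<close>, with the (product) topology and
  the product Borel sigma-algebra.
\<close>

definition config_space :: "nat \<Rightarrow> (nat \<Rightarrow> real) set" where
  "config_space N = PiE {1..N} (\<lambda>_. UNIV)"

definition weyl_chamber_A :: "nat \<Rightarrow> (nat \<Rightarrow> real) set" where
  "weyl_chamber_A N =
     {x \<in> config_space N. \<forall>i\<in>{1..N}. \<forall>j\<in>{1..N}. i \<le> j \<longrightarrow> x j \<le> x i}"

definition partial_deriv :: "nat \<Rightarrow> ((nat \<Rightarrow> real) \<Rightarrow> real) \<Rightarrow> (nat \<Rightarrow> real) \<Rightarrow> real" where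
  "partial_deriv i f x = deriv (\<lambda>s. f (x(i := s))) (x i)"

definition C1_fun :: "nat \<Rightarrow> ((nat \<Rightarrow> real) \<Rightarrow> real) \<Rightarrow> bool" where
  "C1_fun N f \<longleftrightarrow>
     continuous_on (config_space N) f \<and>
     (\<forall>i\<in>{1..N}.
        (\<forall>x\<in>config_space N. (\<lambda>s. f (x(i := s))) differentiable at (x i)) \<and>
        continuous_on (config_space N) (partial_deriv i f))"

definition C2_fun :: "nat \<Rightarrow> ((nat \<Rightarrow> real) \<Rightarrow> real) \<Rightarrow> bool" where
  "C2_fun N f \<longleftrightarrow> C1_fun N f \<and> (\<forall>i\<in>{1..N}. C1_fun N (partial_deriv i f))"

text \<open>
  Division by zero makes a term with \<open>x i = x j\<close> vanish. The values on the walls of the chamber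
  are immaterial below, because the process spends no time there.
\<close>

definition bessel_generator_A ::
    "nat \<Rightarrow> real \<Rightarrow> ((nat \<Rightarrow> real) \<Rightarrow> real) \<Rightarrow> (nat \<Rightarrow> real) \<Rightarrow> real" where
  "bessel_generator_A N k f x =
     1 / 2 * (\<Sum>i=1..N. partial_deriv i (partial_deriv i f) x)
     + k * (\<Sum>i=1..N. (\<Sum>j\<in>{1..N} - {i}. 1 / (x i - x j)) * partial_deriv i f x)"

text \<open>
  Reflecting boundary conditions: the test functions are the compactly supported
  \<open>C\<^sup>2\<close>-functions whose normal derivative vanishes on every wall \<open>x i = x j\<close> of the closed chamber.
  On these functions the singular drift terms cancel in pairs near the walls, and
  \<^term>\<open>bessel_generator_A N k f\<close> is bounded on the chamber.
\<close>

definition reflecting_test_fun :: "nat \<Rightarrow> ((nat \<Rightarrow> real) \<Rightarrow> real) \<Rightarrow> bool" where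
  "reflecting_test_fun N f \<longleftrightarrow>
     C2_fun N f \<and>
     (\<exists>R. \<forall>x\<in>config_space N. (\<exists>i\<in>{1..N}. R < \<bar>x i\<bar>) \<longrightarrow> f x = 0) \<and>
     (\<forall>x\<in>weyl_chamber_A N. \<forall>i\<in>{1..N}. \<forall>j\<in>{1..N}.
        x i = x j \<longrightarrow> partial_deriv i f x = partial_deriv j f x)"

definition natural_filtration ::
    "'w measure \<Rightarrow> 's measure \<Rightarrow> (real \<Rightarrow> 'w \<Rightarrow> 's) \<Rightarrow> real \<Rightarrow> 'w measure" where
  "natural_filtration M S X t =
     sigma (space M) (\<Union>u\<in>{0..t}. {X u -` A \<inter> space M | A. A \<in> sets S})"

definition martingale_wrt ::
    "'w measure \<Rightarrow> (real \<Rightarrow> 'w measure) \<Rightarrow> (real \<Rightarrow> 'w \<Rightarrow> real) \<Rightarrow> bool" where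
  "martingale_wrt M F Y \<longleftrightarrow>
     (\<forall>t\<ge>0. integrable M (Y t) \<and> Y t \<in> borel_measurable (F t)) \<and>
     (\<forall>s t. 0 \<le> s \<and> s \<le> t \<longrightarrow> (AE \<omega> in M. real_cond_exp M (F s) (Y t) \<omega> = Y s \<omega>))"

text \<open>
  The diffusion on the closed chamber with the above generator and reflecting boundary, as a
  solution of the martingale problem: paths are continuous in the chamber, the boundary is
  neither sticky nor absorbing (the set of times spent on the walls is Lebesgue-null), and
  \<open>f (X\<^sub>t) - f (X\<^sub>0) - \<integral>\<^sub>0\<^sup>t (L\<^sub>A f) (X\<^sub>s) ds\<close> is a martingale for every test function \<open>f\<close>.
\<close>

definition bessel_process_A ::
    "nat \<Rightarrow> real \<Rightarrow> 'w measure \<Rightarrow> (real \<Rightarrow> 'w \<Rightarrow> nat \<Rightarrow> real) \<Rightarrow> bool" where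
  "bessel_process_A N k M X \<longleftrightarrow>
     prob_space M \<and>
     (\<forall>t\<ge>0. X t \<in> M \<rightarrow>\<^sub>M (\<Pi>\<^sub>M i\<in>{1..N}. borel)) \<and>
     (\<forall>\<omega>\<in>space M. \<forall>t\<ge>0. X t \<omega> \<in> weyl_chamber_A N) \<and>
     (\<forall>\<omega>\<in>space M. \<forall>i\<in>{1..N}. continuous_on {0..} (\<lambda>t. X t \<omega> i)) \<and>
     (AE \<omega> in M. AE s in lborel. 0 \<le> s \<longrightarrow> inj_on (X s \<omega>) {1..N}) \<and>
     (\<forall>f. reflecting_test_fun N f \<longrightarrow>
        martingale_wrt M (natural_filtration M (\<Pi>\<^sub>M i\<in>{1..N}. borel) X)
          (\<lambda>t \<omega>. f (X t \<omega>) - f (X 0 \<omega>)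
                  - (LINT s:{0..t}|lborel. bessel_generator_A N k f (X s \<omega>))))"

definition started_at_zero :: "nat \<Rightarrow> 'w measure \<Rightarrow> (real \<Rightarrow> 'w \<Rightarrow> nat \<Rightarrow> real) \<Rightarrow> bool" where
  "started_at_zero N M X \<longleftrightarrow> (AE \<omega> in M. \<forall>i\<in>{1..N}. X 0 \<omega> i = 0)"

text \<open>Weak convergence along an arbitrary filter; the library version is for sequences only.\<close>

definition weak_conv_along :: "('k \<Rightarrow> real measure) \<Rightarrow> real measure \<Rightarrow> 'k filter \<Rightarrow> bool" where
  "weak_conv_along \<mu> \<nu> F \<longleftrightarrow>
     (\<forall>x. isCont (cdf \<nu>) x \<longrightarrow> ((\<lambda>k. cdf (\<mu> k) x) \<longlongrightarrow> cdf \<nu> x) F)"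

lemma weak_conv_along_sequentially: "weak_conv_along \<mu> \<nu> sequentially \<longleftrightarrow> weak_conv_m \<mu> \<nu>"
  by (simp add: weak_conv_along_def weak_conv_m_def weak_conv_def)

end

theory Submission
  imports Defs
begin

text \<open>
  Write \<open>N = 2 * L - 1\<close>. The drift of the process pulls a solution started in
  \<open>0\<close> towards \<open>sqrt (2 * k * t) * z\<close>, where \<open>z\<close> is the
  decreasing configuration with \<open>z i = (\<Sum>j. 1 / (z i - z j))\<close> (the zeros of
  the Hermite polynomial of degree \<open>N\<close>). For large \<open>k\<close> the deviation
  \<open>Y\<close> from this curve nearly solves the linear equation \<open>dY = dB - A Y dt /
  (2 * t)\<close> with the stiffness matrix \<open>(A f) i = (\<Sum>j. (f i - f j) / (z i - z
  j)\<^sup>2)\<close>. A linear form \<open>\<langle>w t, Y t\<rangle>\<close> whose direction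
  is transported by \<open>w' = A w / (2 * t)\<close> is then a Brownian integral, hence
  Gaussian with variance \<open>\<integral> |w|\<^sup>2\<close>. As \<open>z L = 0\<close> by
  symmetry, the middle coordinate of \<open>X\<close> is such a form, with no centring.

  The linearisation is controlled without a Taylor expansion. For positive \<open>u\<close>
  and \<open>x\<close>, \<open>1 / x = 2 / u - x / u\<^sup>2 + (x - u)\<^sup>2 / (u\<^sup>2 *
  x)\<close>, and with \<open>u\<close> the gap of the deterministic curve the first two terms
  give exactly the linear drift (\<open>drift_identity\<close>). The remainder is nonnegative.
  In the equation for the mean of \<open>\<langle>z, X\<rangle>\<close> it only increases the
  drift, whereas the second moment \<open>E |X|\<^sup>2 \<le> t * (N + k * N * (N -
  1))\<close> bounds that mean from above by its deterministic value up to \<open>O(1 / sqrt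
  k)\<close>. So the expected remainder, integrated over time, is \<open>O(1 / sqrt
  k)\<close>, and it also bounds the error in the equation for \<open>E cos (\<theta> *
  \<langle>w, X\<rangle> + \<alpha>)\<close> (\<open>wave_drift_bound\<close>,
  \<open>wave_expectation\<close>). All transported forms converge to their Gaussian limits.

  The martingale problem speaks of test functions obeying the reflecting condition, so linear
  forms and waves are multiplied by a cut-off \<open>D^4 / (D^4 + \<delta>)\<close> in the
  Vandermonde product \<open>D\<close>, which vanishes to high order on the walls, and by a
  cut-off in the radius. For \<open>k \<ge> 5/2\<close> the first factor is subharmonic for
  the generator because \<open>D\<close> is harmonic (\<open>wall_cutoff_subharmonic\<close>),
  and together with the absence of sticking this shows that the walls carry no mass
  (\<open>cutoff_expectation_tendsto_1\<close>).

  For the variance, \<open>A\<close> is diagonalised by the polynomials dual to the Hermite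
  polynomials, evaluated at \<open>z\<close>: the eigenvalues are \<open>0, ..., N - 1\<close>
  (\<open>dual_hermite_ladder\<close>). Expanding the middle unit vector in these modes gives
  the limit variance \<open>t / N * (\<Sum>m<L. middle_weight L m / (2 * m + 1))\<close>,
  which is asymptotic to \<open>t * ln L / (4 * L)\<close>
  (\<open>middle_weight_sum_asymp\<close>). Levy's continuity theorem turns both limits into
  weak convergence.
\<close>

section \<open>Equilibrium configurations and their stiffness matrix\<close>

lemma antisym_double_sum:
  fixes a :: "'b \<Rightarrow> real" and e :: "'b \<Rightarrow> 'b \<Rightarrow> real"
  assumes "\<And>i j. e j i = - e i j"
  shows "(\<Sum>i\<in>I. a i * (\<Sum>j\<in>I. e i j)) = 1/2 * (\<Sum>i\<in>I. \<Sum>j\<in>I. (a i - a j) * e i j)"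
proof -
  have "(\<Sum>i\<in>I. \<Sum>j\<in>I. a j * e i j) = (\<Sum>i\<in>I. \<Sum>j\<in>I. a i * e j i)"
    by (rule sum.swap)
  also have "\<dots> = (\<Sum>i\<in>I. \<Sum>j\<in>I. - (a i * e i j))"
    by (intro sum.cong refl) (subst assms, simp)
  also have "\<dots> = - (\<Sum>i\<in>I. \<Sum>j\<in>I. a i * e i j)"
    by (simp add: sum_negf)
  finally show ?thesis
    by (simp add: left_diff_distrib sum_subtractf sum_distrib_left)
qed

text \<open>
  Critical points of \<open>(\<Sum>i. (x i)\<^sup>2 / 2) - (\<Sum>i<j. ln (x i - x j))\<close>
  on the chamber. Sums such as \<open>(\<Sum>j=1..N. 1 / (z i - z j))\<close> run over all
  indices, because the term \<open>j = i\<close> is \<open>1 / 0 = 0\<close>; this convention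
  is used throughout.
\<close>
locale equilibrium =
  fixes N :: nat and z :: "nat \<Rightarrow> real"
  assumes decreasing: "\<lbrakk>i \<in> {1..N}; j \<in> {1..N}; i < j\<rbrakk> \<Longrightarrow> z j < z i"
    and balance: "i \<in> {1..N} \<Longrightarrow> (\<Sum>j=1..N. 1 / (z i - z j)) = z i"
begin

lemma gap_eq_0_iff: "\<lbrakk>i \<in> {1..N}; j \<in> {1..N}\<rbrakk> \<Longrightarrow> z i = z j \<longleftrightarrow> i = j"
  by (metis decreasing linorder_neqE_nat order_less_irrefl)

definition stiffness :: "(nat \<Rightarrow> real) \<Rightarrow> nat \<Rightarrow> real" where
  "stiffness f i = (\<Sum>j=1..N. (f i - f j) / (z i - z j)\<^sup>2)"

text \<open>
  The commutator of the stiffness matrix with multiplication by the position; its own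
  commutator with the position is, up to a rank one term, the identity. These two relations
  (those of the Calogero model) carry the spectral computation below.
\<close>
definition inverse_gap :: "(nat \<Rightarrow> real) \<Rightarrow> nat \<Rightarrow> real" where
  "inverse_gap f i = (\<Sum>j=1..N. f j / (z i - z j))"

lemma stiffness_dirichlet:
  "(\<Sum>i=1..N. f i * stiffness g i)
     = 1/2 * (\<Sum>i=1..N. \<Sum>j=1..N. (f i - f j) * (g i - g j) / (z i - z j)\<^sup>2)"
  unfolding stiffness_def
  by (subst antisym_double_sum) (auto simp: minus_divide_left power2_commute)

lemma stiffness_symmetric:
  "(\<Sum>i=1..N. f i * stiffness g i) = (\<Sum>i=1..N. g i * stiffness f i)"
  unfolding stiffness_dirichlet by (simp add: mult.commute)

lemma stiffness_mult_position:
  "stiffness (\<lambda>j. z j * f j) i = z i * stiffness f i + inverse_gap f i"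
proof -
  have "(z i * f i - z j * f j) / (z i - z j)\<^sup>2
      = z i * ((f i - f j) / (z i - z j)\<^sup>2) + f j / (z i - z j)" for j
    by (cases "z i = z j") (simp_all add: divide_simps, simp add: algebra_simps power2_eq_square)
  then show ?thesis
    unfolding stiffness_def inverse_gap_def by (simp add: sum_distrib_left sum.distrib)
qed

lemma inverse_gap_mult_position:
  assumes "i \<in> {1..N}"
  shows "inverse_gap (\<lambda>j. z j * f j) i = z i * inverse_gap f i + f i - (\<Sum>j=1..N. f j)"
proof -
  have "inverse_gap (\<lambda>j. z j * f j) i = (\<Sum>j=1..N. z i * (f j / (z i - z j)) + (if i = j then f j else 0) - f j)"
    unfolding inverse_gap_def
  proof (rule sum.cong)
    fix j assume "j \<in> {1..N}"
    with assms gap_eq_0_iff[of i j] show "z j * f j / (z i - z j) = z i * (f j / (z i - z j)) + (if i = j then f j else 0) - f j"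
      by (auto simp: field_simps)
  qed simp
  then show ?thesis
    using assms by (simp add: inverse_gap_def sum_subtractf sum.distrib sum_distrib_left)
qed

text \<open>
  The recurrence of the monic Hermite polynomials with its coefficients \<open>1/2, 2/2, ...,
  (N-1)/2\<close> taken in reverse order. These are the monic orthogonal polynomials for the
  uniform distribution on the points \<open>z\<close>.
\<close>
fun dual_hermite :: "nat \<Rightarrow> real \<Rightarrow> real" where
  "dual_hermite 0 x = 1"
| "dual_hermite (Suc 0) x = x"
| "dual_hermite (Suc (Suc k)) x
     = x * dual_hermite (Suc k) x - (real N - real (Suc k)) / 2 * dual_hermite k x"

lemma eigen_sum_zero:
  assumes "\<And>i. i \<in> {1..N} \<Longrightarrow> stiffness f i = c * f i" "c \<noteq> 0"
  shows "(\<Sum>i=1..N. f i) = 0"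
proof -
  have "c * (\<Sum>i=1..N. f i) = (\<Sum>i=1..N. 1 * stiffness f i)"
    using assms(1) by (simp add: sum_distrib_left)
  also have "\<dots> = 0"
    by (subst stiffness_symmetric) (simp add: stiffness_def)
  finally show ?thesis using \<open>c \<noteq> 0\<close> by simp
qed

lemma eigen_orthogonal:
  assumes "\<And>i. i \<in> {1..N} \<Longrightarrow> stiffness f i = c * f i"
    and "\<And>i. i \<in> {1..N} \<Longrightarrow> stiffness g i = d * g i" and "c \<noteq> d"
  shows "(\<Sum>i=1..N. f i * g i) = 0"
proof -
  have "d * (\<Sum>i=1..N. f i * g i) = (\<Sum>i=1..N. f i * stiffness g i)"
    using assms(2) by (auto simp: sum_distrib_left intro!: sum.cong)
  also have "\<dots> = (\<Sum>i=1..N. g i * stiffness f i)" by (rule stiffness_symmetric)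
  also have "\<dots> = c * (\<Sum>i=1..N. f i * g i)"
    using assms(1) by (auto simp: sum_distrib_left intro!: sum.cong)
  finally show ?thesis using \<open>c \<noteq> d\<close> by auto
qed

lemma stiffness_inverse_gap_diff:
  "stiffness (\<lambda>j. f j - c * g j) i = stiffness f i - c * stiffness g i"
  "inverse_gap (\<lambda>j. f j - c * g j) i = inverse_gap f i - c * inverse_gap g i"
  unfolding stiffness_def inverse_gap_def
  by (simp_all add: sum_distrib_left algebra_simps diff_divide_distrib add_divide_distrib flip: sum_subtractf)

text \<open>
  The two relations have to be proved together. Applying the commutator relations to the
  recurrence expresses both sides for \<open>k + 1\<close> by those for \<open>k\<close> and
  \<open>k - 1\<close>, up to the sum of the values of the polynomial over the configuration;
  that sum vanishes because an eigenvector with nonzero eigenvalue is orthogonal to the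
  constants. The induction starts from the balance equation, which says that the commutator
  maps the constant \<open>1\<close> to the position.
\<close>
lemma dual_hermite_ladder:
  shows "i \<in> {1..N} \<Longrightarrow> stiffness (\<lambda>j. dual_hermite k (z j)) i = real k * dual_hermite k (z i)"
    and "i \<in> {1..N} \<Longrightarrow> inverse_gap (\<lambda>j. dual_hermite k (z j)) i
          = z i * dual_hermite k (z i) - (real N - real k) * (if k = 0 then 0 else dual_hermite (k - 1) (z i))"
proof -
  define q where "q k j = dual_hermite k (z j)" for k j
  have q0: "q 0 = (\<lambda>_. 1)" and q1: "q (Suc 0) = z" 
    and q2: "q (Suc (Suc k)) = (\<lambda>j. z j * q (Suc k) j - (real N - real (Suc k)) / 2 * q k j)" for k
    by (auto simp: q_def)
  have "(\<forall>i\<in>{1..N}. stiffness (q k) i = real k * q k i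
           \<and> stiffness (q (Suc k)) i = real (Suc k) * q (Suc k) i
           \<and> inverse_gap (q k) i = z i * q k i - (real N - real k) * (if k = 0 then 0 else q (k - 1) i)
           \<and> inverse_gap (q (Suc k)) i = z i * q (Suc k) i - (real N - real (Suc k)) * q k i)"
  proof (induction k)
    case 0
    have *: "inverse_gap (\<lambda>_. 1) i = z i" if "i \<in> {1..N}" for i
      using balance[OF that] by (simp add: inverse_gap_def)
    have "stiffness (\<lambda>_. 1) i = 0" for i by (simp add: stiffness_def)
    then show ?case
      using stiffness_mult_position[of "\<lambda>_. 1"] inverse_gap_mult_position[of _ "\<lambda>_. 1"] *
      by (auto simp: q0 q1)
  next
    case (Suc k)
    have s: "(\<Sum>j=1..N. q (Suc k) j) = 0"
      by (rule eigen_sum_zero[of _ "real (Suc k)"]) (use Suc in auto)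
    show ?case
    proof
      fix i assume i: "i \<in> {1..N}"
      have q': "q (Suc k) i = z i * q k i - (real N - real k) / 2 * (if k = 0 then 0 else q (k - 1) i)"
        by (cases k) (simp_all add: q0 q1 q2)
      from Suc i have
        1: "stiffness (q k) i = real k * q k i"
        and 2: "stiffness (q (Suc k)) i = real (Suc k) * q (Suc k) i"
        and 3: "inverse_gap (q k) i = z i * q k i - (real N - real k) * (if k = 0 then 0 else q (k - 1) i)"
        and 4: "inverse_gap (q (Suc k)) i = z i * q (Suc k) i - (real N - real (Suc k)) * q k i" by auto
      have 5: "stiffness (q (Suc (Suc k))) i = real (Suc (Suc k)) * q (Suc (Suc k)) i"
        unfolding q2 stiffness_inverse_gap_diff stiffness_mult_position 1 2 4 of_nat_Suc by algebra
      have 6: "inverse_gap (q (Suc (Suc k))) i = z i * q (Suc (Suc k)) i - (real N - real (Suc (Suc k))) * q (Suc k) i"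
        unfolding q2 stiffness_inverse_gap_diff inverse_gap_mult_position[OF i] 3 4 s of_nat_Suc
        using q' by algebra
      show "stiffness (q (Suc k)) i = real (Suc k) * q (Suc k) i
           \<and> stiffness (q (Suc (Suc k))) i = real (Suc (Suc k)) * q (Suc (Suc k)) i
           \<and> inverse_gap (q (Suc k)) i = z i * q (Suc k) i - (real N - real (Suc k)) * (if Suc k = 0 then 0 else q (Suc k - 1) i)
           \<and> inverse_gap (q (Suc (Suc k))) i = z i * q (Suc (Suc k)) i - (real N - real (Suc (Suc k))) * q (Suc k) i"
        using 2 4 5 6 by simp
    qed
  qed
  then show "i \<in> {1..N} \<Longrightarrow> stiffness (\<lambda>j. dual_hermite k (z j)) i = real k * dual_hermite k (z i)"
    and "i \<in> {1..N} \<Longrightarrow> inverse_gap (\<lambda>j. dual_hermite k (z j)) i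
          = z i * dual_hermite k (z i) - (real N - real k) * (if k = 0 then 0 else dual_hermite (k - 1) (z i))"
    by (auto simp: q_def[abs_def])
qed

lemma stiffness_position: "i \<in> {1..N} \<Longrightarrow> stiffness z i = z i"
  using dual_hermite_ladder(1)[of i "Suc 0"] by simp

text \<open>
  The map \<open>x \<mapsto> 1 / x\<close> is decreasing, so pairing the difference of the two
  balance equations with \<open>z - z'\<close> yields a nonnegative number on one side and a
  nonpositive one on the other.
\<close>
lemma equilibrium_unique:
  assumes "equilibrium N z'" "i \<in> {1..N}"
  shows "z' i = z i"
proof -
  interpret other: equilibrium N z' by fact
  define d where "d i = z i - z' i" for i
  have "(\<Sum>i=1..N. (d i)\<^sup>2) = (\<Sum>i=1..N. d i * (\<Sum>j=1..N. 1 / (z i - z j) - 1 / (z' i - z' j)))"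
  proof (rule sum.cong[OF refl])
    fix i assume i: "i \<in> {1..N}"
    have "(\<Sum>j=1..N. 1 / (z i - z j) - 1 / (z' i - z' j)) = d i"
      unfolding sum_subtractf balance[OF i] other.balance[OF i] d_def ..
    then show "(d i)\<^sup>2 = d i * (\<Sum>j=1..N. 1 / (z i - z j) - 1 / (z' i - z' j))"
      by (simp add: power2_eq_square)
  qed
  also have "\<dots> = 1/2 * (\<Sum>i=1..N. \<Sum>j=1..N. (d i - d j) * (1 / (z i - z j) - 1 / (z' i - z' j)))"
  proof (rule antisym_double_sum)
    fix i j
    have "1 / (z j - z i) = - (1 / (z i - z j))" "1 / (z' j - z' i) = - (1 / (z' i - z' j))"
      by (metis minus_diff_eq minus_divide_right)+
    then show "1 / (z j - z i) - 1 / (z' j - z' i) = - (1 / (z i - z j) - 1 / (z' i - z' j))"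
      by simp
  qed
  also have "\<dots> \<le> 0"
  proof -
    have "(d i - d j) * (1 / (z i - z j) - 1 / (z' i - z' j)) \<le> 0"
      if i: "i \<in> {1..N}" and j: "j \<in> {1..N}" for i j
    proof (cases "i = j")
      case False
      then have "0 < (z i - z j) * (z' i - z' j)"
        using decreasing[of i j] decreasing[of j i] other.decreasing[of i j] other.decreasing[of j i] i j
        by (cases "i < j") (auto intro: mult_pos_pos mult_neg_neg)
      moreover have "(a - b) * (1 / a - 1 / b) = - (a - b)\<^sup>2 / (a * b)" if "0 < a * b" for a b :: real
        using that by (auto simp: field_simps power2_eq_square zero_less_mult_iff)
      moreover have "d i - d j = (z i - z j) - (z' i - z' j)"
        by (simp add: d_def)
      ultimately show ?thesis
        by (simp add: divide_nonpos_pos)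
    qed simp
    then have "(\<Sum>i=1..N. \<Sum>j=1..N. (d i - d j) * (1 / (z i - z j) - 1 / (z' i - z' j))) \<le> 0"
      by (intro sum_nonpos)
    then show ?thesis by simp
  qed
  finally have "(\<Sum>i=1..N. (d i)\<^sup>2) = 0"
    by (simp add: sum_nonneg order_antisym)
  then show ?thesis
    using assms(2) by (simp add: sum_nonneg_eq_0_iff d_def)
qed

lemma equilibrium_reflected: "equilibrium N (\<lambda>i. - z (N + 1 - i))"
proof
  fix i j assume "i \<in> {1..N}" "j \<in> {1..N}" "i < j"
  then show "- z (N + 1 - j) < - z (N + 1 - i)"
    using decreasing[of "N + 1 - j" "N + 1 - i"] by auto
next
  fix i assume i: "i \<in> {1..N}"
  have "(\<Sum>j=1..N. 1 / (- z (N + 1 - i) - - z (N + 1 - j))) = (\<Sum>j=1..N. 1 / (- z (N + 1 - i) - - z j))"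
    by (rule sum.reindex_bij_witness[of _ "\<lambda>j. N + 1 - j" "\<lambda>j. N + 1 - j"]) auto
  also have "\<dots> = - (\<Sum>j=1..N. 1 / (z (N + 1 - i) - z j))"
    by (subst sum_negf[symmetric], rule sum.cong) (auto simp: minus_divide_right)
  also have "\<dots> = - z (N + 1 - i)"
    using i by (subst balance) auto
  finally show "(\<Sum>j=1..N. 1 / (- z (N + 1 - i) - - z (N + 1 - j))) = - z (N + 1 - i)" .
qed

lemma middle_zero: "N = 2 * L - 1 \<Longrightarrow> 1 \<le> L \<Longrightarrow> z L = 0"
  using equilibrium_unique[OF equilibrium_reflected, of L] by (auto simp: algebra_simps)

text \<open>
  An eigenvector for the eigenvalue \<open>N\<close> would be orthogonal to all eigenvectors
  for \<open>0, ..., N - 1\<close>. These are the polynomials of degree below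
  \<open>N\<close>, which contain the Lagrange polynomial of each point, so every value has to
  vanish. Thus \<open>dual_hermite N\<close> is the Hermite polynomial itself.
\<close>
lemma dual_hermite_vanishes:
  assumes i: "i \<in> {1..N}"
  shows "dual_hermite N (z i) = 0"
proof -
  have orth: "a + b < N \<Longrightarrow> (\<Sum>j=1..N. dual_hermite N (z j) * (z j ^ a * dual_hermite b (z j))) = 0" for a b
  proof (induction a arbitrary: b)
    case 0
    then show ?case
      using eigen_orthogonal[OF dual_hermite_ladder(1) dual_hermite_ladder(1), of N b] by simp
  next
    case (Suc a)
    show ?case
    proof (cases b)
      case 0
      then show ?thesis using Suc.IH[of 1] Suc.prems by (simp add: mult.assoc mult.commute)
    next
      case (Suc c)
      have "(\<Sum>j=1..N. dual_hermite N (z j) * (z j ^ Suc a * dual_hermite b (z j)))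
         = (\<Sum>j=1..N. dual_hermite N (z j) * (z j ^ a * dual_hermite (Suc b) (z j)))
          + (real N - real b) / 2 * (\<Sum>j=1..N. dual_hermite N (z j) * (z j ^ a * dual_hermite c (z j)))"
        unfolding Suc by (simp add: sum_distrib_left algebra_simps flip: sum.distrib)
      then show ?thesis using Suc.IH[of c] Suc.IH[of "Suc b"] Suc.prems Suc by simp
    qed
  qed
  \<comment> \<open>the Lagrange polynomial of the point \<open>z i\<close>, up to a
    factor\<close>
  define p where "p = (\<Prod>j\<in>{1..N} - {i}. [:- z j, 1:])"
  have "degree p < N"
    using i unfolding p_def by (subst degree_prod_eq_sum_degree) auto
  have "(\<Sum>j=1..N. dual_hermite N (z j) * poly p (z j)) = 0"
  proof -
    have "(\<Sum>j=1..N. dual_hermite N (z j) * poly p (z j))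
        = (\<Sum>a\<le>degree p. coeff p a * (\<Sum>j=1..N. dual_hermite N (z j) * (z j ^ a * dual_hermite 0 (z j))))"
      unfolding poly_altdef sum_distrib_left
      by (subst sum.swap) (simp add: mult_ac)
    also have "\<dots> = 0"
      using orth[of _ 0] \<open>degree p < N\<close> by (intro sum.neutral) auto
    finally show ?thesis .
  qed
  moreover have "poly p (z j) = 0" if "j \<in> {1..N} - {i}" for j
    using that by (auto simp: p_def poly_prod intro!: prod_zero bexI[of _ j])
  then have "(\<Sum>j=1..N. dual_hermite N (z j) * poly p (z j)) = dual_hermite N (z i) * poly p (z i)"
    using i by (subst sum.remove[of _ i]) auto
  moreover have "poly p (z i) \<noteq> 0"
    using i gap_eq_0_iff by (auto simp: p_def poly_prod)
  ultimately show ?thesis by simp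
qed

end

section \<open>Modes of the middle particle\<close>

text \<open>
  Squares of the normalised eigenvectors at the middle point, multiplied by \<open>N\<close>;
  see \<open>weight_at_0\<close>.
\<close>
definition middle_weight :: "nat \<Rightarrow> nat \<Rightarrow> real" where
  "middle_weight L m = (\<Prod>l=1..m. (real L - real l) / (real L - real l - 1/2))"

lemma middle_weight_0 [simp]: "middle_weight L 0 = 1"
  and middle_weight_Suc: "middle_weight L (Suc m)
     = middle_weight L m * ((real L - real (Suc m)) / (real L - real (Suc m) - 1/2))"
  by (simp_all add: middle_weight_def)

text \<open>
  The sum telescopes. At \<open>n = L - 1\<close> the last term vanishes and the sum is
  \<open>N = 2 * L - 1\<close>.
\<close>
lemma sum_middle_weight:
  assumes "n < L"
  shows "(\<Sum>m\<le>n. middle_weight L m) = 2 * real L - 1 - 2 * (real L - real n - 1) * middle_weight L n"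
  using assms
proof (induction n)
  case (Suc n)
  have "real L - real (Suc n) - 1/2 \<noteq> 0" using Suc.prems by auto
  then have "middle_weight L (Suc n) * (real L - real (Suc n) - 1/2) = middle_weight L n * (real L - real (Suc n))"
    by (simp add: middle_weight_Suc)
  moreover have "(\<Sum>m\<le>n. middle_weight L m) = 2 * real L - 1 - 2 * (real L - real n - 1) * middle_weight L n"
    using Suc by simp
  ultimately show ?case by (simp add: algebra_simps)
qed simp

locale odd_equilibrium = equilibrium +
  fixes L :: nat
  assumes N_eq: "N = 2 * L - 1" and L_pos: "1 \<le> L"
begin

lemma real_N: "real N = 2 * real L - 1"
  using N_eq L_pos by simp

lemma L_in: "L \<in> {1..N}"
  using N_eq L_pos by auto

definition squared_norm :: "nat \<Rightarrow> real" where
  "squared_norm k = (\<Prod>l=1..k. (real N - real l) / 2)"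

lemma squared_norm_pos: "k < N \<Longrightarrow> 0 < squared_norm k"
  unfolding squared_norm_def by (intro prod_pos) auto

lemma squared_norm_Suc: "squared_norm (Suc k) = squared_norm k * ((real N - real (Suc k)) / 2)"
  by (simp add: squared_norm_def)

text \<open>
  The Christoffel-Darboux formula with one argument \<open>0\<close>, where the polynomials of
  odd degree drop out.
\<close>
lemma christoffel_darboux_at_0:
  assumes "2 * n < N"
  shows "x * (\<Sum>m\<le>n. dual_hermite (2 * m) 0 * dual_hermite (2 * m) x / squared_norm (2 * m))
     = dual_hermite (Suc (2 * n)) x * dual_hermite (2 * n) 0 / squared_norm (2 * n)"
  using assms
proof (induction n)
  case 0
  then show ?case by (simp add: squared_norm_def)
next
  case (Suc n)
  define b1 b2 where "b1 = (real N - real (Suc (2 * n))) / 2" and "b2 = (real N - real (Suc (Suc (2 * n)))) / 2"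
  have pos: "b1 > 0" "b2 > 0" "squared_norm (2 * n) > 0"
    using Suc.prems squared_norm_pos[of "2 * n"] by (auto simp: b1_def b2_def)
  have IH: "x * (\<Sum>m\<le>n. dual_hermite (2 * m) 0 * dual_hermite (2 * m) x / squared_norm (2 * m))
     = dual_hermite (Suc (2 * n)) x * dual_hermite (2 * n) 0 / squared_norm (2 * n)"
    using Suc by simp
  have h: "squared_norm (2 * Suc n) = squared_norm (2 * n) * b1 * b2"
    by (simp add: squared_norm_Suc b1_def b2_def)
  have q0: "dual_hermite (2 * Suc n) 0 = - b1 * dual_hermite (2 * n) 0"
    by (simp add: b1_def)
  have qx: "dual_hermite (Suc (2 * Suc n)) x = x * dual_hermite (2 * Suc n) x - b2 * dual_hermite (Suc (2 * n)) x"
    by (simp add: b2_def)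
  show ?case
    unfolding sum.atMost_Suc distrib_left IH h q0 qx
    using pos by (simp add: field_simps)
qed

lemma weight_at_0:
  "2 * m < N \<Longrightarrow> dual_hermite (2 * m) 0 * dual_hermite (2 * m) 0 / squared_norm (2 * m) = middle_weight L m"
proof (induction m)
  case 0
  then show ?case by (simp add: squared_norm_def)
next
  case (Suc m)
  define b1 b2 where "b1 = (real N - real (Suc (2 * m))) / 2" and "b2 = (real N - real (Suc (Suc (2 * m)))) / 2"
  have pos: "b1 > 0" "b2 > 0" "squared_norm (2 * m) > 0"
    using Suc.prems squared_norm_pos[of "2 * m"] by (auto simp: b1_def b2_def)
  have b: "real L - real (Suc m) = b1" "b1 - 1/2 = b2"
    by (simp_all add: b1_def b2_def real_N field_simps)
  have h: "squared_norm (2 * Suc m) = squared_norm (2 * m) * b1 * b2"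
    by (simp add: squared_norm_Suc b1_def b2_def)
  have q0: "dual_hermite (2 * Suc m) 0 = - b1 * dual_hermite (2 * m) 0"
    by (simp add: b1_def)
  show ?case
    unfolding h q0 middle_weight_Suc b using Suc pos by (simp add: field_simps)
qed

text \<open>
  The component of the middle unit vector in the eigenspace for \<open>2 * m\<close>.
\<close>
definition mode :: "nat \<Rightarrow> nat \<Rightarrow> real" where
  "mode m i = dual_hermite (2 * m) 0 * dual_hermite (2 * m) (z i) / squared_norm (2 * m) / real N"

lemma mode_eigen: "i \<in> {1..N} \<Longrightarrow> stiffness (mode m) i = real (2 * m) * mode m i"
proof -
  assume i: "i \<in> {1..N}"
  let ?c = "dual_hermite (2 * m) 0 / squared_norm (2 * m) / real N"
  have m: "mode m = (\<lambda>i. 0 - (- ?c) * dual_hermite (2 * m) (z i))"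
    by (simp add: mode_def fun_eq_iff)
  have "stiffness (\<lambda>_. 0) i = 0" by (simp add: stiffness_def)
  then show ?thesis
    unfolding m stiffness_inverse_gap_diff using dual_hermite_ladder(1)[OF i, of "2 * m"] by simp
qed

lemma mode_at_middle: "m < L \<Longrightarrow> mode m L = middle_weight L m / real N"
  unfolding mode_def middle_zero[OF N_eq L_pos]
  by (subst weight_at_0) (use N_eq in auto)

text \<open>
  Away from the middle this is the Christoffel-Darboux formula, as \<open>dual_hermite
  N\<close> vanishes on the configuration; at the middle it is the normalisation
  \<open>sum_middle_weight\<close>.
\<close>
lemma sum_mode:
  assumes "i \<in> {1..N}"
  shows "(\<Sum>m<L. mode m i) = (if i = L then 1 else 0)"
proof (cases "i = L")
  case True
  have "(\<Sum>m<L. mode m L) = (\<Sum>m\<le>L - 1. middle_weight L m) / real N"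
    using L_pos by (auto simp: mode_at_middle lessThan_Suc_atMost[symmetric] sum_divide_distrib intro!: sum.cong)
  also have "\<dots> = 1"
    using L_pos by (subst sum_middle_weight) (auto simp: real_N)
  finally show ?thesis using True by simp
next
  case False
  have "z i \<noteq> 0"
    using gap_eq_0_iff[OF assms L_in] False middle_zero[OF N_eq L_pos] by simp
  moreover have "Suc (2 * (L - 1)) = N" using N_eq L_pos by simp
  then have "z i * (\<Sum>m\<le>L - 1. dual_hermite (2 * m) 0 * dual_hermite (2 * m) (z i) / squared_norm (2 * m)) = 0"
    by (subst christoffel_darboux_at_0) (auto simp: dual_hermite_vanishes[OF assms])
  ultimately have "(\<Sum>m\<le>L - 1. dual_hermite (2 * m) 0 * dual_hermite (2 * m) (z i) / squared_norm (2 * m)) = 0"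
    by simp
  moreover have "{..<L} = {..L - 1}" using L_pos by auto
  ultimately show ?thesis
    using False by (simp add: mode_def sum_divide_distrib[symmetric] del: divide_divide_eq_left)
qed

end

context odd_equilibrium begin

section \<open>Transport of the middle unit vector\<close>

text \<open>
  In the time variable \<open>r\<close> with \<open>t = r\<^sup>2\<close> the transport
  equation \<open>dw/dt = A w / (2 * t)\<close> becomes \<open>r * w' = A w\<close>, and the
  solution that is the middle unit vector at \<open>r = T\<close> is a polynomial in
  \<open>r\<close>. This removes the singularity at time \<open>0\<close>.
\<close>
definition path :: "real \<Rightarrow> real \<Rightarrow> nat \<Rightarrow> real" where
  "path T r i = (\<Sum>m<L. (r / T) ^ (2 * m) * mode m i)"

definition path_velocity :: "real \<Rightarrow> real \<Rightarrow> nat \<Rightarrow> real" where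
  "path_velocity T r i = (\<Sum>m<L. real (2 * m) * (r / T) ^ (2 * m - 1) / T * mode m i)"

text \<open>
  The integral of \<open>2 * s * |w s|\<^sup>2\<close> over \<open>{0..r}\<close>, that is, of
  \<open>|w|\<^sup>2\<close> with respect to time. Orthogonality of the modes reduces
  \<open>|w|\<^sup>2\<close> to a single sum.
\<close>
definition path_variance :: "real \<Rightarrow> real \<Rightarrow> real" where
  "path_variance T r = (\<Sum>m<L. r\<^sup>2 * (r / T) ^ (4 * m) / real (2 * m + 1) * mode m L)"

lemma path_at_end: "T > 0 \<Longrightarrow> i \<in> {1..N} \<Longrightarrow> path T T i = (if i = L then 1 else 0)"
  by (simp add: path_def sum_mode)

lemma path_has_derivative:
  "T > 0 \<Longrightarrow> ((\<lambda>r. path T r i) has_real_derivative path_velocity T r i) (at r)"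
  unfolding path_def path_velocity_def
  by (auto intro!: derivative_eq_intros sum.cong)

lemma continuous_path_velocity: "continuous_on UNIV (\<lambda>r. path_velocity T r i)"
  unfolding path_velocity_def by (cases "T = 0") (auto intro!: continuous_intros)

lemma stiffness_sum:
  "stiffness (\<lambda>i. \<Sum>m\<in>S. c m * f m i) i = (\<Sum>m\<in>S. c m * stiffness (f m) i)"
  unfolding stiffness_def
  by (simp add: sum_distrib_left sum_divide_distrib flip: sum_subtractf)
     (subst sum.swap, simp add: algebra_simps diff_divide_distrib)

lemma path_equation:
  assumes "i \<in> {1..N}" "T > 0"
  shows "r * path_velocity T r i = stiffness (path T r) i"
proof -
  have *: "r * (real (2 * m) * (r / T) ^ (2 * m - 1) / T) = (r / T) ^ (2 * m) * real (2 * m)" for m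
    by (cases m) (simp_all add: field_simps)
  have "stiffness (path T r) i = (\<Sum>m<L. (r / T) ^ (2 * m) * stiffness (mode m) i)"
    unfolding path_def[abs_def] by (rule stiffness_sum)
  also have "\<dots> = (\<Sum>m<L. ((r / T) ^ (2 * m) * real (2 * m)) * mode m i)"
    using assms(1) by (simp add: mode_eigen mult.assoc)
  also have "\<dots> = r * path_velocity T r i"
    unfolding path_velocity_def sum_distrib_left *[symmetric] by (simp add: mult.assoc)
  finally show ?thesis ..
qed

lemma path_orthogonal_to_position: "(\<Sum>i=1..N. path T r i * z i) = 0"
proof -
  have "(\<Sum>i=1..N. mode m i * z i) = 0" for m
  proof (rule eigen_orthogonal)
    show "stiffness (mode m) i = real (2 * m) * mode m i" if "i \<in> {1..N}" for i
      using mode_eigen[OF that] .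
    show "stiffness z i = 1 * z i" if "i \<in> {1..N}" for i
      using stiffness_position[OF that] by simp
    show "real (2 * m) \<noteq> 1"
    proof
      assume "real (2 * m) = 1"
      then have "2 * m = 1" by (metis of_nat_1 of_nat_eq_iff)
      then show False by presburger
    qed
  qed
  then have "(\<Sum>m<L. (r / T) ^ (2 * m) * (\<Sum>i=1..N. mode m i * z i)) = 0"
    by simp
  then show ?thesis
    unfolding path_def sum_distrib_left sum_distrib_right
    by (subst sum.swap) (simp add: mult.assoc)
qed

text \<open>
  The mode \<open>m = 0\<close> is constant in \<open>i\<close> and drops out of the
  differences; the others carry a factor \<open>r\<^sup>2\<close> at least. One power of
  \<open>r\<close> is what the comparison with the curve \<open>r * z\<close> needs near time
  \<open>0\<close>.
\<close>
lemma path_gap_bound: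
  assumes "T > 0"
  obtains C where "C \<ge> 0"
    "\<And>r i j. \<lbrakk>0 \<le> r; r \<le> T; i \<in> {1..N}; j \<in> {1..N}\<rbrakk>
       \<Longrightarrow> \<bar>path T r i - path T r j\<bar> \<le> C * r * \<bar>z i - z j\<bar>"
proof
  define K where "K i j = (\<Sum>m<L. \<bar>mode m i - mode m j\<bar>) / \<bar>z i - z j\<bar> / T" for i j
  define C where "C = (\<Sum>i=1..N. \<Sum>j=1..N. K i j)"
  have K_nonneg: "0 \<le> K i j" for i j
    using assms by (auto simp: K_def intro!: divide_nonneg_nonneg sum_nonneg)
  show "C \<ge> 0" unfolding C_def by (intro sum_nonneg K_nonneg)
  fix r i j assume r: "0 \<le> r" "r \<le> T" and ij: "i \<in> {1..N}" "j \<in> {1..N}"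
  show "\<bar>path T r i - path T r j\<bar> \<le> C * r * \<bar>z i - z j\<bar>"
  proof (cases "i = j")
    case False
    then have gap: "\<bar>z i - z j\<bar> > 0" using gap_eq_0_iff[OF ij] by simp
    have "\<bar>path T r i - path T r j\<bar> = \<bar>\<Sum>m<L. (r / T) ^ (2 * m) * (mode m i - mode m j)\<bar>"
      by (simp add: path_def right_diff_distrib sum_subtractf)
    also have "\<dots> \<le> (\<Sum>m<L. \<bar>(r / T) ^ (2 * m) * (mode m i - mode m j)\<bar>)"
      by (rule sum_abs)
    also have "\<dots> \<le> (\<Sum>m<L. (r / T) * \<bar>mode m i - mode m j\<bar>)"
    proof (rule sum_mono)
      fix m
      have "mode 0 i = mode 0 j" by (simp add: mode_def)
      moreover have "(r / T) ^ (2 * m) \<le> r / T" if "m > 0"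
        using power_decreasing[of 1 "2 * m" "r / T"] r assms that by simp
      ultimately show "\<bar>(r / T) ^ (2 * m) * (mode m i - mode m j)\<bar> \<le> (r / T) * \<bar>mode m i - mode m j\<bar>"
        using r assms mult_right_mono[of "(r / T) ^ (2 * m)" "r / T" "\<bar>mode m i - mode m j\<bar>"]
        by (cases "m = 0") (auto simp: abs_mult)
    qed
    also have "\<dots> = K i j * r * \<bar>z i - z j\<bar>"
      using gap by (simp add: K_def sum_distrib_left[symmetric] sum_divide_distrib[symmetric] mult.commute)
    also have "\<dots> \<le> C * r * \<bar>z i - z j\<bar>"
    proof -
      have "K i j \<le> (\<Sum>j=1..N. K i j)"
        using ij by (intro member_le_sum) (auto simp: K_nonneg)
      also have "\<dots> \<le> C"
        unfolding C_def using ij by (intro member_le_sum) (auto intro!: sum_nonneg simp: K_nonneg)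
      finally show ?thesis using r by (intro mult_right_mono) auto
    qed
    finally show ?thesis .
  qed simp
qed

text \<open>
  For \<open>m = n\<close>: by orthogonality the square norm of a mode is its inner product
  with the sum of all modes, which is the middle unit vector.
\<close>
lemma mode_inner:
  assumes "m < L" "n < L"
  shows "(\<Sum>i=1..N. mode m i * mode n i) = (if m = n then mode m L else 0)"
proof -
  have orth: "(\<Sum>i=1..N. mode a i * mode b i) = 0" if "a \<noteq> b" for a b
    by (rule eigen_orthogonal[OF mode_eigen mode_eigen]) (use that in auto)
  have "(\<Sum>i=1..N. mode m i * mode m i) = (\<Sum>n<L. \<Sum>i=1..N. mode m i * mode n i)"
    using assms orth by (subst sum.remove[of _ m]) (auto intro!: sum.neutral)
  also have "\<dots> = (\<Sum>i=1..N. mode m i * (\<Sum>n<L. mode n i))"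
    by (subst sum.swap) (simp add: sum_distrib_left)
  also have "\<dots> = mode m L"
    using L_in by (simp add: sum_mode if_distrib cong: if_cong)
  finally show ?thesis using orth[of m n] by auto
qed

lemma path_norm: "(\<Sum>i=1..N. (path T r i)\<^sup>2) = (\<Sum>m<L. (r / T) ^ (4 * m) * mode m L)"
proof -
  have "(\<Sum>i=1..N. (path T r i)\<^sup>2)
      = (\<Sum>i=1..N. \<Sum>m<L. \<Sum>n<L. (r / T) ^ (2 * m) * (r / T) ^ (2 * n) * (mode m i * mode n i))"
    by (simp add: path_def power2_eq_square sum_product mult_ac)
  also have "\<dots> = (\<Sum>m<L. \<Sum>n<L. \<Sum>i=1..N. (r / T) ^ (2 * m) * (r / T) ^ (2 * n) * (mode m i * mode n i))"
    by (subst sum.swap, rule sum.cong[OF refl], rule sum.swap)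
  also have "\<dots> = (\<Sum>m<L. \<Sum>n<L. (r / T) ^ (2 * m) * (r / T) ^ (2 * n) * (if m = n then mode m L else 0))"
    by (intro sum.cong refl) (simp add: mode_inner sum_distrib_left[symmetric] del: One_nat_def)
  also have "\<dots> = (\<Sum>m<L. (r / T) ^ (4 * m) * mode m L)"
    by (intro sum.cong refl) (simp add: if_distrib[where f = "\<lambda>x. _ * x"] sum.delta power_add[symmetric] cong: if_cong)
  finally show ?thesis .
qed

lemma path_variance_has_derivative:
  assumes "T > 0"
  shows "(path_variance T has_real_derivative 2 * r * (\<Sum>i=1..N. (path T r i)\<^sup>2)) (at r)"
proof -
  have m: "((\<lambda>r. r\<^sup>2 * (r / T) ^ (4 * m) / real (2 * m + 1) * mode m L)
      has_real_derivative 2 * r * ((r / T) ^ (4 * m) * mode m L)) (at r)" for m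
  proof -
    have "r\<^sup>2 * (real (4 * m) * (r / T) ^ (4 * m - 1) * (1 / T)) = r * real (4 * m) * (r / T) ^ (4 * m)"
    proof (cases m)
      case (Suc n)
      then obtain e where "4 * m = Suc e" by simp
      then show ?thesis by (simp add: power2_eq_square)
    qed simp
    moreover have "((\<lambda>r. r\<^sup>2 * (r / T) ^ (4 * m) / real (2 * m + 1) * mode m L)
      has_real_derivative (2 * r * (r / T) ^ (4 * m) + r\<^sup>2 * (real (4 * m) * (r / T) ^ (4 * m - 1) * (1 / T)))
         / real (2 * m + 1) * mode m L) (at r)"
      using assms by (auto intro!: derivative_eq_intros)
    moreover have "(2 * r * (r / T) ^ (4 * m) + r * real (4 * m) * (r / T) ^ (4 * m)) / real (2 * m + 1)
       = 2 * r * (r / T) ^ (4 * m)"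
    proof -
      have "(2 * r * q + r * real (4 * m) * q) / real (2 * m + 1) = 2 * r * q" for q
        by (simp add: field_simps)
      then show ?thesis .
    qed
    ultimately show ?thesis by (simp only: mult.assoc[symmetric])
  qed
  show ?thesis
    unfolding path_norm sum_distrib_left path_variance_def[abs_def]
    by (rule DERIV_sum) (rule m)
qed

lemma path_variance_0: "path_variance T 0 = 0"
  by (simp add: path_variance_def)

lemma path_variance_end:
  "T > 0 \<Longrightarrow> path_variance T T = T\<^sup>2 * ((\<Sum>m<L. middle_weight L m / real (2 * m + 1)) / real N)"
  by (auto simp: path_variance_def mode_at_middle sum_distrib_left sum_divide_distrib intro!: sum.cong)

end

section \<open>Asymptotics of the variance\<close>

lemma middle_weight_ge_1: "m < L \<Longrightarrow> 1 \<le> middle_weight L m"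
proof (induction m)
  case (Suc m)
  have "1 \<le> (real L - real (Suc m)) / (real L - real (Suc m) - 1/2)"
    using Suc.prems by (auto simp: field_simps)
  then have "1 * 1 \<le> middle_weight L m * ((real L - real (Suc m)) / (real L - real (Suc m) - 1/2))"
    using Suc by (intro mult_mono) auto
  then show ?case by (simp add: middle_weight_Suc)
qed simp

lemma middle_weight_le: "m < L \<Longrightarrow> middle_weight L m \<le> real L / (real L - real m)"
proof (induction m)
  case (Suc m)
  define x where "x = real L - real (Suc m)"
  have x: "x \<ge> 1" "real L - real m = x + 1" using Suc.prems by (auto simp: x_def)
  have "middle_weight L (Suc m) = middle_weight L m * (x / (x - 1/2))"
    by (simp add: middle_weight_Suc x_def)
  also have "\<dots> \<le> real L / (x + 1) * (x / (x - 1/2))"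
    using Suc x by (intro mult_right_mono) auto
  also have "\<dots> \<le> real L / (x + 1) * ((x + 1) / x)"
  proof (rule mult_left_mono)
    show "x / (x - 1 / 2) \<le> (x + 1) / x"
      using x by (simp add: divide_simps) (simp add: algebra_simps)
  qed (use x in auto)
  also have "\<dots> = real L / x" using x by simp
  finally show ?case by (simp add: x_def)
qed simp

lemma sum_odd_reciprocals:
  "ln (2 * real n + 1) / 2 \<le> (\<Sum>m<n. 1 / real (2 * m + 1))"
  "n > 0 \<Longrightarrow> (\<Sum>m<n. 1 / real (2 * m + 1)) \<le> 1 + ln (2 * real n - 1) / 2"
proof -
  show "ln (2 * real n + 1) / 2 \<le> (\<Sum>m<n. 1 / real (2 * m + 1))"
  proof (induction n)
    case (Suc n)
    have "ln (2 * real (Suc n) + 1) - ln (2 * real n + 1) = ln ((2 * real (Suc n) + 1) / (2 * real n + 1))"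
      by (subst ln_div) auto
    also have "\<dots> \<le> (2 * real (Suc n) + 1) / (2 * real n + 1) - 1"
      by (rule ln_le_minus_one) auto
    also have "\<dots> = 2 / (2 * real n + 1)"
      by (simp add: field_simps)
    finally show ?case using Suc by (simp add: add.commute)
  qed simp
next
  show "n > 0 \<Longrightarrow> (\<Sum>m<n. 1 / real (2 * m + 1)) \<le> 1 + ln (2 * real n - 1) / 2"
  proof (induction n)
    case (Suc n)
    show ?case
    proof (cases "n = 0")
      case False
      have "ln (2 * real n - 1) - ln (2 * real n + 1) = ln ((2 * real n - 1) / (2 * real n + 1))"
        using False by (subst ln_div) auto
      also have "\<dots> \<le> (2 * real n - 1) / (2 * real n + 1) - 1"
        using False by (intro ln_le_minus_one) auto
      also have "\<dots> = - (2 / (2 * real n + 1))"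
        by (simp add: field_simps)
      finally show ?thesis using Suc False by (simp add: add.commute)
    qed simp
  qed simp
qed

text \<open>
  The weights are close to \<open>1\<close> as long as \<open>m\<close> is much smaller than
  \<open>L\<close>, and the sum of the reciprocals of the odd numbers below \<open>2 *
  L\<close> is \<open>ln L / 2 + O(1)\<close>. The excess \<open>(middle_weight L m - 1) / (2
  * m + 1)\<close> is at most \<open>middle_weight L m / L\<close>: for \<open>2 * m + 1 \<ge>
  L\<close> trivially, for smaller \<open>m\<close> by \<open>middle_weight_le\<close>. Since
  the weights sum to \<open>2 * L - 1\<close>, the excess contributes at most \<open>2\<close>
  in total.
\<close>
lemma middle_weight_sum_asymp:
  "(\<lambda>L. 4 * real L / ln (real L) * ((\<Sum>m<L. middle_weight L m / real (2 * m + 1)) / real (2 * L - 1)))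
     \<longlonglongrightarrow> 1"
proof -
  define S where "S L = (\<Sum>m<L. middle_weight L m / real (2 * m + 1))" for L
  have lower: "ln (real L) / 2 \<le> S L" and upper: "S L \<le> ln (real L) / 2 + 4" if "L \<ge> 2" for L
  proof -
    have "ln (real L) / 2 \<le> ln (2 * real L + 1) / 2"
      using that by simp
    also have "\<dots> \<le> (\<Sum>m<L. 1 / real (2 * m + 1))"
      by (rule sum_odd_reciprocals)
    also have "\<dots> \<le> S L"
      unfolding S_def by (intro sum_mono divide_right_mono middle_weight_ge_1) auto
    finally show "ln (real L) / 2 \<le> S L" .
    have term_bound: "middle_weight L m / real (2 * m + 1) \<le> 1 / real (2 * m + 1) + middle_weight L m / real L"
      if m: "m < L" for m
    proof -
      let ?a = "middle_weight L m"
      have a: "1 \<le> ?a" "?a \<le> real L / (real L - real m)"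
        using middle_weight_ge_1[OF m] middle_weight_le[OF m] by auto
      have "(?a - 1) * real L \<le> ?a * real (2 * m + 1)"
      proof (cases "2 * m + 1 \<ge> L")
        case True
        have "(?a - 1) * real L \<le> ?a * real L" using a by (intro mult_right_mono) auto
        also have "\<dots> \<le> ?a * real (2 * m + 1)" using True a by (intro mult_left_mono) auto
        finally show ?thesis .
      next
        case False
        then have L: "real L \<ge> 2 * real m + 1" by linarith
        have "?a - 1 \<le> real m / (real L - real m)"
          using a(2) m by (simp add: field_simps)
        then have "(?a - 1) * real L \<le> real m / (real L - real m) * real L"
          by (intro mult_right_mono) auto
        also have "\<dots> \<le> real (2 * m + 1)"
        proof -
          have "0 \<le> real m * (real L - 2 * real m - 1)" using L by (intro mult_nonneg_nonneg) auto
          then show ?thesis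
            using m by (simp add: field_simps)
        qed
        also have "\<dots> \<le> ?a * real (2 * m + 1)"
          using a mult_right_mono[of 1 ?a "real (2 * m + 1)"] by simp
        finally show ?thesis .
      qed
      then have "(?a - 1) / real (2 * m + 1) \<le> ?a / real L"
        using m by (subst pos_divide_le_eq) (simp_all add: pos_le_divide_eq)
      then show ?thesis
        by (simp only: diff_divide_distrib)
    qed
    have "S L \<le> (\<Sum>m<L. 1 / real (2 * m + 1) + middle_weight L m / real L)"
      unfolding S_def using term_bound by (intro sum_mono) auto
    also have "\<dots> = (\<Sum>m<L. 1 / real (2 * m + 1)) + (\<Sum>m\<le>L - 1. middle_weight L m) / real L"
      using that by (simp add: sum.distrib sum_divide_distrib[symmetric] lessThan_Suc_atMost[symmetric])
    also have "(\<Sum>m\<le>L - 1. middle_weight L m) / real L \<le> 2"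
      using that by (subst sum_middle_weight) (auto simp: field_simps)
    also have "(\<Sum>m<L. 1 / real (2 * m + 1)) \<le> 1 + ln (2 * real L) / 2"
    proof -
      have "ln (2 * real L - 1) \<le> ln (2 * real L)" using that by (subst ln_le_cancel_iff) auto
      then show ?thesis using sum_odd_reciprocals(2)[of L] that by linarith
    qed
    also have "ln (2 * real L) = ln 2 + ln (real L)"
      using that by (intro ln_mult_pos) auto
    also have "ln (2::real) \<le> 1"
      using ln_le_minus_one[of "2::real"] by simp
    finally show "S L \<le> ln (real L) / 2 + 4" by (simp add: add_divide_distrib)
  qed
  have ln_top: "filterlim (\<lambda>L. ln (real L)) at_top sequentially"
    by (rule filterlim_compose[OF ln_at_top filterlim_real_sequentially])
  have "(\<lambda>L. S L / ln (real L)) \<longlonglongrightarrow> 1/2"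
  proof (rule tendsto_sandwich[where f = "\<lambda>_. 1/2" and h = "\<lambda>L. 1/2 + 4 / ln (real L)"])
    show "(\<lambda>L. 1/2 + 4 / ln (real L)) \<longlonglongrightarrow> 1/2"
      using tendsto_add[OF tendsto_const[of "1/2::real"] tendsto_divide_0[OF tendsto_const[of "4::real"] filterlim_at_top_imp_at_infinity[OF ln_top]]] by simp
    show "\<forall>\<^sub>F L in sequentially. 1/2 \<le> S L / ln (real L)"
      using eventually_ge_at_top[of 2]
    proof eventually_elim
      case (elim L)
      then have "ln (real L) > 0" by simp
      then show ?case using lower[OF elim] by (simp add: field_simps)
    qed
    show "\<forall>\<^sub>F L in sequentially. S L / ln (real L) \<le> 1/2 + 4 / ln (real L)"
      using eventually_ge_at_top[of 2]
    proof eventually_elim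
      case (elim L)
      then have "ln (real L) > 0" by simp
      then show ?case using upper[OF elim] by (simp add: field_simps)
    qed
  qed simp
  moreover have "(\<lambda>L. 4 * real L / real (2 * L - 1)) \<longlonglongrightarrow> 2"
  proof -
    have "(\<lambda>L. 4 / (2 - 1 / real L)) \<longlonglongrightarrow> 4 / (2 - 0)"
      by (intro tendsto_intros lim_1_over_n) auto
    moreover have "\<forall>\<^sub>F L in sequentially. 4 / (2 - 1 / real L) = 4 * real L / real (2 * L - 1)"
      using eventually_ge_at_top[of 1] by eventually_elim (auto simp: field_simps)
    ultimately show ?thesis
      using tendsto_cong by fastforce
  qed
  ultimately have "(\<lambda>L. 4 * real L / real (2 * L - 1) * (S L / ln (real L))) \<longlonglongrightarrow> 2 * (1/2)"
    by (intro tendsto_mult)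
  then show ?thesis by (simp add: S_def mult_ac)
qed

section \<open>Partial derivatives on configuration space\<close>

text \<open>
  Explicit first and second partial derivatives on all of \<open>nat \<Rightarrow>
  real\<close>, in a form that is closed under products and compositions, so that the
  smoothness of a test function and the value of the generator come from the same computation.
\<close>
definition has_partials ::
    "nat \<Rightarrow> ((nat \<Rightarrow> real) \<Rightarrow> real) \<Rightarrow> (nat \<Rightarrow> (nat \<Rightarrow> real) \<Rightarrow> real) \<Rightarrow>
      (nat \<Rightarrow> nat \<Rightarrow> (nat \<Rightarrow> real) \<Rightarrow> real) \<Rightarrow> bool" where
  "has_partials N f g h \<longleftrightarrow> continuous_on UNIV f \<and>
     (\<forall>i\<in>{1..N}. continuous_on UNIV (g i) \<and>
        (\<forall>x. ((\<lambda>s. f (x(i := s))) has_real_derivative g i x) (at (x i))) \<and>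
        (\<forall>j\<in>{1..N}. continuous_on UNIV (h i j) \<and>
           (\<forall>x. ((\<lambda>s. g i (x(j := s))) has_real_derivative h i j x) (at (x j)))))"

lemma has_partialsI:
  assumes "continuous_on UNIV f"
    and "\<And>i. i \<in> {1..N} \<Longrightarrow> continuous_on UNIV (g i)"
    and "\<And>i x. i \<in> {1..N} \<Longrightarrow> ((\<lambda>s. f (x(i := s))) has_real_derivative g i x) (at (x i))"
    and "\<And>i j. i \<in> {1..N} \<Longrightarrow> j \<in> {1..N} \<Longrightarrow> continuous_on UNIV (h i j)"
    and "\<And>i j x. i \<in> {1..N} \<Longrightarrow> j \<in> {1..N} \<Longrightarrow>
           ((\<lambda>s. g i (x(j := s))) has_real_derivative h i j x) (at (x j))"
  shows "has_partials N f g h"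
  using assms by (auto simp: has_partials_def)

lemma has_partialsD:
  assumes "has_partials N f g h"
  shows "continuous_on UNIV f"
    and "i \<in> {1..N} \<Longrightarrow> continuous_on UNIV (g i)"
    and "i \<in> {1..N} \<Longrightarrow> ((\<lambda>s. f (x(i := s))) has_real_derivative g i x) (at (x i))"
    and "i \<in> {1..N} \<Longrightarrow> j \<in> {1..N} \<Longrightarrow> continuous_on UNIV (h i j)"
    and "i \<in> {1..N} \<Longrightarrow> j \<in> {1..N} \<Longrightarrow>
           ((\<lambda>s. g i (x(j := s))) has_real_derivative h i j x) (at (x j))"
  using assms by (auto simp: has_partials_def)

lemma has_partials_partial_deriv:
  assumes "has_partials N f g h" "i \<in> {1..N}"
  shows "partial_deriv i f = g i"
    and "j \<in> {1..N} \<Longrightarrow> partial_deriv j (partial_deriv i f) = h i j"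
proof -
  show 1: "partial_deriv i f = g i"
    using has_partialsD(3)[OF assms] by (auto simp: partial_deriv_def fun_eq_iff intro!: DERIV_imp_deriv)
  show "partial_deriv j (partial_deriv i f) = h i j" if "j \<in> {1..N}"
    unfolding 1 using has_partialsD(5)[OF assms that]
    by (auto simp: partial_deriv_def fun_eq_iff intro!: DERIV_imp_deriv)
qed

lemma C1_funI:
  assumes "continuous_on UNIV f"
    and "\<And>i. i \<in> {1..N} \<Longrightarrow> continuous_on UNIV (g i)"
    and d: "\<And>i x. i \<in> {1..N} \<Longrightarrow> ((\<lambda>s. f (x(i := s))) has_real_derivative g i x) (at (x i))"
  shows "C1_fun N f"
proof -
  have "partial_deriv i f = g i" if "i \<in> {1..N}" for i
    using d[OF that] by (auto simp: partial_deriv_def fun_eq_iff intro!: DERIV_imp_deriv)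
  moreover have "(\<lambda>s. f (x(i := s))) differentiable at (x i)" if "i \<in> {1..N}" for i x
    using d[OF that] unfolding real_differentiable_def by blast
  ultimately show ?thesis
    unfolding C1_fun_def using assms(1,2) continuous_on_subset[OF _ subset_UNIV] by metis
qed

lemma has_partials_C2_fun:
  assumes "has_partials N f g h"
  shows "C2_fun N f"
proof -
  have "C1_fun N f"
    by (rule C1_funI[where g = g]) (auto intro: has_partialsD[OF assms])
  moreover have "C1_fun N (partial_deriv i f)" if i: "i \<in> {1..N}" for i
    unfolding has_partials_partial_deriv(1)[OF assms i]
    by (rule C1_funI[where g = "h i"]) (use i in \<open>auto intro: has_partialsD[OF assms]\<close>)
  ultimately show ?thesis by (simp add: C2_fun_def)
qed

lemma has_partials_const: "has_partials N (\<lambda>_. c) (\<lambda>_ _. 0) (\<lambda>_ _ _. 0)"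
  by (rule has_partialsI) auto

lemma continuous_on_linear_form: "continuous_on S (\<lambda>x. \<Sum>i\<in>I. a i * x i :: real)"
  by (intro continuous_intros continuous_on_subset[OF continuous_on_product_coordinates]) auto

lemma has_partials_linear:
  "has_partials N (\<lambda>x. \<Sum>i=1..N. a i * x i) (\<lambda>i _. a i) (\<lambda>_ _ _. 0)"
proof (rule has_partialsI)
  fix i and x :: "nat \<Rightarrow> real" assume i: "i \<in> {1..N}"
  have *: "((\<lambda>s. a j * (x(i := s)) j) has_real_derivative (if j = i then a j else 0)) (at (x i))" for j
    by (cases "j = i") (auto intro!: derivative_eq_intros)
  have "((\<lambda>s. \<Sum>j=1..N. a j * (x(i := s)) j) has_real_derivative (\<Sum>j=1..N. if j = i then a j else 0)) (at (x i))"
    by (intro DERIV_sum *)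
  then show "((\<lambda>s. \<Sum>j=1..N. a j * (x(i := s)) j) has_real_derivative a i) (at (x i))"
    using i by (simp add: sum.delta)
qed (auto intro: continuous_on_linear_form)

lemma has_partials_sum_squares:
  "has_partials N (\<lambda>x. \<Sum>i=1..N. (x i)\<^sup>2) (\<lambda>i x. 2 * x i) (\<lambda>i j _. if i = j then 2 else 0)"
proof (rule has_partialsI)
  fix i and x :: "nat \<Rightarrow> real" assume i: "i \<in> {1..N}"
  have *: "((\<lambda>s. ((x(i := s)) j)\<^sup>2) has_real_derivative (if j = i then 2 * x j else 0)) (at (x i))" for j
    by (cases "j = i") (auto intro!: derivative_eq_intros)
  have "((\<lambda>s. \<Sum>j=1..N. ((x(i := s)) j)\<^sup>2) has_real_derivative (\<Sum>j=1..N. if j = i then 2 * x j else 0)) (at (x i))"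
    by (intro DERIV_sum *)
  then show "((\<lambda>s. \<Sum>j=1..N. ((x(i := s)) j)\<^sup>2) has_real_derivative 2 * x i) (at (x i))"
    using i by (simp add: sum.delta)
next
  fix i j and x :: "nat \<Rightarrow> real"
  show "((\<lambda>s. 2 * (x(j := s)) i) has_real_derivative (if i = j then 2 else 0)) (at (x j))"
    by (cases "i = j") (auto intro!: derivative_eq_intros)
qed (auto intro!: continuous_intros continuous_on_subset[OF continuous_on_product_coordinates])

lemma has_partials_mult:
  assumes 1: "has_partials N f1 g1 h1" and 2: "has_partials N f2 g2 h2"
  shows "has_partials N (\<lambda>x. f1 x * f2 x) (\<lambda>i x. g1 i x * f2 x + f1 x * g2 i x)
     (\<lambda>i j x. h1 i j x * f2 x + g1 i x * g2 j x + (g1 j x * g2 i x + f1 x * h2 i j x))"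
proof (rule has_partialsI)
  fix i and x :: "nat \<Rightarrow> real" assume i: "i \<in> {1..N}"
  show "((\<lambda>s. f1 (x(i := s)) * f2 (x(i := s))) has_real_derivative g1 i x * f2 x + f1 x * g2 i x) (at (x i))"
    using DERIV_mult[OF has_partialsD(3)[OF 1 i, of x] has_partialsD(3)[OF 2 i, of x]]
    by (simp add: mult.commute)
next
  fix i j and x :: "nat \<Rightarrow> real" assume ij: "i \<in> {1..N}" "j \<in> {1..N}"
  note d = DERIV_mult[OF has_partialsD(5)[OF 1 ij, of x] has_partialsD(3)[OF 2 ij(2), of x]]
    DERIV_mult[OF has_partialsD(3)[OF 1 ij(2), of x] has_partialsD(5)[OF 2 ij, of x]]
  show "((\<lambda>s. g1 i (x(j := s)) * f2 (x(j := s)) + f1 (x(j := s)) * g2 i (x(j := s))) has_real_derivative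
      h1 i j x * f2 x + g1 i x * g2 j x + (g1 j x * g2 i x + f1 x * h2 i j x)) (at (x j))"
    using DERIV_add[OF d] by (simp add: mult.commute)
qed (auto intro!: continuous_intros has_partialsD[OF 1] has_partialsD[OF 2])

lemma has_partials_compose:
  assumes 1: "has_partials N f g h"
    and p1: "\<And>y. (p has_real_derivative p' y) (at y)"
    and p2: "\<And>y. (p' has_real_derivative p'' y) (at y)"
    and p3: "continuous_on UNIV p''"
  shows "has_partials N (\<lambda>x. p (f x)) (\<lambda>i x. p' (f x) * g i x)
     (\<lambda>i j x. p'' (f x) * g j x * g i x + p' (f x) * h i j x)"
proof -
  have c: "continuous_on UNIV p" "continuous_on UNIV p'"
    using DERIV_continuous_on p1 p2 by blast+
  note cc = continuous_on_compose2[OF c(1)] continuous_on_compose2[OF c(2)] continuous_on_compose2[OF p3]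
  show ?thesis
  proof (rule has_partialsI)
    fix i and x :: "nat \<Rightarrow> real" assume i: "i \<in> {1..N}"
    show "((\<lambda>s. p (f (x(i := s)))) has_real_derivative p' (f x) * g i x) (at (x i))"
      using DERIV_chain2[of p "p' (f x)" "\<lambda>s. f (x(i := s))" "x i"] p1 has_partialsD(3)[OF 1 i, of x]
      by simp
  next
    fix i j and x :: "nat \<Rightarrow> real" assume ij: "i \<in> {1..N}" "j \<in> {1..N}"
    have "((\<lambda>s. p' (f (x(j := s)))) has_real_derivative p'' (f x) * g j x) (at (x j))"
      using DERIV_chain2[of p' "p'' (f x)" "\<lambda>s. f (x(j := s))" "x j"] p2 has_partialsD(3)[OF 1 ij(2), of x]
      by simp
    from DERIV_mult[OF this has_partialsD(5)[OF 1 ij, of x]]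
    show "((\<lambda>s. p' (f (x(j := s))) * g i (x(j := s))) has_real_derivative
        p'' (f x) * g j x * g i x + p' (f x) * h i j x) (at (x j))"
      by (simp add: mult.commute)
  qed (auto intro!: continuous_intros cc has_partialsD[OF 1])
qed

section \<open>The Vandermonde product\<close>

definition index_pairs :: "nat \<Rightarrow> (nat \<times> nat) set" where
  "index_pairs N = {(a, b). a \<in> {1..N} \<and> b \<in> {1..N} \<and> a < b}"

lemma finite_index_pairs [simp]: "finite (index_pairs N)"
  by (rule finite_subset[of _ "{1..N} \<times> {1..N}"]) (auto simp: index_pairs_def)

definition vandermonde :: "nat \<Rightarrow> (nat \<Rightarrow> real) \<Rightarrow> real" where
  "vandermonde N x = (\<Prod>(a, b)\<in>index_pairs N. x a - x b)"

definition inv_gap_sum :: "nat \<Rightarrow> (nat \<Rightarrow> real) \<Rightarrow> nat \<Rightarrow> real" where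
  "inv_gap_sum N x i = (\<Sum>j=1..N. 1 / (x i - x j))"

lemma vandermonde_nonzero_iff: "vandermonde N x \<noteq> 0 \<longleftrightarrow> inj_on x {1..N}"
proof -
  have "vandermonde N x \<noteq> 0 \<longleftrightarrow> (\<forall>(a, b)\<in>index_pairs N. x a \<noteq> x b)"
    by (auto simp: vandermonde_def prod_zero_iff split: prod.splits)
  also have "\<dots> \<longleftrightarrow> inj_on x {1..N}"
  proof
    assume distinct: "\<forall>(a, b)\<in>index_pairs N. x a \<noteq> x b"
    show "inj_on x {1..N}"
    proof (rule inj_onI, rule ccontr)
      fix a b assume "a \<in> {1..N}" "b \<in> {1..N}" "x a = x b" "a \<noteq> b"
      then have "(a, b) \<in> index_pairs N \<or> (b, a) \<in> index_pairs N"
        by (auto simp: index_pairs_def)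
      then show False
        using distinct \<open>x a = x b\<close> by force
    qed
  next
    assume "inj_on x {1..N}"
    then show "\<forall>(a, b)\<in>index_pairs N. x a \<noteq> x b"
      unfolding index_pairs_def by (auto dest!: inj_onD)
  qed
  finally show ?thesis .
qed

text \<open>
  Multiplying \<open>1 / (x i - x j)\<close> by the square of the Vandermonde product leaves a
  continuous function that vanishes on the walls, in agreement with \<open>1 / 0 = 0\<close>.
\<close>
lemma vandermonde_factor:
  assumes "i \<in> {1..N}" "j \<in> {1..N}" "i \<noteq> j"
  obtains P where "continuous_on UNIV P" "\<And>x. vandermonde N x = (x i - x j) * P x"
proof -
  note result = that
  have *: thesis if ab: "(a, b) \<in> index_pairs N" and "(a = i \<and> b = j) \<or> (a = j \<and> b = i)" for a b
  proof -
    define P where "P x = (\<Prod>(a, b)\<in>index_pairs N - {(a, b)}. x a - x b)" for x :: "nat \<Rightarrow> real"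
    have P: "continuous_on UNIV P"
      unfolding P_def by (intro continuous_intros) (auto split: prod.splits intro!: continuous_intros)
    have v: "vandermonde N x = (x a - x b) * P x" for x
      unfolding vandermonde_def P_def using prod.remove[OF finite_index_pairs ab, of "\<lambda>(a, b). x a - x b"] by simp
    show thesis
    proof (cases "a = i \<and> b = j")
      case True then show thesis using result[OF P] v by auto
    next
      case False
      show thesis
        by (rule result[of "\<lambda>x. - P x"]) (use P v False \<open>_ \<or> _\<close> in \<open>auto intro!: continuous_intros simp: algebra_simps\<close>)
    qed
  qed
  show thesis
    using assms *[of i j] *[of j i] by (cases "i < j") (auto simp: index_pairs_def)
qed

lemma has_partials_vandermonde: "\<exists>g h. has_partials N (vandermonde N) g h"
proof -
  have "finite S \<Longrightarrow> S \<subseteq> index_pairs N \<Longrightarrow> \<exists>g h. has_partials N (\<lambda>x. \<Prod>(a, b)\<in>S. x a - x b) g h" for S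
  proof (induction S rule: finite_induct)
    case empty
    show ?case using has_partials_const by auto
  next
    case (insert p S)
    obtain a b where p: "p = (a, b)" by force
    obtain g h where gh: "has_partials N (\<lambda>x. \<Prod>(a, b)\<in>S. x a - x b) g h"
      using insert by auto
    have "(\<Sum>i=1..N. (if i = a then 1 else if i = b then -1 else 0) * x i) = x a - x b" for x :: "nat \<Rightarrow> real"
    proof -
      have "(\<Sum>i=1..N. (if i = a then 1 else if i = b then -1 else 0) * x i)
         = (\<Sum>i=1..N. (if i = a then x i else 0) - (if i = b then x i else 0))"
        using insert.prems p by (intro sum.cong) (auto simp: index_pairs_def)
      then show ?thesis
        using insert.prems p by (simp add: sum_subtractf index_pairs_def)
    qed
    then show ?case
      using has_partials_mult[OF has_partials_linear[of N "\<lambda>i. if i = a then 1 else if i = b then -1 else 0"] gh] insert.hyps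
      by (auto simp: p)
  qed
  from this[of "index_pairs N"] show ?thesis
    by (simp add: vandermonde_def[abs_def])
qed

lemma vandermonde_log_derivative:
  assumes "i \<in> {1..N}" "vandermonde N x \<noteq> 0"
  shows "((\<lambda>s. vandermonde N (x(i := s))) has_real_derivative vandermonde N x * inv_gap_sum N x i) (at (x i))"
proof -
  define c where "c a b = (if a = i then 1 else if b = i then -1 else 0 :: real)" for a b :: nat
  have nz: "x a - x b \<noteq> 0" if "(a, b) \<in> index_pairs N" for a b
    using assms(2) that by (auto simp: vandermonde_def prod_zero_iff)
  have "((\<lambda>s. vandermonde N (x(i := s))) has_real_derivative
      (\<Prod>p\<in>index_pairs N. case p of (a, b) \<Rightarrow> (x(i := x i)) a - (x(i := x i)) b)
       * (\<Sum>p\<in>index_pairs N. c (fst p) (snd p) / (case p of (a, b) \<Rightarrow> (x(i := x i)) a - (x(i := x i)) b))) (at (x i))"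
    unfolding vandermonde_def
  proof (rule has_field_derivative_prod')
    fix p assume p: "p \<in> index_pairs N"
    obtain a b where ab: "p = (a, b)" by force
    show "(case p of (a, b) \<Rightarrow> (x(i := x i)) a - (x(i := x i)) b) \<noteq> 0"
      using nz p ab by auto
    show "((\<lambda>s. case p of (a, b) \<Rightarrow> (x(i := s)) a - (x(i := s)) b) has_real_derivative c (fst p) (snd p)) (at (x i))"
      using p by (auto simp: ab c_def index_pairs_def intro!: derivative_eq_intros)
  qed
  moreover have "(\<Sum>p\<in>index_pairs N. c (fst p) (snd p) / (case p of (a, b) \<Rightarrow> (x(i := x i)) a - (x(i := x i)) b))
      = inv_gap_sum N x i"
  proof -
    have "(\<Sum>p\<in>index_pairs N. c (fst p) (snd p) / (case p of (a, b) \<Rightarrow> (x(i := x i)) a - (x(i := x i)) b))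
       = (\<Sum>(a, b)\<in>index_pairs N. c a b / (x a - x b))"
      by (intro sum.cong) auto
    also have "\<dots> = (\<Sum>a=1..N. \<Sum>b=1..N. if a < b then c a b / (x a - x b) else 0)"
      unfolding index_pairs_def sum.cartesian_product
      by (rule sum.mono_neutral_cong_left) (auto split: if_splits)
    also have "\<dots> = (\<Sum>a=1..N. \<Sum>b=1..N. (if a = i then if a < b then 1 / (x a - x b) else 0 else 0)
          + (if b = i then if a < b then - 1 / (x a - x b) else 0 else 0))"
      by (intro sum.cong refl) (auto simp: c_def)
    also have "\<dots> = (\<Sum>b=1..N. if i < b then 1 / (x i - x b) else 0) + (\<Sum>a=1..N. if a < i then - 1 / (x a - x i) else 0)"
    proof -
      have "(\<Sum>a=1..N. \<Sum>b=1..N. if a = i then if a < b then 1 / (x a - x b) else 0 else 0)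
          = (\<Sum>a=1..N. if a = i then \<Sum>b=1..N. if i < b then 1 / (x i - x b) else 0 else 0)"
        by (intro sum.cong) auto
      then show ?thesis using assms(1) by (simp add: sum.distrib)
    qed
    also have "\<dots> = inv_gap_sum N x i"
      unfolding inv_gap_sum_def sum.distrib[symmetric]
    proof (intro sum.cong refl)
      fix j
      show "(if i < j then 1 / (x i - x j) else 0) + (if j < i then - 1 / (x j - x i) else 0) = 1 / (x i - x j)"
        by (cases i j rule: linorder_cases) (auto simp: minus_divide_left[symmetric] minus_divide_right)
    qed
    finally show ?thesis .
  qed
  ultimately show ?thesis by (simp add: vandermonde_def)
qed

lemma continuous_vandermonde: "continuous_on UNIV (vandermonde N)"
  using has_partials_vandermonde[of N] has_partialsD(1) by blast

lemma continuous_on_coordinate [continuous_intros]: "continuous_on S (\<lambda>x :: nat \<Rightarrow> real. x i)"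
  by (rule continuous_on_subset[OF continuous_on_product_coordinates]) simp

section \<open>The generator on products\<close>

lemma generator_eq:
  assumes "has_partials N f g h"
  shows "bessel_generator_A N k f x
    = 1/2 * (\<Sum>i=1..N. h i i x) + k * (\<Sum>i=1..N. inv_gap_sum N x i * g i x)"
proof -
  have "(\<Sum>j\<in>{1..N} - {i}. 1 / (x i - x j)) = inv_gap_sum N x i" if "i \<in> {1..N}" for i
    using that unfolding inv_gap_sum_def by (subst sum.remove[of "{1..N}" i]) auto
  then show ?thesis
    unfolding bessel_generator_A_def
    using has_partials_partial_deriv[OF assms] by simp
qed

lemma generator_mult:
  assumes 1: "has_partials N f1 g1 h1" and 2: "has_partials N f2 g2 h2"
  shows "bessel_generator_A N k (\<lambda>x. f1 x * f2 x) x
    = f1 x * bessel_generator_A N k f2 x + f2 x * bessel_generator_A N k f1 x + (\<Sum>i=1..N. g1 i x * g2 i x)"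
  unfolding generator_eq[OF has_partials_mult[OF 1 2]] generator_eq[OF 1] generator_eq[OF 2]
  by (simp add: sum.distrib sum_distrib_left algebra_simps)

section \<open>Cut-off profiles\<close>

lemma pos_part_power_derivative:
  assumes "n \<ge> 2"
  shows "((\<lambda>y::real. (max 0 y) ^ n) has_real_derivative real n * (max 0 y) ^ (n - 1)) (at y)"
proof (cases y "0::real" rule: linorder_cases)
  case less
  have "((\<lambda>_. 0) has_real_derivative 0) (at y)" by simp
  then have "((\<lambda>y::real. (max 0 y) ^ n) has_real_derivative 0) (at y)"
    by (rule has_field_derivative_transform_within_open[of _ _ _ "{..<0}"]) (use less assms in auto)
  then show ?thesis using less assms by (simp add: power_0_left)
next
  case greater
  have "((\<lambda>y. y ^ n) has_real_derivative real n * y ^ (n - 1)) (at y)"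
    by (auto intro!: derivative_eq_intros)
  then have "((\<lambda>y::real. (max 0 y) ^ n) has_real_derivative real n * y ^ (n - 1)) (at y)"
    by (rule has_field_derivative_transform_within_open[of _ _ _ "{0<..}"]) (use greater in auto)
  then show ?thesis using greater by simp
next
  case equal
  have "(\<lambda>h::real. (max 0 h) ^ n / h) \<midarrow>0\<rightarrow> 0"
  proof (rule Lim_null_comparison)
    show "(\<lambda>h::real. \<bar>h\<bar>) \<midarrow>0\<rightarrow> 0"
      using tendsto_rabs[OF tendsto_ident_at[of "0::real" UNIV]] by simp
    have "\<bar>(max 0 h) ^ n / h\<bar> \<le> \<bar>h\<bar>" if "\<bar>h\<bar> < 1" for h :: real
    proof (cases "h > 0")
      case True
      have "h ^ n \<le> h ^ 2" using True that assms by (intro power_decreasing) auto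
      then show ?thesis using True by (simp add: power2_eq_square divide_le_eq)
    qed (use assms in \<open>auto simp: max_def power_0_left\<close>)
    then show "\<forall>\<^sub>F h in at 0. norm ((max 0 h) ^ n / h :: real) \<le> \<bar>h\<bar>"
      by (auto simp: eventually_at intro!: exI[of _ 1])
  qed
  then show ?thesis using equal assms by (simp add: DERIV_def power_0_left)
qed

text \<open>
  The exponent \<open>4\<close> makes the profile and its first two derivatives vanish at
  \<open>0\<close> so fast that the singular drift terms stay continuous up to the walls.
\<close>
definition wall_cutoff :: "real \<Rightarrow> real \<Rightarrow> real" where
  "wall_cutoff \<delta> u = u ^ 4 / (u ^ 4 + \<delta>)"

definition wall_cutoff' :: "real \<Rightarrow> real \<Rightarrow> real" where
  "wall_cutoff' \<delta> u = 4 * \<delta> * u ^ 3 / (u ^ 4 + \<delta>)\<^sup>2"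

definition wall_cutoff'' :: "real \<Rightarrow> real \<Rightarrow> real" where
  "wall_cutoff'' \<delta> u = 4 * \<delta> * (3 * u\<^sup>2 * (u ^ 4 + \<delta>) - 8 * u ^ 6) / (u ^ 4 + \<delta>) ^ 3"

text \<open>
  A compactly supported \<open>C\<^sup>2\<close> profile in the squared radius whose first
  derivative is of order \<open>1 / R\<close> and whose second derivative is nonnegative.
\<close>
definition ball_cutoff :: "real \<Rightarrow> real \<Rightarrow> real" where
  "ball_cutoff R v = (max 0 (1 - v / R)) ^ 3"

definition ball_cutoff' :: "real \<Rightarrow> real \<Rightarrow> real" where
  "ball_cutoff' R v = - (3 / R) * (max 0 (1 - v / R))\<^sup>2"

definition ball_cutoff'' :: "real \<Rightarrow> real \<Rightarrow> real" where
  "ball_cutoff'' R v = 6 / R\<^sup>2 * max 0 (1 - v / R)"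

lemma denominator_pos: "0 < \<delta> \<Longrightarrow> 0 < u ^ 4 + (\<delta>::real)"
  using zero_le_even_power'[of u 2] by (simp add: add_nonneg_pos)

lemma wall_cutoff_derivatives:
  assumes "0 < \<delta>"
  shows "(wall_cutoff \<delta> has_real_derivative wall_cutoff' \<delta> u) (at u)"
    and "(wall_cutoff' \<delta> has_real_derivative wall_cutoff'' \<delta> u) (at u)"
    and "continuous_on UNIV (wall_cutoff'' \<delta>)"
proof -
  have nz: "u ^ 4 + \<delta> \<noteq> 0" for u using denominator_pos[OF assms, of u] by simp
  show "(wall_cutoff \<delta> has_real_derivative wall_cutoff' \<delta> u) (at u)"
    unfolding wall_cutoff_def[abs_def] wall_cutoff'_def
    by (rule derivative_eq_intros refl nz)+ (simp add: power2_eq_square algebra_simps)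
  have num: "((\<lambda>u. 4 * \<delta> * u ^ 3) has_real_derivative 4 * \<delta> * (3 * u\<^sup>2)) (at u)"
    and den: "((\<lambda>u. (u ^ 4 + \<delta>)\<^sup>2) has_real_derivative 2 * (4 * u ^ 3) * (u ^ 4 + \<delta>)) (at u)"
    by (auto intro!: derivative_eq_intros)
  have *: "(4 * \<delta> * (3 * u\<^sup>2) * d\<^sup>2 - 4 * \<delta> * u ^ 3 * (2 * (4 * u ^ 3) * d)) / (d\<^sup>2 * d\<^sup>2)
       = 4 * \<delta> * (3 * u\<^sup>2 * d - 8 * u ^ 6) / d ^ 3" if "d \<noteq> 0" for d
    using that by (simp add: field_simps power_numeral_reduce)
  show "(wall_cutoff' \<delta> has_real_derivative wall_cutoff'' \<delta> u) (at u)"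
    using DERIV_divide[OF num den] nz[of u]
    unfolding wall_cutoff'_def[abs_def] wall_cutoff''_def *[OF nz, symmetric] by simp
  show "continuous_on UNIV (wall_cutoff'' \<delta>)"
    unfolding wall_cutoff''_def[abs_def] using nz by (intro continuous_intros) auto
qed

lemma ball_cutoff_derivatives:
  assumes "0 < R"
  shows "(ball_cutoff R has_real_derivative ball_cutoff' R v) (at v)"
    and "(ball_cutoff' R has_real_derivative ball_cutoff'' R v) (at v)"
    and "continuous_on UNIV (ball_cutoff'' R)"
proof -
  have lin: "((\<lambda>v. 1 - v / R) has_real_derivative - (1 / R)) (at v)"
    using assms by (auto intro!: derivative_eq_intros)
  show "(ball_cutoff R has_real_derivative ball_cutoff' R v) (at v)"
    using DERIV_chain2[OF pos_part_power_derivative[of 3 "1 - v / R"] lin]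
    by (simp add: ball_cutoff_def[abs_def] ball_cutoff'_def)
  show "(ball_cutoff' R has_real_derivative ball_cutoff'' R v) (at v)"
    using DERIV_cmult[OF DERIV_chain2[OF pos_part_power_derivative[of 2 "1 - v / R"] lin], of "- (3 / R)"]
    by (simp add: ball_cutoff'_def[abs_def] ball_cutoff''_def power2_eq_square)
  show "continuous_on UNIV (ball_cutoff'' R)"
    unfolding ball_cutoff''_def[abs_def] using assms by (intro continuous_intros) auto
qed

lemma wall_cutoff_bounds:
  assumes "0 < \<delta>"
  shows "0 \<le> wall_cutoff \<delta> u" "wall_cutoff \<delta> u \<le> 1" "0 \<le> wall_cutoff' \<delta> u * u" "wall_cutoff' \<delta> u * u \<le> 1"
proof -
  have d: "0 < u ^ 4 + \<delta>" and u: "0 \<le> u ^ 4"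
    using denominator_pos[OF assms] zero_le_even_power'[of u 2] by auto
  show "0 \<le> wall_cutoff \<delta> u" "wall_cutoff \<delta> u \<le> 1"
    unfolding wall_cutoff_def using u assms
    by (simp, simp add: pos_divide_le_eq[OF d])
  have e: "wall_cutoff' \<delta> u * u = 4 * \<delta> * u ^ 4 / (u ^ 4 + \<delta>)\<^sup>2"
    by (simp add: wall_cutoff'_def power_numeral_reduce)
  show "0 \<le> wall_cutoff' \<delta> u * u" unfolding e using d u assms by auto
  have "0 \<le> (u ^ 4 - \<delta>)\<^sup>2" by simp
  then have "4 * \<delta> * u ^ 4 \<le> (u ^ 4 + \<delta>)\<^sup>2" by (simp add: power2_eq_square algebra_simps)
  then show "wall_cutoff' \<delta> u * u \<le> 1"
    unfolding e using d by (simp add: divide_le_eq)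
qed

text \<open>
  On functions of a harmonic \<open>D\<close> with \<open>\<nabla>D = D * u\<close> the
  generator acts as the radial operator \<open>f'' / 2 + k * f' / D\<close> times
  \<open>|\<nabla>D|\<^sup>2\<close>. The inequality says that \<open>D powr (2 * k)\<close>
  times the derivative of the profile is increasing, which for this profile requires \<open>2
  * k + 3 \<ge> 8\<close>.
\<close>
lemma wall_cutoff_subharmonic:
  assumes "0 < \<delta>" "5/2 \<le> k"
  shows "0 \<le> wall_cutoff'' \<delta> u * u\<^sup>2 / 2 + k * (wall_cutoff' \<delta> u * u)"
proof -
  define d where "d = u ^ 4 + \<delta>"
  have d: "0 < d" and u: "0 \<le> u ^ 4"
    using denominator_pos[OF assms(1)] zero_le_even_power'[of u 2] by (auto simp: d_def)
  have "u ^ 4 \<le> d" using assms(1) by (simp add: d_def)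
  have eq: "wall_cutoff'' \<delta> u * u\<^sup>2 / 2 + k * (wall_cutoff' \<delta> u * u)
      = 4 * \<delta> * u ^ 4 / d ^ 3 * ((3 * d - 8 * u ^ 4) / 2 + k * d)"
    using d unfolding wall_cutoff''_def wall_cutoff'_def d_def[symmetric]
    by (simp add: field_simps power_numeral_reduce)
  have "5/2 * d \<le> k * d" using assms(2) d by (intro mult_right_mono) auto
  moreover have "0 \<le> (3 * d - 8 * q) / 2 + w" if "5/2 * d \<le> w" "q \<le> d" for q w
    using that by (simp add: field_simps)
  ultimately have "0 \<le> (3 * d - 8 * u ^ 4) / 2 + k * d"
    using \<open>u ^ 4 \<le> d\<close> by blast
  then show ?thesis unfolding eq using d u assms(1) by simp
qed

lemma ball_cutoff_bounds:
  assumes "0 < R" "0 \<le> v"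
  shows "0 \<le> ball_cutoff R v" "ball_cutoff R v \<le> 1" "ball_cutoff' R v \<le> 0" "- (3 / R) \<le> ball_cutoff' R v"
    "0 \<le> ball_cutoff'' R v"
proof -
  have "0 \<le> max 0 (1 - v / R)" "max 0 (1 - v / R) \<le> 1" using assms by auto
  then have "(max 0 (1 - v / R)) ^ 3 \<le> 1" "(max 0 (1 - v / R))\<^sup>2 \<le> 1"
    by (auto intro: power_le_one)
  then show "0 \<le> ball_cutoff R v" "ball_cutoff R v \<le> 1" "ball_cutoff' R v \<le> 0" "- (3 / R) \<le> ball_cutoff' R v"
    "0 \<le> ball_cutoff'' R v"
    using assms by (auto simp: ball_cutoff_def ball_cutoff'_def ball_cutoff''_def mult_le_cancel_left2 divide_simps)
qed

lemma ball_cutoff_outside: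
  assumes "0 < R" "R \<le> v"
  shows "ball_cutoff R v = 0" "ball_cutoff' R v = 0" "ball_cutoff'' R v = 0"
  using assms by (auto simp: ball_cutoff_def ball_cutoff'_def ball_cutoff''_def max_def field_simps)

section \<open>Harmonicity of the Vandermonde product\<close>

text \<open>
  The mixed terms cancel in cyclic triples, by \<open>1 / ((a - b) * (a - c)) + 1 / ((b - c) *
  (b - a)) + 1 / ((c - a) * (c - b)) = 0\<close>.
\<close>
lemma sum_inv_gap_squared:
  fixes x :: "nat \<Rightarrow> real"
  assumes inj: "inj_on x {1..N}"
  shows "(\<Sum>i=1..N. (inv_gap_sum N x i)\<^sup>2) = (\<Sum>i=1..N. \<Sum>j=1..N. 1 / (x i - x j)\<^sup>2)"
proof -
  define s where "s i j l = (if j \<noteq> l then 1 / (x i - x j) * (1 / (x i - x l)) else 0)" for i j l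
  have cyc: "s i j l + s j l i + s l i j = 0" if ijl: "i \<in> {1..N}" "j \<in> {1..N}" "l \<in> {1..N}" for i j l
  proof -
    have "1 / (a - b) * (1 / (a - c)) + 1 / (b - c) * (1 / (b - a)) + 1 / (c - a) * (1 / (c - b)) = 0"
      if "a \<noteq> b" "b \<noteq> c" "a \<noteq> c" for a b c :: real
      using that by (simp add: divide_simps) (simp add: algebra_simps)
    moreover have "x a = x b \<longleftrightarrow> a = b" if "a \<in> {1..N}" "b \<in> {1..N}" for a b
      using inj that by (auto dest: inj_onD)
    ultimately show ?thesis
      using ijl by (cases "i = j"; cases "j = l"; cases "i = l") (simp_all add: s_def)
  qed
  define S where "S = (\<Sum>i=1..N. \<Sum>j=1..N. \<Sum>l=1..N. s i j l)"
  have "S = (\<Sum>j=1..N. \<Sum>i=1..N. \<Sum>l=1..N. s j l i)"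
    unfolding S_def by (rule sum.cong[OF refl], rule sum.swap)
  then have 1: "S = (\<Sum>i=1..N. \<Sum>j=1..N. \<Sum>l=1..N. s j l i)"
    by (subst sum.swap) simp
  have "S = (\<Sum>i=1..N. \<Sum>l=1..N. \<Sum>j=1..N. s l i j)"
    unfolding S_def by (rule sum.swap)
  moreover have "(\<Sum>l=1..N. \<Sum>j=1..N. s l i j) = (\<Sum>j=1..N. \<Sum>l=1..N. s l i j)" for i
    by (rule sum.swap)
  ultimately have 2: "S = (\<Sum>i=1..N. \<Sum>j=1..N. \<Sum>l=1..N. s l i j)"
    by simp
  have "S + S + S = (\<Sum>i=1..N. \<Sum>j=1..N. \<Sum>l=1..N. s i j l + s j l i + s l i j)"
    by (simp only: sum.distrib S_def[symmetric] 1[symmetric] 2[symmetric])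
  then have "S + S + S = 0" using cyc by simp
  then have "S = 0" by simp
  have "(inv_gap_sum N x i)\<^sup>2 = (\<Sum>j=1..N. \<Sum>l=1..N. s i j l) + (\<Sum>j=1..N. 1 / (x i - x j)\<^sup>2)" for i
  proof -
    have "(inv_gap_sum N x i)\<^sup>2 = (\<Sum>j=1..N. \<Sum>l=1..N. 1 / (x i - x j) * (1 / (x i - x l)))"
      by (simp add: inv_gap_sum_def power2_eq_square sum_product)
    also have "\<dots> = (\<Sum>j=1..N. \<Sum>l=1..N. s i j l + (if j = l then 1 / (x i - x j)\<^sup>2 else 0))"
      by (intro sum.cong refl) (simp add: s_def power2_eq_square)
    finally show ?thesis by (simp add: sum.distrib)
  qed
  then show ?thesis using \<open>S = 0\<close> by (simp add: S_def sum.distrib)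
qed

definition vandermonde_grad :: "nat \<Rightarrow> nat \<Rightarrow> (nat \<Rightarrow> real) \<Rightarrow> real" where
  "vandermonde_grad N i = partial_deriv i (vandermonde N)"

text \<open>
  The derivatives of the Vandermonde product exist everywhere, but they have a simple form
  only where the product is nonzero. On the walls the wall profile multiplies them by
  \<open>0\<close>.
\<close>
definition vandermonde_hess :: "nat \<Rightarrow> nat \<Rightarrow> nat \<Rightarrow> (nat \<Rightarrow> real) \<Rightarrow> real" where
  "vandermonde_hess N i j = partial_deriv j (vandermonde_grad N i)"

lemma vandermonde_partials: "has_partials N (vandermonde N) (vandermonde_grad N) (vandermonde_hess N)"
proof -
  obtain g h where gh: "has_partials N (vandermonde N) g h"
    using has_partials_vandermonde by blast
  then show ?thesis
    unfolding has_partials_def vandermonde_grad_def vandermonde_hess_def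
    using has_partials_partial_deriv[OF gh] by (auto simp: has_partials_def)
qed

lemma vandermonde_grad_eq:
  assumes "i \<in> {1..N}" "vandermonde N x \<noteq> 0"
  shows "vandermonde_grad N i x = vandermonde N x * inv_gap_sum N x i"
  using DERIV_unique[OF has_partialsD(3)[OF vandermonde_partials assms(1)] vandermonde_log_derivative[OF assms]] .

lemma vandermonde_hess_eq:
  assumes i: "i \<in> {1..N}" and D: "vandermonde N x \<noteq> 0"
  shows "vandermonde_hess N i i x
    = vandermonde N x * ((inv_gap_sum N x i)\<^sup>2 - (\<Sum>j=1..N. 1 / (x i - x j)\<^sup>2))"
proof -
  have inj: "inj_on x {1..N}" using D vandermonde_nonzero_iff by blast
  have u: "((\<lambda>s. inv_gap_sum N (x(i := s)) i) has_real_derivative (\<Sum>j=1..N. - (1 / (x i - x j)\<^sup>2))) (at (x i))"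
    unfolding inv_gap_sum_def
  proof (rule DERIV_sum)
    fix j assume j: "j \<in> {1..N}"
    show "((\<lambda>s. 1 / ((x(i := s)) i - (x(i := s)) j)) has_real_derivative - (1 / (x i - x j)\<^sup>2)) (at (x i))"
    proof (cases "j = i")
      case False
      then have "x i - x j \<noteq> 0" using inj_onD[OF inj, of i j] i j by auto
      then show ?thesis using False
        by (auto intro!: derivative_eq_intros simp: power2_eq_square)
    qed simp
  qed
  have v: "((\<lambda>s. vandermonde N (x(i := s)) * inv_gap_sum N (x(i := s)) i) has_real_derivative
      vandermonde N x * inv_gap_sum N x i * inv_gap_sum N x i
        + (\<Sum>j=1..N. - (1 / (x i - x j)\<^sup>2)) * vandermonde N x) (at (x i))"
    using DERIV_mult[OF vandermonde_log_derivative[OF i D] u] by simp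
  have "((\<lambda>s. vandermonde N (x(i := s))) \<longlongrightarrow> vandermonde N (x(i := x i))) (at (x i))"
    using DERIV_isCont[OF vandermonde_log_derivative[OF i D]] by (simp add: isCont_def)
  then have "\<forall>\<^sub>F s in at (x i). vandermonde N (x(i := s)) \<noteq> 0"
    using D by (intro tendsto_imp_eventually_ne) auto
  then have "\<forall>\<^sub>F s in nhds (x i). vandermonde N (x(i := s)) \<noteq> 0"
    using D by (simp add: eventually_nhds_conv_at)
  then have ev: "\<forall>\<^sub>F s in nhds (x i). vandermonde N (x(i := s)) * inv_gap_sum N (x(i := s)) i = vandermonde_grad N i (x(i := s))"
    by eventually_elim (simp add: vandermonde_grad_eq[OF i])
  have "((\<lambda>s. vandermonde_grad N i (x(i := s))) has_real_derivative
      vandermonde N x * inv_gap_sum N x i * inv_gap_sum N x i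
        + (\<Sum>j=1..N. - (1 / (x i - x j)\<^sup>2)) * vandermonde N x) (at (x i))"
    using DERIV_cong_ev[OF refl ev refl] v by simp
  from DERIV_unique[OF has_partialsD(5)[OF vandermonde_partials i i, of x] this]
  show ?thesis by (simp add: sum_negf power2_eq_square algebra_simps)
qed

lemma vandermonde_harmonic:
  assumes "vandermonde N x \<noteq> 0"
  shows "(\<Sum>i=1..N. vandermonde_hess N i i x) = 0"
proof -
  have "(\<Sum>i=1..N. vandermonde_hess N i i x)
      = (\<Sum>i=1..N. vandermonde N x * ((inv_gap_sum N x i)\<^sup>2 - (\<Sum>j=1..N. 1 / (x i - x j)\<^sup>2)))"
    by (intro sum.cong refl) (rule vandermonde_hess_eq[OF _ assms])
  also have "\<dots> = 0"
    using assms sum_inv_gap_squared[of x N] vandermonde_nonzero_iff[of N x]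
    by (simp only: sum_distrib_left[symmetric] sum_subtractf) simp
  finally show ?thesis .
qed

lemma sum_inv_gap_mult:
  "(\<Sum>i=1..N. a i * inv_gap_sum N x i) = 1/2 * (\<Sum>i=1..N. \<Sum>j=1..N. (a i - a j) / (x i - x j))"
  unfolding inv_gap_sum_def
  by (subst antisym_double_sum) (auto simp: minus_divide_right)

lemma sum_inv_gap_position:
  assumes "vandermonde N x \<noteq> 0"
  shows "(\<Sum>i=1..N. x i * inv_gap_sum N x i) = real (N * (N - 1)) / 2"
proof -
  have inj: "inj_on x {1..N}" using assms vandermonde_nonzero_iff by blast
  have "(\<Sum>j=1..N. (x i - x j) / (x i - x j)) = real (N - 1)" if i: "i \<in> {1..N}" for i
  proof -
    have "(\<Sum>j=1..N. (x i - x j) / (x i - x j)) = (\<Sum>j\<in>{1..N} - {i}. (x i - x j) / (x i - x j))"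
      using i by (subst sum.remove[of _ i]) auto
    also have "\<dots> = (\<Sum>j\<in>{1..N} - {i}. 1)"
      using inj_onD[OF inj, of i] i by (intro sum.cong) auto
    also have "\<dots> = real (card ({1..N} - {i}))" by simp
    finally show ?thesis using i by simp
  qed
  then show ?thesis
    unfolding sum_inv_gap_mult by (cases N) (simp_all add: algebra_simps)
qed

section \<open>Existence of the equilibrium\<close>

lemma compact_box: "compact (PiE {1..N::nat} (\<lambda>_. {-\<rho>..\<rho>::real}))"
proof -
  have "PiE {1..N} (\<lambda>_. {-\<rho>..\<rho>}) = PiE UNIV (\<lambda>i. if i \<in> {1..N} then {-\<rho>..\<rho>} else {undefined})"
    by (auto simp: PiE_iff extensional_def split: if_splits)
  moreover have "compactin (product_topology (\<lambda>_. euclidean) UNIV)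
      (PiE UNIV (\<lambda>i. if i \<in> {1..N} then {-\<rho>..\<rho>} else {undefined}))"
    by (subst compactin_PiE) auto
  ultimately show ?thesis
    by (simp add: euclidean_product_topology)
qed

text \<open>
  A maximiser of the Vandermonde product times \<open>exp (- |x|\<^sup>2 / 2)\<close> on the
  closed chamber has distinct coordinates, because the maximum is positive, so it is an
  interior point and the partial derivatives of the logarithm vanish there. Compactness comes
  from cutting the chamber with a large box, on the boundary of which the Gaussian factor
  beats the product.
\<close>
lemma exists_equilibrium: "\<exists>z. equilibrium N z"
proof -
  define f where "f x = vandermonde N x * exp (- (\<Sum>i=1..N. (x i)\<^sup>2) / 2)" for x
  define m where "m = card (index_pairs N)"
  define x0 :: "nat \<Rightarrow> real" where "x0 = (\<lambda>i\<in>{1..N}. real N - real i)"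
  have "0 < f x0"
    by (auto simp: f_def vandermonde_def x0_def index_pairs_def intro!: mult_pos_pos prod_pos)
  \<comment> \<open>in the box each of the \<open>m\<close> gaps is at most \<open>2 *
    \<rho>\<close>, and on its boundary \<open>|x|\<^sup>2 / 2 \<ge> \<rho>\<close> as soon as
    \<open>\<rho> \<ge> 2\<close>\<close>
  have "((\<lambda>\<rho>. 2 ^ m * (\<rho> ^ m / exp \<rho>)) \<longlongrightarrow> 2 ^ m * 0) (at_top :: real filter)"
    by (intro tendsto_mult tendsto_const tendsto_power_div_exp_0)
  then have "\<forall>\<^sub>F \<rho> in at_top. 2 ^ m * (\<rho> ^ m / exp \<rho>) < f x0"
    using \<open>0 < f x0\<close> by (auto dest: order_tendstoD(2))
  then have "\<forall>\<^sub>F \<rho> in at_top. 2 ^ m * (\<rho> ^ m / exp \<rho>) < f x0 \<and> real N + 2 \<le> \<rho>"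
    using eventually_ge_at_top by (rule eventually_conj)
  then obtain \<rho> where \<rho>: "2 ^ m * (\<rho> ^ m / exp \<rho>) < f x0" "real N + 2 \<le> \<rho>"
    using eventually_happens'[OF trivial_limit_at_top_linorder] by blast
  define K where "K = PiE {1..N} (\<lambda>_. {-\<rho>..\<rho>}) \<inter> {x. \<forall>i\<in>{1..N}. \<forall>j\<in>{1..N}. i \<le> j \<longrightarrow> x j \<le> x i}"
  have "closed {x :: nat \<Rightarrow> real. \<forall>i\<in>{1..N}. \<forall>j\<in>{1..N}. i \<le> j \<longrightarrow> x j \<le> x i}"
  proof -
    have "{x :: nat \<Rightarrow> real. \<forall>i\<in>{1..N}. \<forall>j\<in>{1..N}. i \<le> j \<longrightarrow> x j \<le> x i}
       = (\<Inter>i\<in>{1..N}. \<Inter>j\<in>{i..N}. {x. x j \<le> x i})" by auto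
    moreover have "closed {x :: nat \<Rightarrow> real. x j \<le> x i}" for i j
      by (intro closed_Collect_le continuous_intros)
    ultimately show ?thesis by (simp only:) (intro closed_INT ballI)
  qed
  then have "compact K"
    unfolding K_def by (intro compact_Int_closed compact_box)
  moreover have "x0 \<in> K" using \<rho>(2) by (auto simp: K_def x0_def)
  moreover have "continuous_on K f"
    unfolding f_def by (intro continuous_intros continuous_on_subset[OF continuous_vandermonde]) auto
  ultimately obtain z where z: "z \<in> K" "\<And>x. x \<in> K \<Longrightarrow> f x \<le> f z"
    using continuous_attains_sup[of K f] by blast
  have box: "z i \<in> {-\<rho>..\<rho>}" and mono: "j \<in> {1..N} \<Longrightarrow> i \<le> j \<Longrightarrow> z j \<le> z i" if "i \<in> {1..N}" for i j
    using z(1) that by (auto simp: K_def PiE_iff)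
  have "f x0 \<le> f z" using z(2) \<open>x0 \<in> K\<close> by simp
  then have "0 < f z" using \<open>0 < f x0\<close> by simp
  then have D: "0 < vandermonde N z" by (simp add: f_def zero_less_mult_iff)
  then have inj: "inj_on z {1..N}" using vandermonde_nonzero_iff[of N z] by simp
  have strict: "z j < z i" if "i \<in> {1..N}" "j \<in> {1..N}" "i < j" for i j
    using mono[of i j] inj_onD[OF inj, of i j] that by fastforce
  have inside: "-\<rho> < z i" "z i < \<rho>" if i: "i \<in> {1..N}" for i
  proof -
    have "\<bar>z i\<bar> \<noteq> \<rho>"
    proof
      assume abs: "\<bar>z i\<bar> = \<rho>"
      have "vandermonde N z \<le> \<bar>vandermonde N z\<bar>" by simp
      also have "\<dots> = (\<Prod>p\<in>index_pairs N. \<bar>case p of (a, b) \<Rightarrow> z a - z b\<bar>)"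
        unfolding vandermonde_def by (simp add: abs_prod)
      also have "\<dots> \<le> (\<Prod>p\<in>index_pairs N. 2 * \<rho>)"
      proof (rule prod_mono)
        fix p assume "p \<in> index_pairs N"
        then obtain a b where "p = (a, b)" "a \<in> {1..N}" "b \<in> {1..N}" by (auto simp: index_pairs_def)
        then show "0 \<le> \<bar>case p of (a, b) \<Rightarrow> z a - z b\<bar> \<and> \<bar>case p of (a, b) \<Rightarrow> z a - z b\<bar> \<le> 2 * \<rho>"
          using box[of a] box[of b] by auto
      qed
      also have "\<dots> = 2 ^ m * \<rho> ^ m" by (simp add: m_def power_mult_distrib)
      finally have v: "vandermonde N z \<le> 2 ^ m * \<rho> ^ m" .
      have "\<rho>\<^sup>2 = (z i)\<^sup>2" using abs by (metis power2_abs)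
      also have "\<dots> \<le> (\<Sum>i=1..N. (z i)\<^sup>2)"
        using i by (intro member_le_sum) auto
      finally have "\<rho>\<^sup>2 \<le> (\<Sum>i=1..N. (z i)\<^sup>2)" .
      moreover have "2 * \<rho> \<le> \<rho> * \<rho>"
        using \<rho>(2) by (intro mult_right_mono) auto
      ultimately have "2 * \<rho> \<le> (\<Sum>i=1..N. (z i)\<^sup>2)"
        by (simp add: power2_eq_square)
      then have "f z \<le> 2 ^ m * \<rho> ^ m * exp (- \<rho>)"
        unfolding f_def using v D \<rho>(2) by (intro mult_mono) auto
      also have "\<dots> < f x0"
        using \<rho>(1) by (simp add: exp_minus divide_inverse)
      finally show False using \<open>f x0 \<le> f z\<close> by simp
    qed
    then show "-\<rho> < z i" "z i < \<rho>" using box[OF i] by auto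
  qed
  have "equilibrium N z"
  proof
    fix i assume i: "i \<in> {1..N}"
    have "\<forall>\<^sub>F s in nhds (z i). (-\<rho> < s \<and> s < \<rho>) \<and> (\<forall>j\<in>{1..N}. (i < j \<longrightarrow> z j < s) \<and> (j < i \<longrightarrow> s < z j))"
    proof (intro eventually_conj eventually_ball_finite ballI)
      show "\<forall>\<^sub>F s in nhds (z i). - \<rho> < s" "\<forall>\<^sub>F s in nhds (z i). s < \<rho>"
        using eventually_nhds_in_open[of "{-\<rho><..}" "z i"] eventually_nhds_in_open[of "{..<\<rho>}" "z i"] inside[OF i]
        by simp_all
      fix j assume j: "j \<in> {1..N}"
      have "i < j \<Longrightarrow> \<forall>\<^sub>F s in nhds (z i). z j < s"
        using strict[OF i j] eventually_nhds_in_open[of "{z j<..}" "z i"] by simp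
      then show "\<forall>\<^sub>F s in nhds (z i). i < j \<longrightarrow> z j < s" by (cases "i < j") auto
      have "j < i \<Longrightarrow> \<forall>\<^sub>F s in nhds (z i). s < z j"
        using strict[OF j i] eventually_nhds_in_open[of "{..<z j}" "z i"] by simp
      then show "\<forall>\<^sub>F s in nhds (z i). j < i \<longrightarrow> s < z j" by (cases "j < i") auto
    qed simp
    then have "\<forall>\<^sub>F s in nhds (z i). f (z(i := s)) \<le> f z"
    proof eventually_elim
      case (elim s)
      have "z(i := s) \<in> K"
        unfolding K_def
      proof (intro IntI CollectI ballI impI)
        show "z(i := s) \<in> (\<Pi>\<^sub>E i\<in>{1..N}. {-\<rho>..\<rho>})"
          using z(1) elim i by (auto simp: K_def PiE_iff extensional_def)
        fix a b assume "a \<in> {1..N}" "b \<in> {1..N}" "a \<le> b"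
        then show "(z(i := s)) b \<le> (z(i := s)) a"
          using elim mono[of a b] by (cases "a = i"; cases "b = i") (auto simp: order_less_imp_le)
      qed
      then show ?case by (rule z(2))
    qed
    then obtain d where d: "d > 0" "\<And>s. dist s (z i) < d \<Longrightarrow> f (z(i := s)) \<le> f z"
      unfolding eventually_nhds_metric by blast
    have "((\<lambda>s. f (z(i := s))) has_real_derivative
        (vandermonde N z * inv_gap_sum N z i) * exp (- (\<Sum>i=1..N. (z i)\<^sup>2) / 2)
         + (exp (- (\<Sum>i=1..N. (z i)\<^sup>2) / 2) * - (z i)) * vandermonde N z) (at (z i))"
    proof -
      have q: "((\<lambda>s. \<Sum>j=1..N. ((z(i := s)) j)\<^sup>2) has_real_derivative 2 * z i) (at (z i))"
        using has_partialsD(3)[OF has_partials_sum_squares i, of z] .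
      have e: "((\<lambda>s. exp (- (\<Sum>j=1..N. ((z(i := s)) j)\<^sup>2) / 2)) has_real_derivative
           exp (- (\<Sum>j=1..N. (z j)\<^sup>2) / 2) * - (z i)) (at (z i))"
        using DERIV_chain2[OF DERIV_exp DERIV_cdivide[OF DERIV_minus[OF q], of 2]] by simp
      have "vandermonde N z \<noteq> 0" using D by simp
      from DERIV_mult[OF vandermonde_log_derivative[OF i this] e]
      show ?thesis unfolding f_def by simp
    qed
    then have "(vandermonde N z * inv_gap_sum N z i) * exp (- (\<Sum>i=1..N. (z i)\<^sup>2) / 2)
         + (exp (- (\<Sum>i=1..N. (z i)\<^sup>2) / 2) * - (z i)) * vandermonde N z = 0"
      by (rule DERIV_local_max[OF _ d(1)]) (use d(2) in \<open>auto simp: dist_real_def abs_minus_commute\<close>)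
    then have "vandermonde N z * exp (- (\<Sum>i=1..N. (z i)\<^sup>2) / 2) * (inv_gap_sum N z i - z i) = 0"
      by (simp add: algebra_simps)
    then show "(\<Sum>j=1..N. 1 / (z i - z j)) = z i"
      using D by (simp add: inv_gap_sum_def)
  qed (rule strict)
  then show ?thesis by blast
qed

section \<open>Test functions that vanish on the walls\<close>

definition sq_norm :: "nat \<Rightarrow> (nat \<Rightarrow> real) \<Rightarrow> real" where
  "sq_norm N x = (\<Sum>i=1..N. (x i)\<^sup>2)"

lemma sq_norm_nonneg: "0 \<le> sq_norm N x"
  by (simp add: sq_norm_def sum_nonneg)

lemma sq_norm_partials: "has_partials N (sq_norm N) (\<lambda>i x. 2 * x i) (\<lambda>i j _. if i = j then 2 else 0)"
  using has_partials_sum_squares[of N] unfolding sq_norm_def[abs_def] .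

lemma coordinate_le_sq_norm: "i \<in> {1..N} \<Longrightarrow> (x i)\<^sup>2 \<le> sq_norm N x"
  unfolding sq_norm_def by (intro member_le_sum) auto

definition cutoff :: "nat \<Rightarrow> real \<Rightarrow> real \<Rightarrow> (nat \<Rightarrow> real) \<Rightarrow> real" where
  "cutoff N \<delta> R x = wall_cutoff \<delta> (vandermonde N x) * ball_cutoff R (sq_norm N x)"

definition cutoff_grad :: "nat \<Rightarrow> real \<Rightarrow> real \<Rightarrow> nat \<Rightarrow> (nat \<Rightarrow> real) \<Rightarrow> real" where
  "cutoff_grad N \<delta> R i x =
     wall_cutoff' \<delta> (vandermonde N x) * vandermonde_grad N i x * ball_cutoff R (sq_norm N x)
     + wall_cutoff \<delta> (vandermonde N x) * (ball_cutoff' R (sq_norm N x) * (2 * x i))"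

lemma wall_factor_partials:
  assumes "0 < \<delta>"
  shows "has_partials N (\<lambda>x. wall_cutoff \<delta> (vandermonde N x))
    (\<lambda>i x. wall_cutoff' \<delta> (vandermonde N x) * vandermonde_grad N i x)
    (\<lambda>i j x. wall_cutoff'' \<delta> (vandermonde N x) * vandermonde_grad N j x * vandermonde_grad N i x
      + wall_cutoff' \<delta> (vandermonde N x) * vandermonde_hess N i j x)"
  by (rule has_partials_compose[OF vandermonde_partials]) (use wall_cutoff_derivatives[OF assms] in auto)

lemma ball_factor_partials:
  assumes "0 < R"
  shows "has_partials N (\<lambda>x. ball_cutoff R (sq_norm N x))
    (\<lambda>i x. ball_cutoff' R (sq_norm N x) * (2 * x i))
    (\<lambda>i j x. ball_cutoff'' R (sq_norm N x) * (2 * x j) * (2 * x i)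
      + ball_cutoff' R (sq_norm N x) * (if i = j then 2 else 0))"
  by (rule has_partials_compose[OF sq_norm_partials]) (use ball_cutoff_derivatives[OF assms] in auto)

lemma cutoff_partials:
  assumes "0 < \<delta>" "0 < R"
  obtains h where "has_partials N (cutoff N \<delta> R) (cutoff_grad N \<delta> R) h"
proof -
  have "cutoff N \<delta> R = (\<lambda>x. wall_cutoff \<delta> (vandermonde N x) * ball_cutoff R (sq_norm N x))"
    by (simp add: cutoff_def fun_eq_iff)
  moreover have "cutoff_grad N \<delta> R = (\<lambda>i x. wall_cutoff' \<delta> (vandermonde N x) * vandermonde_grad N i x * ball_cutoff R (sq_norm N x)
     + wall_cutoff \<delta> (vandermonde N x) * (ball_cutoff' R (sq_norm N x) * (2 * x i)))"
    by (simp add: cutoff_grad_def fun_eq_iff)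
  ultimately show thesis
    using that has_partials_mult[OF wall_factor_partials[OF assms(1), of N] ball_factor_partials[OF assms(2), of N]]
    by (simp only:)
qed

lemma wall_cutoff_0 [simp]: "wall_cutoff \<delta> 0 = 0" "wall_cutoff' \<delta> 0 = 0" "wall_cutoff'' \<delta> 0 = 0"
  by (simp_all add: wall_cutoff_def wall_cutoff'_def wall_cutoff''_def)

lemma cutoff_grad_wall: "vandermonde N x = 0 \<Longrightarrow> cutoff_grad N \<delta> R i x = 0"
  by (simp add: cutoff_grad_def)

lemma cutoff_grad_interior:
  assumes "vandermonde N x \<noteq> 0"
  shows "(\<Sum>i=1..N. a i * cutoff_grad N \<delta> R i x)
    = wall_cutoff' \<delta> (vandermonde N x) * vandermonde N x * ball_cutoff R (sq_norm N x)
        * (\<Sum>i=1..N. a i * inv_gap_sum N x i)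
      + 2 * wall_cutoff \<delta> (vandermonde N x) * ball_cutoff' R (sq_norm N x) * (\<Sum>i=1..N. a i * x i)"
proof -
  have "a i * cutoff_grad N \<delta> R i x
    = wall_cutoff' \<delta> (vandermonde N x) * vandermonde N x * ball_cutoff R (sq_norm N x)
        * (a i * inv_gap_sum N x i)
      + 2 * wall_cutoff \<delta> (vandermonde N x) * ball_cutoff' R (sq_norm N x) * (a i * x i)"
    if "i \<in> {1..N}" for i
    unfolding cutoff_grad_def vandermonde_grad_eq[OF that assms] by algebra
  then show ?thesis
    by (simp add: sum.distrib sum_distrib_left)
qed

lemma cutoff_generator_wall:
  assumes "0 < \<delta>" "0 < R" "vandermonde N x = 0"
  shows "bessel_generator_A N k (cutoff N \<delta> R) x = 0"
  unfolding cutoff_def[abs_def]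
  unfolding generator_mult[OF wall_factor_partials[OF assms(1)] ball_factor_partials[OF assms(2)]]
    generator_eq[OF wall_factor_partials[OF assms(1)]]
  by (simp add: assms(3))

lemma cutoff_generator_interior:
  fixes x :: "nat \<Rightarrow> real"
  assumes "0 < \<delta>" "0 < R" and D: "vandermonde N x \<noteq> 0"
  defines "v \<equiv> sq_norm N x" and "u \<equiv> vandermonde N x"
  shows "bessel_generator_A N k (cutoff N \<delta> R) x
    = ball_cutoff R v * ((wall_cutoff'' \<delta> u * u\<^sup>2 / 2 + k * (wall_cutoff' \<delta> u * u)) * (\<Sum>i=1..N. (inv_gap_sum N x i)\<^sup>2))
    + wall_cutoff \<delta> u * (2 * v * ball_cutoff'' R v + (real N + k * real (N * (N - 1))) * ball_cutoff' R v)
    + real (N * (N - 1)) * (wall_cutoff' \<delta> u * u) * ball_cutoff' R v"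
proof -
  define Q where "Q = (\<Sum>i=1..N. (inv_gap_sum N x i)\<^sup>2)"
  have grad: "vandermonde_grad N i x = u * inv_gap_sum N x i" if "i \<in> {1..N}" for i
    using vandermonde_grad_eq[OF that D] by (simp add: u_def)
  have pos: "(\<Sum>i=1..N. x i * inv_gap_sum N x i) = real (N * (N - 1)) / 2"
    by (rule sum_inv_gap_position[OF D])
  have 1: "bessel_generator_A N k (\<lambda>x. wall_cutoff \<delta> (vandermonde N x)) x
      = (wall_cutoff'' \<delta> u * u\<^sup>2 / 2 + k * (wall_cutoff' \<delta> u * u)) * Q"
  proof -
    have a: "(\<Sum>i=1..N. wall_cutoff'' \<delta> u * vandermonde_grad N i x * vandermonde_grad N i x
        + wall_cutoff' \<delta> u * vandermonde_hess N i i x) = wall_cutoff'' \<delta> u * u\<^sup>2 * Q"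
    proof -
      have "(\<Sum>i=1..N. wall_cutoff'' \<delta> u * vandermonde_grad N i x * vandermonde_grad N i x)
          = (\<Sum>i=1..N. wall_cutoff'' \<delta> u * u\<^sup>2 * (inv_gap_sum N x i)\<^sup>2)"
        by (intro sum.cong refl) (simp add: grad power2_eq_square)
      moreover have "(\<Sum>i=1..N. wall_cutoff' \<delta> u * vandermonde_hess N i i x) = 0"
        using vandermonde_harmonic[OF D] by (simp flip: sum_distrib_left)
      ultimately show ?thesis
        by (simp add: sum.distrib Q_def flip: sum_distrib_left)
    qed
    have b: "(\<Sum>i=1..N. inv_gap_sum N x i * (wall_cutoff' \<delta> u * vandermonde_grad N i x)) = wall_cutoff' \<delta> u * u * Q"
    proof -
      have "(\<Sum>i=1..N. inv_gap_sum N x i * (wall_cutoff' \<delta> u * vandermonde_grad N i x))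
          = (\<Sum>i=1..N. wall_cutoff' \<delta> u * u * (inv_gap_sum N x i)\<^sup>2)"
        by (intro sum.cong refl) (simp add: grad power2_eq_square)
      then show ?thesis by (simp add: Q_def flip: sum_distrib_left)
    qed
    show ?thesis
      unfolding generator_eq[OF wall_factor_partials[OF assms(1)]] u_def[symmetric] a b
      by (simp add: algebra_simps)
  qed
  have 2: "bessel_generator_A N k (\<lambda>x. ball_cutoff R (sq_norm N x)) x
      = 2 * v * ball_cutoff'' R v + (real N + k * real (N * (N - 1))) * ball_cutoff' R v"
  proof -
    have a: "(\<Sum>i=1..N. ball_cutoff'' R v * (2 * x i) * (2 * x i) + ball_cutoff' R v * (if i = i then 2 else 0))
        = 4 * v * ball_cutoff'' R v + 2 * real N * ball_cutoff' R v"
    proof -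
      have "(\<Sum>i=1..N. ball_cutoff'' R v * (2 * x i) * (2 * x i)) = (\<Sum>i=1..N. 4 * ball_cutoff'' R v * (x i)\<^sup>2)"
        by (intro sum.cong refl) (simp add: power2_eq_square)
      then show ?thesis
        by (simp add: sum.distrib v_def sq_norm_def flip: sum_distrib_left)
    qed
    have b: "(\<Sum>i=1..N. inv_gap_sum N x i * (ball_cutoff' R v * (2 * x i))) = ball_cutoff' R v * real (N * (N - 1))"
    proof -
      have "(\<Sum>i=1..N. inv_gap_sum N x i * (ball_cutoff' R v * (2 * x i)))
          = (\<Sum>i=1..N. 2 * ball_cutoff' R v * (x i * inv_gap_sum N x i))"
        by (intro sum.cong refl) simp
      also have "\<dots> = 2 * ball_cutoff' R v * (\<Sum>i=1..N. x i * inv_gap_sum N x i)"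
        by (simp only: sum_distrib_left)
      finally show ?thesis unfolding pos by simp
    qed
    show ?thesis
      unfolding generator_eq[OF ball_factor_partials[OF assms(2)]] v_def[symmetric] a b
      by (simp add: algebra_simps)
  qed
  have 3: "(\<Sum>i=1..N. wall_cutoff' \<delta> u * vandermonde_grad N i x * (ball_cutoff' R v * (2 * x i)))
      = real (N * (N - 1)) * (wall_cutoff' \<delta> u * u) * ball_cutoff' R v"
  proof -
    have "(\<Sum>i=1..N. wall_cutoff' \<delta> u * vandermonde_grad N i x * (ball_cutoff' R v * (2 * x i)))
        = (\<Sum>i=1..N. 2 * (wall_cutoff' \<delta> u * u) * ball_cutoff' R v * (x i * inv_gap_sum N x i))"
      by (intro sum.cong refl) (simp add: grad)
    also have "\<dots> = 2 * (wall_cutoff' \<delta> u * u) * ball_cutoff' R v * (\<Sum>i=1..N. x i * inv_gap_sum N x i)"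
      by (simp only: sum_distrib_left)
    finally show ?thesis unfolding pos by simp
  qed
  show ?thesis
    unfolding cutoff_def[abs_def]
    unfolding generator_mult[OF wall_factor_partials[OF assms(1)] ball_factor_partials[OF assms(2)]] 1 2
    unfolding u_def[symmetric] v_def[symmetric] 3 Q_def by (simp add: algebra_simps)
qed

text \<open>
  The term with the wall profile is nonnegative by \<open>wall_cutoff_subharmonic\<close> and
  so is the second derivative of the ball profile; the rest carries the factor \<open>3 /
  R\<close>.
\<close>
lemma cutoff_generator_lower_bound:
  assumes "0 < \<delta>" "0 < R" "5/2 \<le> k"
  shows "- (3 / R * (real N + (k + 1) * real (N * (N - 1)))) \<le> bessel_generator_A N k (cutoff N \<delta> R) x"
proof (cases "vandermonde N x = 0")
  case True
  then show ?thesis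
    using assms cutoff_generator_wall[OF assms(1,2) True] by simp
next
  case False
  define v where "v = sq_norm N x"
  define u where "u = vandermonde N x"
  have "0 \<le> v" by (simp add: v_def sq_norm_nonneg)
  note b = ball_cutoff_bounds[OF assms(2) this] and w = wall_cutoff_bounds[OF assms(1), of u]
  define n where "n = real (N * (N - 1))"
  have n: "0 \<le> n" by (simp add: n_def)
  have t1: "0 \<le> ball_cutoff R v * ((wall_cutoff'' \<delta> u * u\<^sup>2 / 2 + k * (wall_cutoff' \<delta> u * u)) * (\<Sum>i=1..N. (inv_gap_sum N x i)\<^sup>2))"
    using b wall_cutoff_subharmonic[OF assms(1,3), of u] by (intro mult_nonneg_nonneg sum_nonneg) auto
  have neg: "- (3 / R) \<le> c * ball_cutoff' R v" if "0 \<le> c" "c \<le> 1" for c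
  proof -
    have "1 * ball_cutoff' R v \<le> c * ball_cutoff' R v" using that b by (intro mult_right_mono_neg) auto
    then show ?thesis using b by simp
  qed
  have t2: "- (3 / R) * (real N + k * n) \<le> wall_cutoff \<delta> u * (2 * v * ball_cutoff'' R v + (real N + k * n) * ball_cutoff' R v)"
  proof -
    have "(- (3 / R)) * (real N + k * n) \<le> (wall_cutoff \<delta> u * ball_cutoff' R v) * (real N + k * n)"
      using neg w n assms(3) by (intro mult_right_mono) auto
    moreover have "0 \<le> wall_cutoff \<delta> u * (2 * v * ball_cutoff'' R v)"
      using b w \<open>0 \<le> v\<close> by auto
    ultimately show ?thesis by (simp add: algebra_simps)
  qed
  have t3: "- (3 / R) * n \<le> n * (wall_cutoff' \<delta> u * u) * ball_cutoff' R v"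
  proof -
    have "(- (3 / R)) * n \<le> ((wall_cutoff' \<delta> u * u) * ball_cutoff' R v) * n"
      using neg[OF w(3,4)] n by (intro mult_right_mono) auto
    then show ?thesis by (simp add: mult_ac)
  qed
  have "bessel_generator_A N k (cutoff N \<delta> R) x
    = ball_cutoff R v * ((wall_cutoff'' \<delta> u * u\<^sup>2 / 2 + k * (wall_cutoff' \<delta> u * u)) * (\<Sum>i=1..N. (inv_gap_sum N x i)\<^sup>2))
    + wall_cutoff \<delta> u * (2 * v * ball_cutoff'' R v + (real N + k * n) * ball_cutoff' R v)
    + n * (wall_cutoff' \<delta> u * u) * ball_cutoff' R v"
    unfolding cutoff_generator_interior[OF assms(1,2) False] u_def v_def n_def ..
  moreover have "- (3 / R * (real N + (k + 1) * n)) = - (3 / R) * (real N + k * n) + - (3 / R) * n"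
    by (simp add: algebra_simps)
  ultimately show ?thesis
    unfolding n_def[symmetric] using t1 t2 t3 by linarith
qed

lemma cutoff_outside:
  assumes "0 < \<delta>" "0 < R" "R \<le> sq_norm N x"
  shows "cutoff N \<delta> R x = 0" "cutoff_grad N \<delta> R i x = 0" "bessel_generator_A N k (cutoff N \<delta> R) x = 0"
proof -
  note b = ball_cutoff_outside[OF assms(2,3)]
  show "cutoff N \<delta> R x = 0" "cutoff_grad N \<delta> R i x = 0"
    by (simp_all add: cutoff_def cutoff_grad_def b)
  show "bessel_generator_A N k (cutoff N \<delta> R) x = 0"
    using cutoff_generator_wall[OF assms(1,2)] cutoff_generator_interior[OF assms(1,2), of N x k]
    by (cases "vandermonde N x = 0") (simp_all add: b)
qed

lemma cutoff_bounds: "0 < \<delta> \<Longrightarrow> 0 < R \<Longrightarrow> 0 \<le> cutoff N \<delta> R x" "0 < \<delta> \<Longrightarrow> 0 < R \<Longrightarrow> cutoff N \<delta> R x \<le> 1"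
  using wall_cutoff_bounds(1,2)[of \<delta> "vandermonde N x"] ball_cutoff_bounds(1,2)[of R "sq_norm N x"]
  by (auto simp: cutoff_def sq_norm_nonneg intro: mult_le_one)

lemma continuous_cutoff:
  assumes "0 < \<delta>" "0 < R"
  shows "continuous_on UNIV (cutoff N \<delta> R)" "i \<in> {1..N} \<Longrightarrow> continuous_on UNIV (cutoff_grad N \<delta> R i)"
  using cutoff_partials[OF assms] has_partialsD by metis+

lemma continuous_inv_gap_vandermonde:
  assumes i: "i \<in> {1..N}"
  shows "continuous_on UNIV (\<lambda>x. inv_gap_sum N x i * (vandermonde N x)\<^sup>2)"
proof -
  have "continuous_on UNIV (\<lambda>x. 1 / (x i - x j) * (vandermonde N x)\<^sup>2)" if j: "j \<in> {1..N}" for j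
  proof (cases "i = j")
    case False
    then obtain P where P: "continuous_on UNIV P" "\<And>x. vandermonde N x = (x i - x j) * P x"
      using vandermonde_factor[OF i j] by metis
    have "1 / (x i - x j) * (vandermonde N x)\<^sup>2 = vandermonde N x * P x" for x
      by (cases "x i = x j") (simp_all add: P(2) power2_eq_square)
    then show ?thesis using P(1) continuous_vandermonde by (auto intro!: continuous_intros)
  qed simp
  then show ?thesis
    unfolding inv_gap_sum_def sum_distrib_right by (intro continuous_on_sum) auto
qed

lemma continuous_inv_gap_cutoff:
  assumes "0 < \<delta>" "0 < R" and i: "i \<in> {1..N}"
  shows "continuous_on UNIV (\<lambda>x. inv_gap_sum N x i * cutoff N \<delta> R x)"
    and "continuous_on UNIV (\<lambda>x. inv_gap_sum N x i * cutoff_grad N \<delta> R i x)"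
proof -
  have nz: "(vandermonde N x) ^ 4 + \<delta> \<noteq> 0" for x
    using denominator_pos[OF assms(1), of "vandermonde N x"] by simp
  have cb: "continuous_on UNIV (\<lambda>x. ball_cutoff R (sq_norm N x))"
    "continuous_on UNIV (\<lambda>x. ball_cutoff' R (sq_norm N x))"
    unfolding ball_cutoff_def ball_cutoff'_def using assms(2) has_partialsD(1)[OF sq_norm_partials]
    by (auto intro!: continuous_intros)
  note c = continuous_inv_gap_vandermonde[OF i] continuous_vandermonde cb has_partialsD(2)[OF vandermonde_partials i]
  have "(\<lambda>x. inv_gap_sum N x i * cutoff N \<delta> R x) = (\<lambda>x. inv_gap_sum N x i * (vandermonde N x)\<^sup>2
      * ((vandermonde N x)\<^sup>2 / ((vandermonde N x) ^ 4 + \<delta>) * ball_cutoff R (sq_norm N x)))"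
    by (rule ext) (simp add: cutoff_def wall_cutoff_def power_numeral_reduce mult_ac)
  then show "continuous_on UNIV (\<lambda>x. inv_gap_sum N x i * cutoff N \<delta> R x)"
    using nz by (simp only:) (intro continuous_on_mult[OF c(1)] continuous_intros c ballI; auto)
  have "(\<lambda>x. inv_gap_sum N x i * cutoff_grad N \<delta> R i x) = (\<lambda>x. inv_gap_sum N x i * (vandermonde N x)\<^sup>2
      * (4 * \<delta> * vandermonde N x / ((vandermonde N x) ^ 4 + \<delta>)\<^sup>2 * vandermonde_grad N i x * ball_cutoff R (sq_norm N x)
        + (vandermonde N x)\<^sup>2 / ((vandermonde N x) ^ 4 + \<delta>) * (ball_cutoff' R (sq_norm N x) * (2 * x i))))"
    by (rule ext) (simp add: cutoff_grad_def wall_cutoff_def wall_cutoff'_def power_numeral_reduce algebra_simps)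
  then show "continuous_on UNIV (\<lambda>x. inv_gap_sum N x i * cutoff_grad N \<delta> R i x)"
    using nz by (simp only:) (intro continuous_on_mult[OF c(1)] continuous_intros c ballI; auto)
qed

lemma continuous_cutoff_generator:
  assumes "0 < \<delta>" "0 < R"
  shows "continuous_on UNIV (bessel_generator_A N k (cutoff N \<delta> R))"
proof -
  obtain h where h: "has_partials N (cutoff N \<delta> R) (cutoff_grad N \<delta> R) h"
    using cutoff_partials[OF assms] by blast
  have "bessel_generator_A N k (cutoff N \<delta> R) = (\<lambda>x. 1/2 * (\<Sum>i=1..N. h i i x)
      + k * (\<Sum>i=1..N. inv_gap_sum N x i * cutoff_grad N \<delta> R i x))"
    by (rule ext) (rule generator_eq[OF h])
  then show ?thesis
    by (simp only:) (intro continuous_on_add continuous_on_mult_left continuous_on_sum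
        continuous_inv_gap_cutoff(2)[OF assms] has_partialsD(4)[OF h])
qed

text \<open>
  The cut-off and its gradient vanish on the walls, so the reflecting condition holds for
  every function of a linear form, symmetric or not.
\<close>
lemma linear_test_generator:
  fixes N :: nat and a :: "nat \<Rightarrow> real"
  assumes "0 < \<delta>" "0 < R"
    and p: "\<And>y. (p has_real_derivative p' y) (at y)" "\<And>y. (p' has_real_derivative p'' y) (at y)"
      "continuous_on UNIV p''"
  defines "y \<equiv> \<lambda>x. \<Sum>i=1..N. a i * x i"
  shows "bessel_generator_A N k (\<lambda>x. p (y x) * cutoff N \<delta> R x) x
      = p (y x) * bessel_generator_A N k (cutoff N \<delta> R) x
        + (p'' (y x) / 2 * (\<Sum>i=1..N. (a i)\<^sup>2) * cutoff N \<delta> R x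
            + k * p' (y x) * (\<Sum>i=1..N. a i * (inv_gap_sum N x i * cutoff N \<delta> R x)))
        + p' (y x) * (\<Sum>i=1..N. a i * cutoff_grad N \<delta> R i x)"
    and "reflecting_test_fun N (\<lambda>x. p (y x) * cutoff N \<delta> R x)"
proof -
  obtain h where h: "has_partials N (cutoff N \<delta> R) (cutoff_grad N \<delta> R) h"
    using cutoff_partials[OF assms(1,2)] by blast
  have "has_partials N y (\<lambda>i _. a i) (\<lambda>_ _ _. 0)"
    unfolding y_def by (rule has_partials_linear)
  note lin = has_partials_compose[OF this p]
  note pr = has_partials_mult[OF lin h]
  show "bessel_generator_A N k (\<lambda>x. p (y x) * cutoff N \<delta> R x) x
      = p (y x) * bessel_generator_A N k (cutoff N \<delta> R) x
        + (p'' (y x) / 2 * (\<Sum>i=1..N. (a i)\<^sup>2) * cutoff N \<delta> R x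
            + k * p' (y x) * (\<Sum>i=1..N. a i * (inv_gap_sum N x i * cutoff N \<delta> R x)))
        + p' (y x) * (\<Sum>i=1..N. a i * cutoff_grad N \<delta> R i x)"
    unfolding generator_mult[OF lin h] generator_eq[OF lin]
    by (simp add: sum_distrib_left sum_distrib_right power2_eq_square algebra_simps)
  show "reflecting_test_fun N (\<lambda>x. p (y x) * cutoff N \<delta> R x)"
    unfolding reflecting_test_fun_def
  proof (intro conjI ballI impI)
    show "C2_fun N (\<lambda>x. p (y x) * cutoff N \<delta> R x)"
      by (rule has_partials_C2_fun[OF pr])
    have "p (y x) * cutoff N \<delta> R x = 0" if i: "i \<in> {1..N}" and x: "sqrt R < \<bar>x i\<bar>" for x i
    proof -
      have "R = (sqrt R)\<^sup>2" using assms(2) by simp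
      also have "\<dots> \<le> \<bar>x i\<bar>\<^sup>2" using x assms(2) by (intro power_mono) auto
      also have "\<dots> = (x i)\<^sup>2" by simp
      also have "\<dots> \<le> sq_norm N x" by (rule coordinate_le_sq_norm[OF i])
      finally show ?thesis using cutoff_outside(1)[OF assms(1,2)] by simp
    qed
    then show "\<exists>R'. \<forall>x\<in>config_space N. (\<exists>i\<in>{1..N}. R' < \<bar>x i\<bar>) \<longrightarrow> p (y x) * cutoff N \<delta> R x = 0"
      by blast
    fix x :: "nat \<Rightarrow> real" and i j assume ij: "i \<in> {1..N}" "j \<in> {1..N}" "x i = x j"
    show "partial_deriv i (\<lambda>x. p (y x) * cutoff N \<delta> R x) x = partial_deriv j (\<lambda>x. p (y x) * cutoff N \<delta> R x) x"
    proof (cases "i = j")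
      case False
      then have "vandermonde N x = 0"
        using vandermonde_nonzero_iff[of N x] ij by (auto dest: inj_onD)
      then show ?thesis
        unfolding has_partials_partial_deriv(1)[OF pr ij(1)] has_partials_partial_deriv(1)[OF pr ij(2)]
        by (simp add: cutoff_grad_wall cutoff_def)
    qed simp
  qed
qed

section \<open>Differentiating expectations along the process\<close>

lemma mvt_increment:
  fixes f :: "real \<Rightarrow> real"
  assumes "\<And>s. \<bar>s - a\<bar> \<le> \<bar>h\<bar> \<Longrightarrow> (f has_real_derivative f' s) (at s)"
  shows "\<exists>\<xi>. \<bar>\<xi> - a\<bar> \<le> \<bar>h\<bar> \<and> f (a + h) - f a = h * f' \<xi>"
proof (cases h "0::real" rule: linorder_cases)
  case less
  then have "\<exists>\<xi>>a + h. \<xi> < a \<and> f a - f (a + h) = (a - (a + h)) * f' \<xi>"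
    using assms by (intro MVT2) auto
  then obtain \<xi> where "a + h < \<xi>" "\<xi> < a" "f a - f (a + h) = - h * f' \<xi>" by auto
  then show ?thesis using less by (intro exI[of _ \<xi>]) auto
next
  case equal
  then show ?thesis by auto
next
  case greater
  then have "\<exists>\<xi>>a. \<xi> < a + h \<and> f (a + h) - f a = (a + h - a) * f' \<xi>"
    using assms by (intro MVT2) auto
  then obtain \<xi> where "a < \<xi>" "\<xi> < a + h" "f (a + h) - f a = h * f' \<xi>" by auto
  then show ?thesis using greater by (intro exI[of _ \<xi>]) auto
qed

lemma set_integral_square_derivative:
  fixes c :: "real \<Rightarrow> real"
  assumes "continuous_on {0..} c"
  shows "((\<lambda>r. LINT s:{0..r\<^sup>2}|lborel. c s) has_real_derivative 2 * a * c (a\<^sup>2)) (at a)"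
proof -
  \<comment> \<open>a continuous extension to negative times makes every
    \<open>a\<^sup>2\<close> an interior point\<close>
  define e where "e s = c (max 0 s)" for s
  have e: "continuous_on UNIV e"
    unfolding e_def by (rule continuous_on_compose2[OF assms]) (auto intro!: continuous_intros)
  have I: "(LINT s:{0..q}|lborel. c s) = integral {-1..q} e - integral {-1..0} e" if "0 \<le> q" for q
  proof -
    have "(LINT s:{0..q}|lborel. c s) = (LINT s:{0..q}|lborel. e s)"
      by (rule set_lebesgue_integral_cong) (auto simp: e_def)
    also have "\<dots> = integral {0..q} e"
      by (rule set_borel_integral_eq_integral(2)[OF borel_integrable_atLeastAtMost'])
        (rule continuous_on_subset[OF e], simp)
    also have "\<dots> = integral {-1..q} e - integral {-1..0} e"
      using Henstock_Kurzweil_Integration.integral_combine[where a = "-1" and c = 0 and b = q and f = e] that integrable_continuous_real[OF continuous_on_subset[OF e]] by simp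
    finally show ?thesis .
  qed
  have "((\<lambda>q. integral {-1..q} e) has_real_derivative e (a\<^sup>2)) (at (a\<^sup>2) within {-1..a\<^sup>2 + 1})"
    by (rule integral_has_real_derivative) (auto intro: continuous_on_subset[OF e] order_trans[of _ 0])
  moreover have "at (a\<^sup>2) within {-1..a\<^sup>2 + 1} = at (a\<^sup>2)"
    by (rule at_within_interior) (simp, meson less_le_trans neg_less_0_iff_less zero_le_power2 zero_less_one)
  ultimately have "((\<lambda>q. integral {-1..q} e) has_real_derivative e (a\<^sup>2)) (at (a\<^sup>2))" by simp
  moreover have "((\<lambda>r. r\<^sup>2) has_real_derivative 2 * a) (at a)"
    by (auto intro!: derivative_eq_intros)
  ultimately have "((\<lambda>r. integral {-1..r\<^sup>2} e) has_real_derivative e (a\<^sup>2) * (2 * a)) (at a)"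
    using DERIV_chain2[of "\<lambda>q. integral {-1..q} e" "e (a\<^sup>2)" "\<lambda>r. r\<^sup>2" a "2 * a"] by simp
  from DERIV_diff[OF this DERIV_const[of "integral {-1..0} e"]]
  show ?thesis
    by (simp add: I e_def mult.commute)
qed

locale bessel_zero = prob_space M for M :: "'w measure" +
  fixes N :: nat and k :: real and X :: "real \<Rightarrow> 'w \<Rightarrow> nat \<Rightarrow> real"
  assumes process: "bessel_process_A N k M X" and start: "started_at_zero N M X"
begin

lemma in_chamber: "\<omega> \<in> space M \<Longrightarrow> 0 \<le> t \<Longrightarrow> X t \<omega> \<in> weyl_chamber_A N"
  using process by (auto simp: bessel_process_A_def)

lemma outside_index: "\<omega> \<in> space M \<Longrightarrow> 0 \<le> t \<Longrightarrow> i \<notin> {1..N} \<Longrightarrow> X t \<omega> i = undefined"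
  using in_chamber[of \<omega> t] by (auto simp: weyl_chamber_A_def config_space_def PiE_iff extensional_def)

lemma continuous_paths:
  assumes "\<omega> \<in> space M"
  shows "continuous_on {0..} (\<lambda>t. X t \<omega>)"
proof (rule continuous_on_coordinatewise_then_product)
  fix i
  show "continuous_on {0..} (\<lambda>t. X t \<omega> i)"
  proof (cases "i \<in> {1..N}")
    case True
    then show ?thesis using process assms by (auto simp: bessel_process_A_def)
  next
    case False
    then show ?thesis
      using outside_index[OF assms] by (intro continuous_on_eq[OF continuous_on_const[of _ undefined]]) auto
  qed
qed

lemma measurable_X:
  assumes "0 \<le> t"
  shows "X t \<in> borel_measurable M"
proof (rule measurable_coordinatewise_then_product)
  fix i
  show "(\<lambda>\<omega>. X t \<omega> i) \<in> borel_measurable M"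
  proof (cases "i \<in> {1..N}")
    case True
    have "X t \<in> M \<rightarrow>\<^sub>M (\<Pi>\<^sub>M i\<in>{1..N}. borel)"
      using process assms by (auto simp: bessel_process_A_def)
    then show ?thesis using True by (rule measurable_component_singleton[THEN measurable_compose[rotated], rotated])
  next
    case False
    then have "(\<lambda>\<omega>. X t \<omega> i) \<in> borel_measurable M \<longleftrightarrow> (\<lambda>\<omega>. undefined :: real) \<in> borel_measurable M"
      using outside_index assms by (intro measurable_cong) auto
    then show ?thesis by simp
  qed
qed

lemma measurable_continuous:
  assumes "continuous_on UNIV f" "0 \<le> t"
  shows "(\<lambda>\<omega>. f (X t \<omega>) :: real) \<in> borel_measurable M"
  by (rule measurable_compose[OF measurable_X[OF assms(2)] borel_measurable_continuous_onI[OF assms(1)]])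

lemma integrable_continuous:
  assumes "continuous_on UNIV f" "0 \<le> t" "\<And>x. x \<in> weyl_chamber_A N \<Longrightarrow> \<bar>f x\<bar> \<le> K"
  shows "integrable M (\<lambda>\<omega>. f (X t \<omega>) :: real)"
  by (rule integrable_const_bound[of _ K])
     (use in_chamber assms(2,3) measurable_continuous[OF assms(1,2)] in \<open>auto intro!: AE_I2\<close>)

text \<open>
  The expectation of the martingale is that of its conditional expectation at time
  \<open>0\<close>, where it vanishes.
\<close>
lemma martingale_problem:
  assumes f: "reflecting_test_fun N f" and t: "0 \<le> t"
  defines "Y \<equiv> \<lambda>t \<omega>. f (X t \<omega>) - f (X 0 \<omega>) - (LINT s:{0..t}|lborel. bessel_generator_A N k f (X s \<omega>))"
  shows "integrable M (Y t)" "expectation (Y t) = 0"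
proof -
  let ?F = "natural_filtration M (\<Pi>\<^sub>M i\<in>{1..N}. borel) X"
  have mart: "martingale_wrt M ?F Y"
    using process f unfolding bessel_process_A_def Y_def by blast
  then show int: "integrable M (Y t)" using t by (auto simp: martingale_wrt_def)
  define G where "G = (\<Union>u\<in>{0..0::real}. {X u -` A \<inter> space M |A. A \<in> sets (\<Pi>\<^sub>M i\<in>{1..N}. borel)})"
  have "G \<subseteq> sets M"
    using process unfolding G_def bessel_process_A_def by (auto intro: measurable_sets)
  then have "sigma_sets (space M) G \<subseteq> sets M" "G \<subseteq> Pow (space M)"
    using sets.sigma_sets_subset[of G M] sets.sets_into_space[of _ M] by blast+
  then have "subalgebra M (?F 0)"
    unfolding subalgebra_def natural_filtration_def G_def[symmetric]
    by (simp add: space_measure_of_conv sets_measure_of)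
  then interpret sub: finite_measure_subalgebra M "?F 0"
    by unfold_locales
  have "AE \<omega> in M. real_cond_exp M (?F 0) (Y t) \<omega> = Y 0 \<omega>"
    using mart t by (auto simp: martingale_wrt_def)
  moreover have "Y 0 \<omega> = 0" for \<omega>
  proof -
    have "(LINT s:{0..0}|lborel. g s) = 0" for g :: "real \<Rightarrow> real"
      unfolding set_lebesgue_integral_def
      by (rule integral_eq_zero_AE, use AE_lborel_singleton[of "0::real"] in eventually_elim) auto
    then show ?thesis by (simp add: Y_def)
  qed
  ultimately have "AE \<omega> in M. real_cond_exp M (?F 0) (Y t) \<omega> = 0" by simp
  then have "expectation (real_cond_exp M (?F 0) (Y t)) = 0"
    by (intro integral_eq_zero_AE)
  then show "expectation (Y t) = 0"
    using sub.real_cond_exp_int(2)[OF int] by simp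
qed

text \<open>
  Time is \<open>r\<^sup>2\<close>. The increment of the expectation splits into the change of
  the test function, treated by the mean value theorem, and the increment of the integral of
  the generator, whose expectation the martingale property supplies. Along each path both
  difference quotients converge, since the path and the functions are continuous, and they are
  bounded; so dominated convergence over \<open>\<omega>\<close> applies.
\<close>
lemma expectation_derivative:
  fixes \<psi> \<psi>' :: "real \<Rightarrow> (nat \<Rightarrow> real) \<Rightarrow> real"
  assumes refl: "\<And>r. reflecting_test_fun N (\<psi> r)"
    and cont: "\<And>r. continuous_on UNIV (\<psi> r)"
    and deriv: "\<And>r x. ((\<lambda>r. \<psi> r x) has_real_derivative \<psi>' r x) (at r)"
    and cont': "continuous_on UNIV (\<lambda>p. \<psi>' (fst p) (snd p))"
    and cont_gen: "continuous_on UNIV (bessel_generator_A N k (\<psi> a))"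
    and bound: "\<And>r x. \<bar>r - a\<bar> \<le> 1 \<Longrightarrow> x \<in> weyl_chamber_A N \<Longrightarrow> \<bar>\<psi> r x\<bar> \<le> K"
    and bound': "\<And>r x. \<bar>r - a\<bar> \<le> 1 \<Longrightarrow> x \<in> weyl_chamber_A N \<Longrightarrow> \<bar>\<psi>' r x\<bar> \<le> K"
    and bound_gen: "\<And>x. x \<in> weyl_chamber_A N \<Longrightarrow> \<bar>bessel_generator_A N k (\<psi> a) x\<bar> \<le> K"
  shows "((\<lambda>r. expectation (\<lambda>\<omega>. \<psi> r (X (r\<^sup>2) \<omega>))) has_real_derivative
      expectation (\<lambda>\<omega>. \<psi>' a (X (a\<^sup>2) \<omega>) + 2 * a * bessel_generator_A N k (\<psi> a) (X (a\<^sup>2) \<omega>))) (at a)"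
proof -
  define G where "G = bessel_generator_A N k (\<psi> a)"
  define I where "I r \<omega> = (LINT s:{0..r\<^sup>2}|lborel. G (X s \<omega>))" for r \<omega>
  define \<Phi> where "\<Phi> r = expectation (\<lambda>\<omega>. \<psi> r (X (r\<^sup>2) \<omega>))" for r
  define D where "D \<omega> = \<psi>' a (X (a\<^sup>2) \<omega>) + 2 * a * G (X (a\<^sup>2) \<omega>)" for \<omega>
  define q where "q h \<omega> = (\<psi> (a + h) (X ((a + h)\<^sup>2) \<omega>) - \<psi> a (X ((a + h)\<^sup>2) \<omega>) + (I (a + h) \<omega> - I a \<omega>)) / h" for h \<omega>
  have int_\<psi>: "integrable M (\<lambda>\<omega>. \<psi> r (X (s\<^sup>2) \<omega>))" if "\<bar>r - a\<bar> \<le> 1" for r s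
    using bound[OF that] by (intro integrable_continuous[OF cont]) auto
  have mart: "integrable M (\<lambda>\<omega>. \<psi> a (X (r\<^sup>2) \<omega>) - \<psi> a (X 0 \<omega>) - I r \<omega>)"
    "expectation (\<lambda>\<omega>. \<psi> a (X (r\<^sup>2) \<omega>) - \<psi> a (X 0 \<omega>) - I r \<omega>) = 0" for r
    using martingale_problem[OF refl[of a], of "r\<^sup>2"] by (simp_all add: I_def G_def)
  have int0: "integrable M (\<lambda>\<omega>. \<psi> a (X 0 \<omega>))"
    using int_\<psi>[of a 0] by simp
  have int_I: "integrable M (I r)" for r
  proof -
    have "integrable M (\<lambda>\<omega>. (\<psi> a (X (r\<^sup>2) \<omega>) - \<psi> a (X 0 \<omega>)) - (\<psi> a (X (r\<^sup>2) \<omega>) - \<psi> a (X 0 \<omega>) - I r \<omega>))"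
      by (rule Bochner_Integration.integrable_diff[OF Bochner_Integration.integrable_diff[OF int_\<psi> int0] mart(1)]) simp
    then show ?thesis by simp
  qed
  have exp_I: "expectation (I r) = expectation (\<lambda>\<omega>. \<psi> a (X (r\<^sup>2) \<omega>)) - expectation (\<lambda>\<omega>. \<psi> a (X 0 \<omega>))" for r
    using mart(2)[of r] int_I[of r] int_\<psi>[of a r] int0 by simp
  have exp_q: "expectation (q h) = (\<Phi> (a + h) - \<Phi> a) / h" if "\<bar>h\<bar> \<le> 1" for h
    unfolding q_def \<Phi>_def
    using int_\<psi>[of "a + h" "a + h"] int_\<psi>[of a "a + h"] int_\<psi>[of a a] int_I exp_I that by simp
  have meas_q: "q h \<in> borel_measurable M" if "\<bar>h\<bar> \<le> 1" for h
    unfolding q_def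
    using int_\<psi>[of "a + h" "a + h"] int_\<psi>[of a "a + h"] int_I[of a] int_I[of "a + h"] that
    by (intro borel_measurable_divide borel_measurable_diff borel_measurable_add borel_measurable_const)
       (auto dest: borel_measurable_integrable)
  have path: "\<exists>\<xi> \<eta>. \<bar>\<xi> - a\<bar> \<le> \<bar>h\<bar> \<and> \<bar>\<eta> - a\<bar> \<le> \<bar>h\<bar> \<and>
        q h \<omega> = \<psi>' \<xi> (X ((a + h)\<^sup>2) \<omega>) + 2 * \<eta> * G (X (\<eta>\<^sup>2) \<omega>)"
    if \<omega>: "\<omega> \<in> space M" and h: "h \<noteq> 0" for h \<omega>
  proof -
    obtain \<xi> where \<xi>: "\<bar>\<xi> - a\<bar> \<le> \<bar>h\<bar>"
      "\<psi> (a + h) (X ((a + h)\<^sup>2) \<omega>) - \<psi> a (X ((a + h)\<^sup>2) \<omega>) = h * \<psi>' \<xi> (X ((a + h)\<^sup>2) \<omega>)"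
      using mvt_increment[of a h "\<lambda>r. \<psi> r (X ((a + h)\<^sup>2) \<omega>)" "\<lambda>r. \<psi>' r (X ((a + h)\<^sup>2) \<omega>)"] deriv by blast
    have "continuous_on {0..} (\<lambda>s. G (X s \<omega>))"
      by (rule continuous_on_compose2[OF cont_gen[folded G_def] continuous_paths[OF \<omega>]]) simp
    then have "((\<lambda>r. I r \<omega>) has_real_derivative 2 * s * G (X (s\<^sup>2) \<omega>)) (at s)" for s
      unfolding I_def by (rule set_integral_square_derivative)
    then obtain \<eta> where \<eta>: "\<bar>\<eta> - a\<bar> \<le> \<bar>h\<bar>" "I (a + h) \<omega> - I a \<omega> = h * (2 * \<eta> * G (X (\<eta>\<^sup>2) \<omega>))"
      using mvt_increment[of a h "\<lambda>r. I r \<omega>" "\<lambda>s. 2 * s * G (X (s\<^sup>2) \<omega>)"] by blast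
    have "q h \<omega> = \<psi>' \<xi> (X ((a + h)\<^sup>2) \<omega>) + 2 * \<eta> * G (X (\<eta>\<^sup>2) \<omega>)"
      unfolding q_def \<xi>(2) \<eta>(2) using h by (simp add: field_simps)
    with \<xi>(1) \<eta>(1) show ?thesis by blast
  qed
  have lim_path: "(\<lambda>n. q (h n) \<omega>) \<longlonglongrightarrow> D \<omega>"
    if \<omega>: "\<omega> \<in> space M" and h: "h \<longlonglongrightarrow> 0" "\<And>n. h n \<noteq> 0" for h :: "nat \<Rightarrow> real" and \<omega>
  proof -
    obtain \<xi> \<eta> where *: "\<And>n. \<bar>\<xi> n - a\<bar> \<le> \<bar>h n\<bar>" "\<And>n. \<bar>\<eta> n - a\<bar> \<le> \<bar>h n\<bar>"
        "\<And>n. q (h n) \<omega> = \<psi>' (\<xi> n) (X ((a + h n)\<^sup>2) \<omega>) + 2 * \<eta> n * G (X ((\<eta> n)\<^sup>2) \<omega>)"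
      using path[OF \<omega> h(2)] by metis
    have near: "u \<longlonglongrightarrow> a" if "\<And>n. \<bar>u n - a\<bar> \<le> \<bar>h n\<bar>" for u
    proof -
      have "(\<lambda>n. u n - a) \<longlonglongrightarrow> 0"
        by (rule Lim_null_comparison[OF _ tendsto_rabs_zero[OF h(1)]]) (use that in auto)
      then show ?thesis using LIM_zero_iff by blast
    qed
    have lim_X: "(\<lambda>n. X ((u n)\<^sup>2) \<omega>) \<longlonglongrightarrow> X (a\<^sup>2) \<omega>" if "u \<longlonglongrightarrow> a" for u
      by (rule continuous_on_tendsto_compose[OF continuous_paths[OF \<omega>]])
         (use that in \<open>auto intro!: tendsto_intros\<close>)
    have "(\<lambda>n. (\<xi> n, X ((a + h n)\<^sup>2) \<omega>)) \<longlonglongrightarrow> (a, X (a\<^sup>2) \<omega>)"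
      by (intro tendsto_Pair near *(1) lim_X) auto
    from continuous_on_tendsto_compose[OF cont' this]
    have "(\<lambda>n. \<psi>' (\<xi> n) (X ((a + h n)\<^sup>2) \<omega>)) \<longlonglongrightarrow> \<psi>' a (X (a\<^sup>2) \<omega>)" by simp
    moreover have "(\<lambda>n. G (X ((\<eta> n)\<^sup>2) \<omega>)) \<longlonglongrightarrow> G (X (a\<^sup>2) \<omega>)"
      by (rule continuous_on_tendsto_compose[OF cont_gen[folded G_def] lim_X[OF near[OF *(2)]]]) auto
    ultimately show ?thesis
      unfolding *(3) D_def by (intro tendsto_intros near[OF *(2)])
  qed
  have "(\<lambda>h. (\<Phi> (a + h) - \<Phi> a) / h) \<midarrow>0\<rightarrow> expectation D"
    unfolding tendsto_at_iff_sequentially comp_def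
  proof (intro allI impI)
    fix h :: "nat \<Rightarrow> real" assume "\<forall>n. h n \<in> UNIV - {0}" and h0: "h \<longlonglongrightarrow> 0"
    then have hn: "h n \<noteq> 0" for n by auto
    have "\<forall>\<^sub>F n in sequentially. \<bar>h n\<bar> < 1"
      using tendsto_rabs_zero[OF h0] by (rule order_tendstoD) simp
    then obtain n0 where n0: "\<And>n. n0 \<le> n \<Longrightarrow> \<bar>h n\<bar> < 1"
      by (auto simp: eventually_sequentially)
    define g where "g n = h (n + n0)" for n
    have g: "g \<longlonglongrightarrow> 0" "\<And>n. g n \<noteq> 0" "\<And>n. \<bar>g n\<bar> \<le> 1"
      using LIMSEQ_ignore_initial_segment[OF h0, of n0] hn n0 by (auto simp: g_def[abs_def] less_imp_le)
    have "(\<lambda>n. expectation (q (g n))) \<longlonglongrightarrow> expectation D"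
    proof (rule integral_dominated_convergence[where w = "\<lambda>_. K + 2 * (\<bar>a\<bar> + 1) * K"])
      have "continuous_on UNIV (\<psi>' a)"
        using continuous_on_compose2[OF cont', of UNIV "\<lambda>x. (a, x)"]
          continuous_on_Pair[OF continuous_on_const continuous_on_id, of UNIV a] by simp
      then have "(\<lambda>\<omega>. \<psi>' a (X (a\<^sup>2) \<omega>)) \<in> borel_measurable M" "(\<lambda>\<omega>. G (X (a\<^sup>2) \<omega>)) \<in> borel_measurable M"
        using measurable_continuous[of "\<psi>' a"] measurable_continuous[OF cont_gen]
        by (auto simp: G_def)
      then show "D \<in> borel_measurable M" unfolding D_def by simp
      show "AE \<omega> in M. (\<lambda>n. q (g n) \<omega>) \<longlonglongrightarrow> D \<omega>"
        by (rule AE_I2) (rule lim_path[OF _ g(1,2)])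
      fix n
      show "q (g n) \<in> borel_measurable M" by (rule meas_q[OF g(3)])
      show "AE \<omega> in M. norm (q (g n) \<omega>) \<le> K + 2 * (\<bar>a\<bar> + 1) * K"
      proof (rule AE_I2)
        fix \<omega> assume \<omega>: "\<omega> \<in> space M"
        obtain \<xi> \<eta> where *: "\<bar>\<xi> - a\<bar> \<le> \<bar>g n\<bar>" "\<bar>\<eta> - a\<bar> \<le> \<bar>g n\<bar>"
          "q (g n) \<omega> = \<psi>' \<xi> (X ((a + g n)\<^sup>2) \<omega>) + 2 * \<eta> * G (X (\<eta>\<^sup>2) \<omega>)"
          using path[OF \<omega> g(2)] by blast
        have "\<bar>\<psi>' \<xi> (X ((a + g n)\<^sup>2) \<omega>)\<bar> \<le> K"
          using *(1) g(3)[of n] by (intro bound' in_chamber[OF \<omega>]) auto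
        moreover have "\<bar>2 * \<eta> * G (X (\<eta>\<^sup>2) \<omega>)\<bar> \<le> 2 * (\<bar>a\<bar> + 1) * K"
          unfolding abs_mult using *(2) g(3)[of n] bound_gen[OF in_chamber[OF \<omega>], of "\<eta>\<^sup>2"]
          by (intro mult_mono) (auto simp: G_def)
        ultimately show "norm (q (g n) \<omega>) \<le> K + 2 * (\<bar>a\<bar> + 1) * K"
          unfolding *(3) by simp
      qed
    qed simp
    then have "(\<lambda>n. (\<Phi> (a + h (n + n0)) - \<Phi> a) / h (n + n0)) \<longlonglongrightarrow> expectation D"
      using exp_q[OF g(3)] by (simp add: g_def)
    then show "(\<lambda>n. (\<Phi> (a + h n) - \<Phi> a) / h n) \<longlonglongrightarrow> expectation D"
      by (rule LIMSEQ_offset)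
  qed
  then show ?thesis
    unfolding \<Phi>_def[abs_def] D_def G_def DERIV_def by simp
qed

end

lemma bounded_of_ball_support:
  fixes f :: "real \<times> (nat \<Rightarrow> real) \<Rightarrow> real"
  assumes cont: "continuous_on UNIV f"
    and zero: "\<And>r x. R \<le> sq_norm N x \<Longrightarrow> f (r, x) = 0" and "0 < R"
  obtains K where "0 \<le> K" "\<And>r x. \<lbrakk>\<bar>r - a\<bar> \<le> 1; x \<in> config_space N\<rbrakk> \<Longrightarrow> \<bar>f (r, x)\<bar> \<le> K"
proof -
  define S where "S = {a - 1..a + 1} \<times> PiE {1..N} (\<lambda>_. {- sqrt R..sqrt R})"
  have "compact S"
    unfolding S_def by (intro compact_Times compact_box compact_Icc)
  then have "bounded (f ` S)"
    by (intro compact_imp_bounded compact_continuous_image continuous_on_subset[OF cont]) auto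
  then obtain K where K: "0 < K" "\<And>y. y \<in> S \<Longrightarrow> \<bar>f y\<bar> \<le> K"
    unfolding bounded_pos by auto
  have "\<bar>f (r, x)\<bar> \<le> K" if "\<bar>r - a\<bar> \<le> 1" "x \<in> config_space N" for r x
  proof (cases "R \<le> sq_norm N x")
    case True
    then show ?thesis using zero K(1) by simp
  next
    case False
    have "x i \<in> {- sqrt R..sqrt R}" if "i \<in> {1..N}" for i
    proof -
      have "(x i)\<^sup>2 \<le> R" using coordinate_le_sq_norm[OF that, of x] False by simp
      then have "\<bar>x i\<bar> \<le> sqrt R" by (simp add: real_le_rsqrt)
      then show ?thesis by auto
    qed
    then have "(r, x) \<in> S"
      using that by (auto simp: S_def config_space_def PiE_iff)
    then show ?thesis by (rule K(2))
  qed
  then show thesis using that[of K] K(1) by simp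
qed

lemma sum_inv_gap_position_bounds:
  "0 \<le> (\<Sum>i=1..N. x i * inv_gap_sum N x i)" "(\<Sum>i=1..N. x i * inv_gap_sum N x i) \<le> real (N * (N - 1)) / 2"
proof -
  have "(\<Sum>j=1..N. (x i - x j) / (x i - x j)) \<le> real (N - 1)" if i: "i \<in> {1..N}" for i
  proof -
    have "(\<Sum>j=1..N. (x i - x j) / (x i - x j)) = (\<Sum>j\<in>{1..N} - {i}. (x i - x j) / (x i - x j))"
      using i by (subst sum.remove[of _ i]) auto
    also have "\<dots> \<le> (\<Sum>j\<in>{1..N} - {i}. 1)"
      by (intro sum_mono) auto
    also have "\<dots> = real (N - 1)" using i by simp
    finally show ?thesis .
  qed
  then have "(\<Sum>i=1..N. \<Sum>j=1..N. (x i - x j) / (x i - x j)) \<le> (\<Sum>i=1..N. real (N - 1))"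
    by (intro sum_mono) auto
  also have "\<dots> = real (N * (N - 1))"
    by (simp only: sum_constant card_atLeastAtMost of_nat_mult) simp
  finally show "(\<Sum>i=1..N. x i * inv_gap_sum N x i) \<le> real (N * (N - 1)) / 2"
    unfolding sum_inv_gap_mult by simp
  show "0 \<le> (\<Sum>i=1..N. x i * inv_gap_sum N x i)"
    unfolding sum_inv_gap_mult by (auto intro!: sum_nonneg)
qed

lemma chamber_config: "x \<in> weyl_chamber_A N \<Longrightarrow> x \<in> config_space N"
  by (simp add: weyl_chamber_A_def)

context bessel_zero begin

text \<open>
  The product rule in space and time for \<open>p r * \<phi> (\<langle>w r,
  x\<rangle>)\<close> times the cut-off. Every bound required by
  \<open>expectation_derivative\<close> comes from continuity and the compact support.
\<close>
lemma cutoff_test_derivative: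
  fixes w w' :: "real \<Rightarrow> nat \<Rightarrow> real" and a :: real and y :: "real \<Rightarrow> (nat \<Rightarrow> real) \<Rightarrow> real"
  assumes \<delta>R: "0 < \<delta>" "0 < R"
    and \<phi>: "\<And>y. (\<phi> has_real_derivative \<phi>' y) (at y)" "\<And>y. (\<phi>' has_real_derivative \<phi>'' y) (at y)"
      "continuous_on UNIV \<phi>''"
    and p: "\<And>r. (p has_real_derivative p' r) (at r)" "continuous_on UNIV p'"
    and w: "\<And>r i. ((\<lambda>r. w r i) has_real_derivative w' r i) (at r)" "\<And>i. continuous_on UNIV (\<lambda>r. w' r i)"
  defines "y \<equiv> \<lambda>r x. \<Sum>i=1..N. w r i * x i"
    and "drift \<equiv> \<lambda>x. (p' a * \<phi> (y a x) + p a * (\<phi>' (y a x) * (\<Sum>i=1..N. w' a i * x i))) * cutoff N \<delta> R x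
      + 2 * a * (p a * \<phi> (y a x) * bessel_generator_A N k (cutoff N \<delta> R) x
        + (p a * \<phi>'' (y a x) / 2 * (\<Sum>i=1..N. (w a i)\<^sup>2) * cutoff N \<delta> R x
            + k * (p a * \<phi>' (y a x)) * (\<Sum>i=1..N. w a i * (inv_gap_sum N x i * cutoff N \<delta> R x)))
        + p a * \<phi>' (y a x) * (\<Sum>i=1..N. w a i * cutoff_grad N \<delta> R i x))"
  shows "((\<lambda>r. expectation (\<lambda>\<omega>. p r * \<phi> (y r (X (r\<^sup>2) \<omega>)) * cutoff N \<delta> R (X (r\<^sup>2) \<omega>)))
    has_real_derivative expectation (\<lambda>\<omega>. drift (X (a\<^sup>2) \<omega>))) (at a)"
    and "integrable M (\<lambda>\<omega>. drift (X (a\<^sup>2) \<omega>))"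
proof -
  define \<psi> where "\<psi> r x = (p r * \<phi> (y r x)) * cutoff N \<delta> R x" for r x
  define \<psi>' where "\<psi>' r x = (p' r * \<phi> (y r x) + p r * (\<phi>' (y r x) * (\<Sum>i=1..N. w' r i * x i))) * cutoff N \<delta> R x" for r x
  define G where "G x = p a * \<phi> (y a x) * bessel_generator_A N k (cutoff N \<delta> R) x
        + (p a * \<phi>'' (y a x) / 2 * (\<Sum>i=1..N. (w a i)\<^sup>2) * cutoff N \<delta> R x
            + k * (p a * \<phi>' (y a x)) * (\<Sum>i=1..N. w a i * (inv_gap_sum N x i * cutoff N \<delta> R x)))
        + p a * \<phi>' (y a x) * (\<Sum>i=1..N. w a i * cutoff_grad N \<delta> R i x)" for x
  have sc: "\<And>z. ((\<lambda>z. p r * \<phi> z) has_real_derivative p r * \<phi>' z) (at z)"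
    "\<And>z. ((\<lambda>z. p r * \<phi>' z) has_real_derivative p r * \<phi>'' z) (at z)"
    "continuous_on UNIV (\<lambda>z. p r * \<phi>'' z)" for r
    using \<phi> by (auto intro!: DERIV_cmult continuous_intros)
  have gen: "bessel_generator_A N k (\<psi> a) = G"
  proof
    fix x
    show "bessel_generator_A N k (\<psi> a) x = G x"
      unfolding \<psi>_def[abs_def] G_def y_def by (rule linear_test_generator(1)[OF \<delta>R sc])
  qed
  have refl: "reflecting_test_fun N (\<psi> r)" for r
    unfolding \<psi>_def[abs_def] y_def by (rule linear_test_generator(2)[OF \<delta>R sc])
  have snd_coord: "continuous_on UNIV (\<lambda>q :: real \<times> (nat \<Rightarrow> real). snd q i)" for i
    by (rule continuous_on_compose2[OF continuous_on_coordinate[of UNIV i] continuous_on_snd[OF continuous_on_id]]) simp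
  have comp_fst: "continuous_on UNIV (\<lambda>q :: real \<times> (nat \<Rightarrow> real). f (fst q))"
    if "continuous_on UNIV f" for f :: "real \<Rightarrow> real"
    by (rule continuous_on_compose2[OF that continuous_on_fst[OF continuous_on_id]]) simp
  have cw: "continuous_on UNIV (\<lambda>r. w r i)" for i
    using w(1) by (intro DERIV_continuous_on) auto
  have cy: "continuous_on UNIV (\<lambda>q. y (fst q) (snd q))"
    unfolding y_def by (intro continuous_on_sum continuous_on_mult snd_coord comp_fst cw)
  have c1: "continuous_on UNIV \<phi>" "continuous_on UNIV \<phi>'" "continuous_on UNIV p"
    using \<phi> p by (auto intro!: DERIV_continuous_on)
  have c2: "continuous_on UNIV (\<lambda>q :: real \<times> (nat \<Rightarrow> real). \<Sum>i=1..N. w' (fst q) i * snd q i)"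
    by (intro continuous_on_sum continuous_on_mult snd_coord comp_fst w(2))
  have cut: "continuous_on UNIV (\<lambda>q :: real \<times> (nat \<Rightarrow> real). cutoff N \<delta> R (snd q))"
    by (rule continuous_on_compose2[OF continuous_cutoff(1)[OF \<delta>R] continuous_on_snd[OF continuous_on_id]]) simp
  have cp: "continuous_on UNIV (\<lambda>q :: real \<times> (nat \<Rightarrow> real). p (fst q))" "continuous_on UNIV (\<lambda>q :: real \<times> (nat \<Rightarrow> real). p' (fst q))"
    by (intro comp_fst c1 p(2))+
  note c\<phi> = continuous_on_compose2[OF c1(1) cy] continuous_on_compose2[OF c1(2) cy] continuous_on_compose2[OF \<phi>(3) cy]
  have cont: "continuous_on UNIV (\<lambda>q. \<psi> (fst q) (snd q))"
    unfolding \<psi>_def by (intro continuous_on_mult cut cp c\<phi>) auto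
  have cont': "continuous_on UNIV (\<lambda>q. \<psi>' (fst q) (snd q))"
    unfolding \<psi>'_def by (intro continuous_on_mult continuous_on_add cut cp c\<phi> c2) auto
  have slice: "continuous_on UNIV (\<lambda>x. f a x)" if "continuous_on UNIV (\<lambda>q. f (fst q) (snd q))"
    for f :: "real \<Rightarrow> (nat \<Rightarrow> real) \<Rightarrow> real" and a
    using continuous_on_compose2[OF that, of UNIV "\<lambda>x. (a, x)"]
      continuous_on_Pair[OF continuous_on_const continuous_on_id, of UNIV a] by simp
  have contG: "continuous_on UNIV G"
  proof -
    have ya: "continuous_on UNIV (\<lambda>x. y a x)"
      unfolding y_def by (intro continuous_intros)
    note s = continuous_on_compose2[OF c1(1) ya] continuous_on_compose2[OF c1(2) ya] continuous_on_compose2[OF \<phi>(3) ya]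
    show ?thesis
      unfolding G_def[abs_def]
      by (intro continuous_on_add continuous_on_mult continuous_on_divide continuous_on_const continuous_on_sum s
          continuous_cutoff_generator[OF \<delta>R] continuous_cutoff[OF \<delta>R] continuous_inv_gap_cutoff[OF \<delta>R]) auto
  qed
  note zero = cutoff_outside[OF \<delta>R]
  have z1: "\<psi> (fst (r, x)) (snd (r, x)) = 0" and z2: "\<psi>' (fst (r, x)) (snd (r, x)) = 0" and z3: "G (snd (r, x)) = 0"
    if "R \<le> sq_norm N x" for r x
    using zero[OF that] by (simp_all add: \<psi>_def \<psi>'_def G_def)
  obtain K1 where K1: "0 \<le> K1" "\<And>r x. \<bar>r - a\<bar> \<le> 1 \<Longrightarrow> x \<in> config_space N \<Longrightarrow> \<bar>\<psi> (fst (r, x)) (snd (r, x))\<bar> \<le> K1"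
    by (rule bounded_of_ball_support[OF cont z1 \<delta>R(2), where a = a and N = N]) (assumption, rule that)
  obtain K2 where K2: "0 \<le> K2" "\<And>r x. \<bar>r - a\<bar> \<le> 1 \<Longrightarrow> x \<in> config_space N \<Longrightarrow> \<bar>\<psi>' (fst (r, x)) (snd (r, x))\<bar> \<le> K2"
    by (rule bounded_of_ball_support[OF cont' z2 \<delta>R(2), where a = a and N = N]) (assumption, rule that)
  have contG': "continuous_on UNIV (\<lambda>q :: real \<times> (nat \<Rightarrow> real). G (snd q))"
    by (rule continuous_on_compose2[OF contG continuous_on_snd[OF continuous_on_id]]) simp
  obtain K3 where K3: "0 \<le> K3" "\<And>r x. \<bar>r - a\<bar> \<le> 1 \<Longrightarrow> x \<in> config_space N \<Longrightarrow> \<bar>G (snd (r, x))\<bar> \<le> K3"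
    by (rule bounded_of_ball_support[OF contG' z3 \<delta>R(2), where a = a and N = N]) (assumption, rule that)
  define K where "K = K1 + K2 + K3"
  have b1: "\<bar>\<psi> r x\<bar> \<le> K" and b2: "\<bar>\<psi>' r x\<bar> \<le> K" if "\<bar>r - a\<bar> \<le> 1" "x \<in> weyl_chamber_A N" for r x
    using K1(2)[OF that(1) chamber_config[OF that(2)]] K2(2)[OF that(1) chamber_config[OF that(2)]] K1(1) K2(1) K3(1)
    by (simp_all add: K_def)
  have b3: "\<bar>G x\<bar> \<le> K" if "x \<in> weyl_chamber_A N" for x
    using K3(2)[of a x] chamber_config[OF that] K1(1) K2(1) by (simp add: K_def)
  have "((\<lambda>r. \<psi> r x) has_real_derivative \<psi>' r x) (at r)" for r x
  proof -
    have "((\<lambda>r. y r x) has_real_derivative (\<Sum>i=1..N. w' r i * x i)) (at r)"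
      unfolding y_def by (intro DERIV_sum DERIV_cmult_right w(1))
    from DERIV_mult[OF p(1) DERIV_chain2[OF \<phi>(1) this]]
    show ?thesis
      unfolding \<psi>_def \<psi>'_def by (intro DERIV_cmult_right) (simp add: mult.commute)
  qed
  from expectation_derivative[OF refl slice[OF cont] this cont' contG[folded gen] b1 b2 b3[folded gen]]
  have "((\<lambda>r. expectation (\<lambda>\<omega>. \<psi> r (X (r\<^sup>2) \<omega>))) has_real_derivative
      expectation (\<lambda>\<omega>. \<psi>' a (X (a\<^sup>2) \<omega>) + 2 * a * G (X (a\<^sup>2) \<omega>))) (at a)"
    unfolding gen .
  then show "((\<lambda>r. expectation (\<lambda>\<omega>. p r * \<phi> (y r (X (r\<^sup>2) \<omega>)) * cutoff N \<delta> R (X (r\<^sup>2) \<omega>)))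
    has_real_derivative expectation (\<lambda>\<omega>. drift (X (a\<^sup>2) \<omega>))) (at a)"
    by (simp only: \<psi>_def \<psi>'_def G_def drift_def)
  have "integrable M (\<lambda>\<omega>. \<psi>' a (X (a\<^sup>2) \<omega>) + 2 * a * G (X (a\<^sup>2) \<omega>))"
    by (intro Bochner_Integration.integrable_add integrable_mult_right integrable_continuous[where K = K]
        slice[OF cont'] contG b2 b3) auto
  then show "integrable M (\<lambda>\<omega>. drift (X (a\<^sup>2) \<omega>))"
    by (simp only: \<psi>'_def G_def drift_def)
qed

end

section \<open>The second moment\<close>

text \<open>
  For \<open>R \<rightarrow> \<infinity>\<close> the function increases by
  \<open>|x|\<^sup>2\<close> over its value at \<open>0\<close>. It is concave in
  \<open>|x|\<^sup>2\<close>, so truncation only lowers the generator, and it is symmetric, so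
  it satisfies the reflecting condition without a factor vanishing on the walls.
\<close>
lemma ball_test_function:
  fixes N :: nat and R :: real
  assumes "0 < R" "0 \<le> k"
  defines "f \<equiv> \<lambda>x. - (R / 3) * ball_cutoff R (sq_norm N x)"
  shows "reflecting_test_fun N f" "bessel_generator_A N k f x \<le> real N + k * real (N * (N - 1))"
proof -
  have "has_partials N f (\<lambda>i x. (- (R / 3) * ball_cutoff' R (sq_norm N x)) * (2 * x i))
    (\<lambda>i j x. (- (R / 3) * ball_cutoff'' R (sq_norm N x)) * (2 * x j) * (2 * x i)
      + (- (R / 3) * ball_cutoff' R (sq_norm N x)) * (if i = j then 2 else 0))"
    unfolding f_def
    by (rule has_partials_compose[OF sq_norm_partials DERIV_cmult[OF ball_cutoff_derivatives(1)[OF assms(1)]]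
          DERIV_cmult[OF ball_cutoff_derivatives(2)[OF assms(1)]]
          continuous_on_mult_left[OF ball_cutoff_derivatives(3)[OF assms(1)]]])
  note f = this
  show "reflecting_test_fun N f"
    unfolding reflecting_test_fun_def
  proof (intro conjI ballI impI)
    show "C2_fun N f" by (rule has_partials_C2_fun[OF f])
    have "f x = 0" if i: "i \<in> {1..N}" and x: "sqrt R < \<bar>x i\<bar>" for x i
    proof -
      have "R = (sqrt R)\<^sup>2" using assms(1) by simp
      also have "\<dots> \<le> \<bar>x i\<bar>\<^sup>2" using x assms(1) by (intro power_mono) auto
      also have "\<dots> = (x i)\<^sup>2" by simp
      also have "\<dots> \<le> sq_norm N x" by (rule coordinate_le_sq_norm[OF i])
      finally show ?thesis using ball_cutoff_outside(1)[OF assms(1)] by (simp add: f_def)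
    qed
    then show "\<exists>R'. \<forall>x\<in>config_space N. (\<exists>i\<in>{1..N}. R' < \<bar>x i\<bar>) \<longrightarrow> f x = 0"
      by blast
    fix x :: "nat \<Rightarrow> real" and i j assume "i \<in> {1..N}" "j \<in> {1..N}" "x i = x j"
    then show "partial_deriv i f x = partial_deriv j f x"
      using has_partials_partial_deriv(1)[OF f] by simp
  qed
  define v where "v = sq_norm N x"
  define b where "b = - (R / 3) * ball_cutoff' R v"
  note bb = ball_cutoff_bounds[OF assms(1) sq_norm_nonneg[of N x], folded v_def]
  have b: "0 \<le> b" "b \<le> 1"
    using bb(3,4) assms(1) by (auto simp: b_def field_simps mult_le_0_iff)
  have "bessel_generator_A N k f x
      = - (R / 3) * ball_cutoff'' R v * 2 * v + real N * b + k * (2 * b) * (\<Sum>i=1..N. x i * inv_gap_sum N x i)"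
  proof -
    have "(\<Sum>i=1..N. (- (R / 3) * ball_cutoff'' R v) * (2 * x i) * (2 * x i) + b * (if i = i then 2 else 0))
      = (\<Sum>i=1..N. (- (R / 3) * ball_cutoff'' R v * 4) * (x i)\<^sup>2 + b * 2)"
      by (intro sum.cong refl) (simp add: power2_eq_square)
    also have "\<dots> = (- (R / 3) * ball_cutoff'' R v * 4) * v + real N * (b * 2)"
      unfolding sum.distrib v_def sq_norm_def sum_distrib_left by simp
    finally have 1: "(\<Sum>i=1..N. (- (R / 3) * ball_cutoff'' R v) * (2 * x i) * (2 * x i) + b * (if i = i then 2 else 0))
      = (- (R / 3) * ball_cutoff'' R v * 4) * v + real N * (b * 2)" .
    have "(\<Sum>i=1..N. inv_gap_sum N x i * (b * (2 * x i))) = (\<Sum>i=1..N. (2 * b) * (x i * inv_gap_sum N x i))"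
      by (intro sum.cong refl) simp
    also have "\<dots> = 2 * b * (\<Sum>i=1..N. x i * inv_gap_sum N x i)"
      by (simp only: sum_distrib_left)
    finally have 2: "(\<Sum>i=1..N. inv_gap_sum N x i * (b * (2 * x i))) = 2 * b * (\<Sum>i=1..N. x i * inv_gap_sum N x i)" .
    show ?thesis
      unfolding generator_eq[OF f] v_def[symmetric] b_def[symmetric] 1 2 by (simp add: algebra_simps)
  qed
  also have "\<dots> \<le> 0 + real N * 1 + k * (2 * 1) * (real (N * (N - 1)) / 2)"
  proof (intro add_mono mult_mono mult_left_mono)
    show "- (R / 3) * ball_cutoff'' R v * 2 * v \<le> 0"
      using bb(5) assms(1) sq_norm_nonneg[of N x] by (simp add: v_def)
    show "(\<Sum>i=1..N. x i * inv_gap_sum N x i) \<le> real (N * (N - 1)) / 2"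
      by (rule sum_inv_gap_position_bounds)
    show "0 \<le> (\<Sum>i=1..N. x i * inv_gap_sum N x i)"
      by (rule sum_inv_gap_position_bounds)
  qed (use b assms(2) in auto)
  finally show "bessel_generator_A N k f x \<le> real N + k * real (N * (N - 1))"
    by simp
qed

lemma ball_cutoff_almost_linear:
  assumes "0 < R" "0 \<le> v"
  shows "v - v\<^sup>2 / R \<le> R / 3 - R / 3 * ball_cutoff R v"
proof -
  define s where "s = v / R"
  have v: "v = s * R" and s: "0 \<le> s" using assms by (simp_all add: s_def)
  have "s - s\<^sup>2 \<le> (1 - (max 0 (1 - s)) ^ 3) / 3"
  proof (cases "s \<le> 1")
    case True
    have "(1 - (1 - s) ^ 3) / 3 = s - s\<^sup>2 + s ^ 3 / 3"
      by (simp add: power3_eq_cube power2_eq_square field_simps)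
    then show ?thesis using True s by simp
  next
    case False
    then have "s \<le> s\<^sup>2" by (simp add: power2_eq_square)
    then show ?thesis using False by simp
  qed
  then have "R * (s - s\<^sup>2) \<le> R * ((1 - (max 0 (1 - s)) ^ 3) / 3)"
    using assms(1) by (intro mult_left_mono) auto
  then show ?thesis
    using assms(1) by (simp add: ball_cutoff_def v power2_eq_square algebra_simps)
qed

context bessel_zero begin

lemma start_AE: "AE \<omega> in M. \<forall>i\<in>{1..N}. X 0 \<omega> i = 0"
  using start by (simp add: started_at_zero_def)

lemma continuous_sq_norm: "continuous_on UNIV (sq_norm N)"
  by (rule has_partialsD(1)[OF sq_norm_partials])

lemma continuous_ball_cutoff: "0 < R \<Longrightarrow> continuous_on UNIV (\<lambda>x. ball_cutoff R (sq_norm N x))"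
  using ball_factor_partials[of R N] has_partialsD(1) by blast

lemma expectation_ball_cutoff:
  assumes "0 < R" "0 \<le> k" "0 \<le> t"
  shows "expectation (\<lambda>\<omega>. R / 3 - R / 3 * ball_cutoff R (sq_norm N (X t \<omega>))) \<le> t * (real N + k * real (N * (N - 1)))"
proof -
  define C where "C = real N + k * real (N * (N - 1))"
  have C: "0 \<le> C" using assms(2) by (simp add: C_def)
  define f where "f x = - (R / 3) * ball_cutoff R (sq_norm N x)" for x
  define I where "I \<omega> = (LINT s:{0..t}|lborel. bessel_generator_A N k f (X s \<omega>))" for \<omega>
  have f: "reflecting_test_fun N f" "\<And>x. bessel_generator_A N k f x \<le> C"
    using ball_test_function[OF assms(1,2), of N] by (simp_all add: f_def[abs_def] C_def)
  have cf: "continuous_on UNIV f"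
    unfolding f_def[abs_def] by (intro continuous_intros continuous_ball_cutoff[OF assms(1)])
  have bound_f: "\<bar>f x\<bar> \<le> R / 3" for x
    using ball_cutoff_bounds(1,2)[OF assms(1) sq_norm_nonneg[of N x]] assms(1) by (simp add: f_def abs_mult)
  have int_f: "integrable M (\<lambda>\<omega>. f (X s \<omega>))" if "0 \<le> s" for s
    by (rule integrable_continuous[OF cf that bound_f])
  note mart = martingale_problem[OF f(1) assms(3), folded I_def]
  have "integrable M (\<lambda>\<omega>. (f (X t \<omega>) - f (X 0 \<omega>)) - (f (X t \<omega>) - f (X 0 \<omega>) - I \<omega>))"
    by (rule Bochner_Integration.integrable_diff[OF Bochner_Integration.integrable_diff[OF int_f int_f] mart(1)])
       (use assms in auto)
  then have int_I: "integrable M I" by simp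
  have I: "I \<omega> \<le> t * C" for \<omega>
  proof (cases "set_integrable lborel {0..t} (\<lambda>s. bessel_generator_A N k f (X s \<omega>))")
    case True
    have "I \<omega> \<le> (LINT s:{0..t}|lborel. C)"
      unfolding I_def using f(2)
      by (intro set_integral_mono[OF True borel_integrable_atLeastAtMost']) auto
    also have "\<dots> = t * C" using assms(3) by (simp add: set_lebesgue_integral_def)
    finally show ?thesis .
  next
    case False
    then have "I \<omega> = 0"
      by (simp add: I_def set_lebesgue_integral_def set_integrable_def not_integrable_integral_eq)
    then show ?thesis using assms(3) C by simp
  qed
  have "expectation (\<lambda>\<omega>. f (X 0 \<omega>)) = expectation (\<lambda>\<omega>. - (R / 3))"
  proof (rule integral_cong_AE)
    show "AE \<omega> in M. f (X 0 \<omega>) = - (R / 3)"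
      using start_AE by eventually_elim (simp add: f_def ball_cutoff_def sq_norm_def)
  qed (use int_f[of 0] borel_measurable_integrable in auto)
  then have "expectation (\<lambda>\<omega>. f (X 0 \<omega>)) = - (R / 3)" by (simp add: prob_space)
  moreover have "expectation I \<le> t * C"
    using int_I I by (intro integral_le_const) auto
  moreover have "expectation (\<lambda>\<omega>. f (X t \<omega>)) - expectation (\<lambda>\<omega>. f (X 0 \<omega>)) - expectation I = 0"
    using mart(2) int_f[OF assms(3)] int_f[of 0] int_I by simp
  moreover have "expectation (\<lambda>\<omega>. R / 3 - R / 3 * ball_cutoff R (sq_norm N (X t \<omega>))) = R / 3 + expectation (\<lambda>\<omega>. f (X t \<omega>))"
    using int_f[OF assms(3)] by (simp add: f_def prob_space)
  ultimately show ?thesis by (simp add: C_def)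
qed

lemma second_moment:
  assumes "0 < \<delta>" "0 < R" "0 \<le> k" "0 \<le> t"
  shows "expectation (\<lambda>\<omega>. sq_norm N (X t \<omega>) * cutoff N \<delta> R (X t \<omega>)) \<le> t * (real N + k * real (N * (N - 1)))"
proof (rule field_le_epsilon)
  fix e :: real assume e: "0 < e"
  \<comment> \<open>a truncation radius so large that on the support of the cut-off it changes
    \<open>|x|\<^sup>2\<close> by at most \<open>e\<close>\<close>
  define R' where "R' = R\<^sup>2 / e"
  have R': "0 < R'" "R\<^sup>2 / R' = e" using e assms(2) by (simp_all add: R'_def)
  have le: "sq_norm N x * cutoff N \<delta> R x \<le> (R' / 3 - R' / 3 * ball_cutoff R' (sq_norm N x)) + e" for x
  proof (cases "R \<le> sq_norm N x")
    case True
    have "0 \<le> R' / 3 * (1 - ball_cutoff R' (sq_norm N x))"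
      using ball_cutoff_bounds(2)[OF R'(1) sq_norm_nonneg[of N x]] R'(1) by simp
    then show ?thesis using cutoff_outside(1)[OF assms(1,2) True] e by (simp add: algebra_simps)
  next
    case False
    have "sq_norm N x * cutoff N \<delta> R x \<le> sq_norm N x * 1"
      using cutoff_bounds[OF assms(1,2)] by (intro mult_left_mono sq_norm_nonneg) auto
    moreover have "(sq_norm N x)\<^sup>2 / R' \<le> R\<^sup>2 / R'"
      using False R'(1) sq_norm_nonneg[of N x] by (intro divide_right_mono power_mono) auto
    ultimately show ?thesis
      using ball_cutoff_almost_linear[OF R'(1) sq_norm_nonneg[of N x]] R'(2) by simp
  qed
  have c1: "continuous_on UNIV (\<lambda>x. sq_norm N x * cutoff N \<delta> R x)"
    by (intro continuous_on_mult continuous_sq_norm continuous_cutoff[OF assms(1,2)])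
  have b1: "\<bar>sq_norm N x * cutoff N \<delta> R x\<bar> \<le> R" for x
  proof (cases "R \<le> sq_norm N x")
    case True
    then show ?thesis using cutoff_outside(1)[OF assms(1,2) True] assms(2) by simp
  next
    case False
    then show ?thesis
      using cutoff_bounds[OF assms(1,2), of N x] sq_norm_nonneg[of N x]
        mult_mono[of "sq_norm N x" R "cutoff N \<delta> R x" 1] by (simp add: abs_mult)
  qed
  have c2: "continuous_on UNIV (\<lambda>x. R' / 3 - R' / 3 * ball_cutoff R' (sq_norm N x))"
    by (intro continuous_intros continuous_ball_cutoff[OF R'(1)])
  have b2: "\<bar>R' / 3 - R' / 3 * ball_cutoff R' (sq_norm N x)\<bar> \<le> R'" for x
  proof -
    have "R' / 3 * ball_cutoff R' (sq_norm N x) \<le> R' / 3 * 1"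
      using ball_cutoff_bounds(2)[OF R'(1) sq_norm_nonneg[of N x]] R'(1) by (intro mult_left_mono) auto
    moreover have "0 \<le> R' / 3 * ball_cutoff R' (sq_norm N x)"
      using ball_cutoff_bounds(1)[OF R'(1) sq_norm_nonneg[of N x]] R'(1) by (intro mult_nonneg_nonneg) auto
    ultimately show ?thesis using R'(1) by simp
  qed
  have int2: "integrable M (\<lambda>\<omega>. R' / 3 - R' / 3 * ball_cutoff R' (sq_norm N (X t \<omega>)))"
    by (rule integrable_continuous[OF c2 assms(4) b2])
  have "expectation (\<lambda>\<omega>. sq_norm N (X t \<omega>) * cutoff N \<delta> R (X t \<omega>))
      \<le> expectation (\<lambda>\<omega>. (R' / 3 - R' / 3 * ball_cutoff R' (sq_norm N (X t \<omega>))) + e)"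
    by (rule integral_mono[OF integrable_continuous[OF c1 assms(4) b1]]) (use int2 le in auto)
  also have "\<dots> = expectation (\<lambda>\<omega>. R' / 3 - R' / 3 * ball_cutoff R' (sq_norm N (X t \<omega>))) + e"
    using int2 by (subst Bochner_Integration.integral_add) (auto simp: prob_space)
  also have "\<dots> \<le> t * (real N + k * real (N * (N - 1))) + e"
    using expectation_ball_cutoff[OF R'(1) assms(3,4)] by simp
  finally show "expectation (\<lambda>\<omega>. sq_norm N (X t \<omega>) * cutoff N \<delta> R (X t \<omega>)) \<le> t * (real N + k * real (N * (N - 1))) + e" .
qed

section \<open>Absence of mass on the walls\<close>

text \<open>
  By continuity of the paths, \<open>X s\<close> is the limit of \<open>X\<close> at the grid
  times \<open>\<lfloor>(m + 1) * s\<rfloor> / (m + 1)\<close>, and a grid has countably many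
  points.
\<close>
lemma measurable_joint:
  assumes "continuous_on UNIV (f :: (nat \<Rightarrow> real) \<Rightarrow> real)"
  shows "(\<lambda>(s, \<omega>). f (X s \<omega>)) \<in> borel_measurable (restrict_space lborel {0..q} \<Otimes>\<^sub>M M)"
proof -
  define g where "g m = (\<lambda>(s, \<omega>). f (X (real (nat \<lfloor>real (Suc m) * s\<rfloor>) / real (Suc m)) \<omega>))" for m :: nat
  show ?thesis
  proof (rule borel_measurable_LIMSEQ_real)
    fix m
    have "(\<lambda>p. f (X (real (nat \<lfloor>real (Suc m) * fst p\<rfloor>) / real (Suc m)) (snd p)))
        \<in> borel_measurable (restrict_space lborel {0..q} \<Otimes>\<^sub>M M)"
    proof (rule measurable_compose_countable[where f = "\<lambda>i p. f (X (real i / real (Suc m)) (snd p))"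
          and g = "\<lambda>p. nat \<lfloor>real (Suc m) * fst p\<rfloor>"])
      show "(\<lambda>p. f (X (real i / real (Suc m)) (snd p))) \<in> borel_measurable (restrict_space lborel {0..q} \<Otimes>\<^sub>M M)" for i
        by (rule measurable_compose[OF measurable_snd measurable_continuous[OF assms]]) simp
      have "(\<lambda>s. nat \<lfloor>real (Suc m) * s\<rfloor>) \<in> lborel \<rightarrow>\<^sub>M count_space UNIV" by measurable
      then have "(\<lambda>s. nat \<lfloor>real (Suc m) * s\<rfloor>) \<in> restrict_space lborel {0..q} \<rightarrow>\<^sub>M count_space UNIV"
        by (rule measurable_restrict_space1)
      then show "(\<lambda>p. nat \<lfloor>real (Suc m) * fst p\<rfloor>) \<in> restrict_space lborel {0..q} \<Otimes>\<^sub>M M \<rightarrow>\<^sub>M count_space UNIV"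
        by (rule measurable_compose[OF measurable_fst])
    qed
    then show "g m \<in> borel_measurable (restrict_space lborel {0..q} \<Otimes>\<^sub>M M)"
      by (simp add: g_def case_prod_beta)
  next
    fix p assume "p \<in> space (restrict_space lborel {0..q} \<Otimes>\<^sub>M M)"
    then obtain s \<omega> where p: "p = (s, \<omega>)" "0 \<le> s" "\<omega> \<in> space M"
      by (auto simp: space_pair_measure space_restrict_space)
    have "(\<lambda>m. real (nat \<lfloor>real (Suc m) * s\<rfloor>) / real (Suc m)) \<longlonglongrightarrow> s"
    proof (rule tendsto_sandwich[where f = "\<lambda>m. s - 1 / real (Suc m)" and h = "\<lambda>_. s"])
      show "(\<lambda>m. s - 1 / real (Suc m)) \<longlonglongrightarrow> s"
        using tendsto_diff[OF tendsto_const LIMSEQ_Suc[OF lim_1_over_n], of s] by simp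
      have "s * real (Suc m) - 1 \<le> real (nat \<lfloor>real (Suc m) * s\<rfloor>)" "real (nat \<lfloor>real (Suc m) * s\<rfloor>) \<le> s * real (Suc m)" for m
        using p(2) real_of_int_floor_gt_diff_one[of "real (Suc m) * s"] of_int_floor_le[of "real (Suc m) * s"]
        by (simp_all add: mult.commute)
      then show "\<forall>\<^sub>F m in sequentially. s - 1 / real (Suc m) \<le> real (nat \<lfloor>real (Suc m) * s\<rfloor>) / real (Suc m)"
        "\<forall>\<^sub>F m in sequentially. real (nat \<lfloor>real (Suc m) * s\<rfloor>) / real (Suc m) \<le> s"
        by (auto intro!: always_eventually simp: le_divide_eq divide_le_eq left_diff_distrib simp del: of_nat_Suc)
    qed simp
    then have "(\<lambda>m. X (real (nat \<lfloor>real (Suc m) * s\<rfloor>) / real (Suc m)) \<omega>) \<longlonglongrightarrow> X s \<omega>"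
      by (rule continuous_on_tendsto_compose[OF continuous_paths[OF p(3)]]) (use p in auto)
    from continuous_on_tendsto_compose[OF assms this]
    show "(\<lambda>m. g m p) \<longlonglongrightarrow> (case p of (s, \<omega>) \<Rightarrow> f (X s \<omega>))"
      by (simp add: g_def p(1))
  qed
qed

lemma cutoff_tendsto_1:
  assumes "vandermonde N x \<noteq> 0"
  shows "(\<lambda>n. cutoff N (1 / real (Suc n)) (real (Suc n)) x) \<longlonglongrightarrow> 1"
proof -
  define u where "u = vandermonde N x"
  have inv: "(\<lambda>n. 1 / real (Suc n)) \<longlonglongrightarrow> 0"
    by (rule LIMSEQ_Suc[OF lim_1_over_n])
  have "(\<lambda>n. wall_cutoff (1 / real (Suc n)) u) \<longlonglongrightarrow> u ^ 4 / (u ^ 4 + 0)"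
    unfolding wall_cutoff_def by (intro tendsto_intros inv) (use assms in \<open>simp add: u_def\<close>)
  moreover have "(\<lambda>n. ball_cutoff (real (Suc n)) (sq_norm N x)) \<longlonglongrightarrow> (max 0 (1 - sq_norm N x * 0)) ^ 3"
  proof -
    have "(\<lambda>n. (max 0 (1 - sq_norm N x * (1 / real (Suc n)))) ^ 3) \<longlonglongrightarrow> (max 0 (1 - sq_norm N x * 0)) ^ 3"
      by (intro tendsto_intros inv)
    then show ?thesis by (simp add: ball_cutoff_def del: of_nat_Suc)
  qed
  ultimately show ?thesis
    using tendsto_mult assms by (fastforce simp: cutoff_def u_def)
qed

lemma integrable_cutoff:
  assumes "0 < \<delta>" "0 < R" "0 \<le> t"
  shows "integrable M (\<lambda>\<omega>. cutoff N \<delta> R (X t \<omega>))"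
  by (rule integrable_continuous[OF continuous_cutoff(1)[OF assms(1,2)] assms(3), where K = 1])
     (use cutoff_bounds[OF assms(1,2)] in simp)

lemma integrable_cutoff_generator:
  assumes "0 < \<delta>" "0 < R" "0 \<le> t"
  shows "integrable M (\<lambda>\<omega>. bessel_generator_A N k (cutoff N \<delta> R) (X t \<omega>))"
proof -
  note c = continuous_cutoff_generator[OF assms(1,2), of N k]
  have "continuous_on UNIV (\<lambda>q :: real \<times> (nat \<Rightarrow> real). bessel_generator_A N k (cutoff N \<delta> R) (snd q))"
    by (rule continuous_on_compose2[OF c continuous_on_snd[OF continuous_on_id]]) simp
  moreover have "bessel_generator_A N k (cutoff N \<delta> R) (snd (r, x)) = 0" if "R \<le> sq_norm N x" for r :: real and x
    using cutoff_outside(3)[OF assms(1,2) that] by simp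
  ultimately obtain K where K: "\<And>r x. \<bar>r - 0\<bar> \<le> 1 \<Longrightarrow> x \<in> config_space N \<Longrightarrow> \<bar>bessel_generator_A N k (cutoff N \<delta> R) (snd (r :: real, x))\<bar> \<le> K"
    by (rule bounded_of_ball_support[OF _ _ assms(2), where a = 0 and N = N]) (assumption, rule that)
  then show ?thesis
    using K[of 0] chamber_config by (intro integrable_continuous[OF c assms(3), where K = K]) auto
qed

lemma cutoff_derivative:
  assumes "0 < \<delta>" "0 < R"
  shows "((\<lambda>r. expectation (\<lambda>\<omega>. cutoff N \<delta> R (X (r\<^sup>2) \<omega>))) has_real_derivative
    2 * a * expectation (\<lambda>\<omega>. bessel_generator_A N k (cutoff N \<delta> R) (X (a\<^sup>2) \<omega>))) (at a)"
  using cutoff_test_derivative(1)[OF assms, where \<phi> = "\<lambda>_. 1" and \<phi>' = "\<lambda>_. 0" and \<phi>'' = "\<lambda>_. 0"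
      and p = "\<lambda>_. 1" and p' = "\<lambda>_. 0" and w = "\<lambda>_ _. 0" and w' = "\<lambda>_ _. 0" and a = a]
  by (simp add: Let_def)

text \<open>
  The subharmonicity of the cut-off in integrated form.
\<close>
lemma cutoff_expectation_almost_mono:
  assumes "0 < \<delta>" "0 < R" "5/2 \<le> k" "0 \<le> r" "r \<le> s"
  defines "e \<equiv> 3 / R * (real N + (k + 1) * real (N * (N - 1)))"
  shows "expectation (\<lambda>\<omega>. cutoff N \<delta> R (X (r\<^sup>2) \<omega>)) \<le> expectation (\<lambda>\<omega>. cutoff N \<delta> R (X (s\<^sup>2) \<omega>)) + e * (s\<^sup>2 - r\<^sup>2)"
proof -
  define g where "g r = expectation (\<lambda>\<omega>. cutoff N \<delta> R (X (r\<^sup>2) \<omega>)) + e * r\<^sup>2" for r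
  have "g r \<le> g s"
  proof (rule DERIV_nonneg_imp_nondecreasing[OF assms(5)])
    fix x assume x: "r \<le> x" "x \<le> s"
    have "(g has_real_derivative 2 * x * expectation (\<lambda>\<omega>. bessel_generator_A N k (cutoff N \<delta> R) (X (x\<^sup>2) \<omega>)) + e * (2 * x)) (at x)"
      unfolding g_def[abs_def] by (rule derivative_eq_intros cutoff_derivative[OF assms(1,2)] refl)+ simp
    moreover have "- e \<le> expectation (\<lambda>\<omega>. bessel_generator_A N k (cutoff N \<delta> R) (X (x\<^sup>2) \<omega>))"
      unfolding e_def using cutoff_generator_lower_bound[OF assms(1-3)]
      by (intro integral_ge_const integrable_cutoff_generator[OF assms(1,2)]) auto
    then have "0 \<le> 2 * x * (expectation (\<lambda>\<omega>. bessel_generator_A N k (cutoff N \<delta> R) (X (x\<^sup>2) \<omega>)) + e)"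
      using x assms(4) by (intro mult_nonneg_nonneg) auto
    ultimately show "\<exists>y. (g has_real_derivative y) (at x) \<and> 0 \<le> y"
      by (intro exI[of _ "2 * x * expectation (\<lambda>\<omega>. bessel_generator_A N k (cutoff N \<delta> R) (X (x\<^sup>2) \<omega>)) + e * (2 * x)"])
         (simp add: algebra_simps)
  qed
  then show ?thesis by (simp add: g_def algebra_simps)
qed

text \<open>
  The paths are off the walls for almost all times, so the expectation of the cut-off tends to
  \<open>1\<close> on average over \<open>[0, r\<^sup>2]\<close>. As it is almost increasing
  in time, its value at the right end point is at least the average, up to a vanishing error.
\<close>
lemma cutoff_expectation_tendsto_1:
  assumes "5/2 \<le> k" "0 < r"
  shows "(\<lambda>n. expectation (\<lambda>\<omega>. cutoff N (1 / real (Suc n)) (real (Suc n)) (X (r\<^sup>2) \<omega>))) \<longlonglongrightarrow> 1"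
proof -
  define q where "q = r\<^sup>2"
  have q: "0 < q" using assms(2) by (simp add: q_def)
  define \<nu> where "\<nu> = restrict_space lborel {0..q}"
  define H where "H n = cutoff N (1 / real (Suc n)) (real (Suc n))" for n
  define c where "c = 3 * (real N + (k + 1) * real (N * (N - 1)))"
  have c: "0 \<le> c" using assms(1) by (simp add: c_def)
  have H: "0 \<le> H n x" "H n x \<le> 1" for n x
    by (auto simp: H_def intro: cutoff_bounds)
  have cH: "continuous_on UNIV (H n)" for n
    unfolding H_def by (rule continuous_cutoff) auto
  have space_\<nu>: "space \<nu> = {0..q}"
    by (simp add: \<nu>_def space_restrict_space)
  have meas_\<nu>: "measure \<nu> (space \<nu>) = q"
    using q by (simp add: \<nu>_def space_restrict_space measure_restrict_space)
  interpret \<nu>: finite_measure \<nu>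
    by (rule finite_measureI) (use q in \<open>simp add: \<nu>_def space_restrict_space emeasure_restrict_space\<close>)
  interpret P: pair_sigma_finite \<nu> M ..
  interpret PF: finite_measure "\<nu> \<Otimes>\<^sub>M M"
    by (rule finite_measure_pair_measure) unfold_locales
  have joint: "(\<lambda>(s, \<omega>). H n (X s \<omega>)) \<in> borel_measurable (\<nu> \<Otimes>\<^sub>M M)" for n
    unfolding \<nu>_def by (rule measurable_joint[OF cH])
  have "integrable (\<nu> \<Otimes>\<^sub>M M) (\<lambda>(s, \<omega>). H n (X s \<omega>))" for n
    by (rule PF.integrable_const_bound[where B = 1, OF _ joint]) (use H in \<open>auto simp: case_prod_beta\<close>)
  from P.Fubini_integral[OF this]
  have fubini: "(\<integral>\<omega>. (\<integral>s. H n (X s \<omega>) \<partial>\<nu>) \<partial>M) = (\<integral>s. expectation (\<lambda>\<omega>. H n (X s \<omega>)) \<partial>\<nu>)" for n .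
  have swap: "(\<lambda>(\<omega>, s). H n (X s \<omega>)) \<in> borel_measurable (M \<Otimes>\<^sub>M \<nu>)" for n
    using measurable_pair_swap[OF joint[of n]] by simp
  have inner_meas: "(\<lambda>\<omega>. \<integral>s. H n (X s \<omega>) \<partial>\<nu>) \<in> borel_measurable M" for n
    by (rule \<nu>.borel_measurable_lebesgue_integral[OF swap])
  have slice: "(\<lambda>s. H n (X s \<omega>)) \<in> borel_measurable \<nu>" if "\<omega> \<in> space M" for n \<omega>
    using measurable_compose[OF measurable_Pair2'[OF that] joint[of n]] by simp
  have inner_int: "integrable \<nu> (\<lambda>s. H n (X s \<omega>))" if "\<omega> \<in> space M" for n \<omega>
    by (rule \<nu>.integrable_const_bound[where B = 1, OF _ slice[OF that]]) (use H in auto)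
  have nonstick: "AE \<omega> in M. AE s in \<nu>. vandermonde N (X s \<omega>) \<noteq> 0"
  proof -
    have "AE \<omega> in M. AE s in lborel. 0 \<le> s \<longrightarrow> inj_on (X s \<omega>) {1..N}"
      using process by (simp add: bessel_process_A_def)
    then show ?thesis
    proof eventually_elim
      case (elim \<omega>)
      then have "AE s in lborel. s \<in> {0..q} \<longrightarrow> vandermonde N (X s \<omega>) \<noteq> 0"
        by eventually_elim (simp add: vandermonde_nonzero_iff)
      then show ?case
        unfolding \<nu>_def by (subst AE_restrict_space_iff) auto
    qed
  qed
  have lim: "(\<lambda>n. expectation (\<lambda>\<omega>. \<integral>s. H n (X s \<omega>) \<partial>\<nu>)) \<longlonglongrightarrow> expectation (\<lambda>_. q)"
  proof (rule integral_dominated_convergence[where w = "\<lambda>_. q"])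
    show "AE \<omega> in M. (\<lambda>n. \<integral>s. H n (X s \<omega>) \<partial>\<nu>) \<longlonglongrightarrow> q"
      using nonstick
    proof (rule AE_mp, intro AE_I2 impI)
      fix \<omega> assume \<omega>: "\<omega> \<in> space M" and ns: "AE s in \<nu>. vandermonde N (X s \<omega>) \<noteq> 0"
      have "(\<lambda>n. \<integral>s. H n (X s \<omega>) \<partial>\<nu>) \<longlonglongrightarrow> (\<integral>s. 1 \<partial>\<nu>)"
      proof (rule integral_dominated_convergence[where w = "\<lambda>_. 1"])
        show "AE s in \<nu>. (\<lambda>n. H n (X s \<omega>)) \<longlonglongrightarrow> 1"
          using ns by eventually_elim (simp add: H_def cutoff_tendsto_1 del: of_nat_Suc)
      qed (use H slice[OF \<omega>] in auto)
      then show "(\<lambda>n. \<integral>s. H n (X s \<omega>) \<partial>\<nu>) \<longlonglongrightarrow> q" by (simp add: meas_\<nu>)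
    qed
    fix n
    show "AE \<omega> in M. norm (\<integral>s. H n (X s \<omega>) \<partial>\<nu>) \<le> q"
    proof (rule AE_I2)
      fix \<omega> assume \<omega>: "\<omega> \<in> space M"
      have "0 \<le> (\<integral>s. H n (X s \<omega>) \<partial>\<nu>)" using H by (intro integral_nonneg_AE) auto
      moreover have "(\<integral>s. H n (X s \<omega>) \<partial>\<nu>) \<le> (\<integral>s. 1 \<partial>\<nu>)"
        using H by (intro integral_mono inner_int[OF \<omega>]) auto
      ultimately show "norm (\<integral>s. H n (X s \<omega>) \<partial>\<nu>) \<le> q" by (simp add: meas_\<nu>)
    qed
  qed (use inner_meas in auto)
  have upper: "expectation (\<lambda>\<omega>. \<integral>s. H n (X s \<omega>) \<partial>\<nu>) \<le> q * (expectation (\<lambda>\<omega>. H n (X q \<omega>)) + c / real (Suc n) * q)" for n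
  proof -
    define B where "B = expectation (\<lambda>\<omega>. H n (X q \<omega>)) + c / real (Suc n) * q"
    have "expectation (\<lambda>\<omega>. H n (X s \<omega>)) \<le> B" if s: "s \<in> space \<nu>" for s
    proof -
      have s': "0 \<le> s" "s \<le> q" using s by (auto simp: space_\<nu>)
      have "expectation (\<lambda>\<omega>. H n (X ((sqrt s)\<^sup>2) \<omega>)) \<le> expectation (\<lambda>\<omega>. H n (X ((sqrt q)\<^sup>2) \<omega>))
          + 3 / real (Suc n) * (real N + (k + 1) * real (N * (N - 1))) * ((sqrt q)\<^sup>2 - (sqrt s)\<^sup>2)"
        unfolding H_def by (rule cutoff_expectation_almost_mono) (use assms(1) s' in auto)
      also have "\<dots> = expectation (\<lambda>\<omega>. H n (X q \<omega>)) + c / real (Suc n) * (q - s)"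
        using s' q by (simp add: c_def)
      also have "\<dots> \<le> B"
        unfolding B_def using c s' by (intro add_left_mono mult_left_mono) auto
      finally show ?thesis using s' by simp
    qed
    moreover have "integrable \<nu> (\<lambda>s. expectation (\<lambda>\<omega>. H n (X s \<omega>)))"
      using P.integrable_fst'[OF \<open>integrable (\<nu> \<Otimes>\<^sub>M M) (\<lambda>(s, \<omega>). H n (X s \<omega>))\<close>] by simp
    ultimately have "(\<integral>s. expectation (\<lambda>\<omega>. H n (X s \<omega>)) \<partial>\<nu>) \<le> (\<integral>s. B \<partial>\<nu>)"
      by (intro integral_mono) auto
    then show ?thesis unfolding fubini B_def by (simp add: meas_\<nu>)
  qed
  have "(\<lambda>n. expectation (\<lambda>\<omega>. H n (X q \<omega>))) \<longlonglongrightarrow> 1"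
  proof (rule tendsto_sandwich)
    show "\<forall>\<^sub>F n in sequentially. expectation (\<lambda>\<omega>. \<integral>s. H n (X s \<omega>) \<partial>\<nu>) / q - c * q * (1 / real (Suc n)) \<le> expectation (\<lambda>\<omega>. H n (X q \<omega>))"
      using upper q by (intro always_eventually allI) (simp add: field_simps del: of_nat_Suc)
    have "(\<lambda>n. expectation (\<lambda>\<omega>. \<integral>s. H n (X s \<omega>) \<partial>\<nu>) / q - c * q * (1 / real (Suc n))) \<longlonglongrightarrow> expectation (\<lambda>_. q) / q - c * q * 0"
      by (intro tendsto_intros lim LIMSEQ_Suc[OF lim_1_over_n]) (use q in auto)
    then show "(\<lambda>n. expectation (\<lambda>\<omega>. \<integral>s. H n (X s \<omega>) \<partial>\<nu>) / q - c * q * (1 / real (Suc n))) \<longlonglongrightarrow> 1"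
      using q by (simp add: prob_space)
    show "\<forall>\<^sub>F n in sequentially. expectation (\<lambda>\<omega>. H n (X q \<omega>)) \<le> 1"
      unfolding H_def using q
      by (intro always_eventually allI integral_le_const integrable_cutoff) (auto intro!: cutoff_bounds)
  qed simp
  then show ?thesis by (simp add: H_def q_def)
qed

end

section \<open>The drift in the coordinates of the equilibrium\<close>

lemma abs_linear_form_le:
  fixes a x :: "nat \<Rightarrow> real"
  assumes "0 < R" "sq_norm N x \<le> R" "(\<Sum>i=1..N. (a i)\<^sup>2) \<le> A"
  shows "\<bar>\<Sum>i=1..N. a i * x i\<bar> \<le> (A + 1) / 2 * sqrt R"
proof -
  define s where "s = sqrt R"
  have s: "0 < s" "s\<^sup>2 = R" using assms(1) by (simp_all add: s_def)
  have "\<bar>a i * x i\<bar> \<le> s / 2 * (a i)\<^sup>2 + (x i)\<^sup>2 / (2 * s)" for i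
  proof -
    have "0 \<le> (s * \<bar>a i\<bar> - \<bar>x i\<bar>)\<^sup>2" by simp
    then have "2 * s * (\<bar>a i\<bar> * \<bar>x i\<bar>) \<le> s\<^sup>2 * (a i)\<^sup>2 + (x i)\<^sup>2"
      by (simp add: power2_diff power_mult_distrib)
    then show ?thesis using s(1) by (simp add: abs_mult field_simps power2_eq_square)
  qed
  then have "\<bar>\<Sum>i=1..N. a i * x i\<bar> \<le> (\<Sum>i=1..N. s / 2 * (a i)\<^sup>2 + (x i)\<^sup>2 / (2 * s))"
    by (intro order_trans[OF sum_abs] sum_mono)
  also have "\<dots> = s / 2 * (\<Sum>i=1..N. (a i)\<^sup>2) + sq_norm N x / (2 * s)"
    by (simp add: sq_norm_def sum.distrib sum_distrib_left sum_divide_distrib)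
  also have "\<dots> \<le> s / 2 * A + s\<^sup>2 / (2 * s)"
    using assms s by (intro add_mono mult_left_mono divide_right_mono) auto
  also have "\<dots> = (A + 1) / 2 * s" using s(1) by (simp add: field_simps power2_eq_square)
  finally show ?thesis by (simp add: s_def)
qed

lemma chamber_decreasing:
  assumes "x \<in> weyl_chamber_A N" "i \<in> {1..N}" "j \<in> {1..N}" "i \<le> j"
  shows "x j \<le> x i"
  using assms by (auto simp: weyl_chamber_A_def)

context equilibrium begin

lemma gap_product_nonneg:
  assumes "x \<in> weyl_chamber_A N" "i \<in> {1..N}" "j \<in> {1..N}"
  shows "0 \<le> (z i - z j) * (x i - x j)"
proof (cases i j rule: linorder_cases)
  case less
  then show ?thesis using decreasing[of i j] chamber_decreasing[of x N i j] assms by (intro mult_nonneg_nonneg) auto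
next
  case greater
  then show ?thesis using decreasing[of j i] chamber_decreasing[of x N j i] assms by (intro mult_nonpos_nonpos) auto
qed simp

lemma inv_gap_sum_equilibrium: "i \<in> {1..N} \<Longrightarrow> inv_gap_sum N z i = z i"
  unfolding inv_gap_sum_def by (rule balance)

lemma sum_position_form: "(\<Sum>i=1..N. a i * z i) = 1/2 * (\<Sum>i=1..N. \<Sum>j=1..N. (a i - a j) / (z i - z j))"
proof -
  have "(\<Sum>i=1..N. a i * z i) = (\<Sum>i=1..N. a i * inv_gap_sum N z i)"
    by (intro sum.cong refl) (simp add: inv_gap_sum_equilibrium)
  then show ?thesis by (simp only: sum_inv_gap_mult)
qed

lemma sum_z_squared: "(\<Sum>i=1..N. (z i)\<^sup>2) = real (N * (N - 1)) / 2"
proof -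
  have "inj_on z {1..N}" using gap_eq_0_iff by (intro inj_onI) auto
  then have "(\<Sum>i=1..N. z i * inv_gap_sum N z i) = real (N * (N - 1)) / 2"
    by (intro sum_inv_gap_position) (simp add: vandermonde_nonzero_iff)
  moreover have "(\<Sum>i=1..N. z i * inv_gap_sum N z i) = (\<Sum>i=1..N. (z i)\<^sup>2)"
    by (intro sum.cong refl) (simp add: inv_gap_sum_equilibrium power2_eq_square)
  ultimately show ?thesis by simp
qed

lemma position_form_nonneg: "x \<in> weyl_chamber_A N \<Longrightarrow> 0 \<le> (\<Sum>i=1..N. z i * x i)"
proof -
  assume x: "x \<in> weyl_chamber_A N"
  have "0 \<le> (x i - x j) / (z i - z j)" if "i \<in> {1..N}" "j \<in> {1..N}" for i j
    using gap_product_nonneg[OF x that] by (auto simp: zero_le_divide_iff zero_le_mult_iff)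
  then have "0 \<le> (\<Sum>i=1..N. x i * z i)"
    unfolding sum_position_form by (intro mult_nonneg_nonneg sum_nonneg) auto
  then show ?thesis by (simp add: mult.commute)
qed

lemma inv_gap_form_le:
  assumes x: "x \<in> weyl_chamber_A N"
    and w: "\<And>i j. i \<in> {1..N} \<Longrightarrow> j \<in> {1..N} \<Longrightarrow> \<bar>w i - w j\<bar> \<le> c * \<bar>z i - z j\<bar>"
  shows "\<bar>\<Sum>i=1..N. w i * inv_gap_sum N x i\<bar> \<le> c * (\<Sum>i=1..N. z i * inv_gap_sum N x i)"
proof -
  have t: "\<bar>(w i - w j) / (x i - x j)\<bar> \<le> c * ((z i - z j) / (x i - x j))" if ij: "i \<in> {1..N}" "j \<in> {1..N}" for i j
  proof -
    have "\<bar>(w i - w j) / (x i - x j)\<bar> \<le> c * \<bar>z i - z j\<bar> / \<bar>x i - x j\<bar>"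
      unfolding abs_divide using w[OF ij] by (intro divide_right_mono) auto
    moreover have "0 \<le> (z i - z j) / (x i - x j)"
      using gap_product_nonneg[OF x ij] by (simp add: zero_le_divide_iff zero_le_mult_iff)
    then have "\<bar>z i - z j\<bar> / \<bar>x i - x j\<bar> = (z i - z j) / (x i - x j)"
      by (simp flip: abs_divide)
    ultimately show ?thesis by (metis times_divide_eq_right)
  qed
  have "\<bar>\<Sum>i=1..N. w i * inv_gap_sum N x i\<bar> = 1/2 * \<bar>\<Sum>i=1..N. \<Sum>j=1..N. (w i - w j) / (x i - x j)\<bar>"
    unfolding sum_inv_gap_mult by simp
  also have "\<dots> \<le> 1/2 * (\<Sum>i=1..N. \<Sum>j=1..N. c * ((z i - z j) / (x i - x j)))"
    by (intro mult_left_mono order_trans[OF sum_abs] sum_mono) (use t in \<open>auto\<close>)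
  also have "\<dots> = c * (\<Sum>i=1..N. z i * inv_gap_sum N x i)"
    unfolding sum_inv_gap_mult by (simp add: sum_distrib_left)
  finally show ?thesis .
qed

text \<open>
  Up to the factor \<open>1 / (r * (z i - z j))\<close> this is the remainder in the expansion
  of \<open>2 * r * k / (x i - x j)\<close> around the gap \<open>sqrt (2 * k) * r * (z i - z
  j)\<close>; see \<open>drift_identity\<close>.
\<close>
definition excess :: "real \<Rightarrow> real \<Rightarrow> (nat \<Rightarrow> real) \<Rightarrow> nat \<Rightarrow> nat \<Rightarrow> real" where
  "excess k r x i j = ((x i - x j) - sqrt (2 * k) * r * (z i - z j))\<^sup>2 / ((z i - z j) * (x i - x j))"

lemma excess_nonneg: "x \<in> weyl_chamber_A N \<Longrightarrow> i \<in> {1..N} \<Longrightarrow> j \<in> {1..N} \<Longrightarrow> 0 \<le> excess k r x i j"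
  unfolding excess_def using gap_product_nonneg by (intro divide_nonneg_nonneg) auto

text \<open>
  An exact identity rather than an expansion. Gap by gap it reads \<open>2 * r * k / x = 2 * s
  / c - x / (r * c\<^sup>2) + e / (r * c)\<close> with \<open>c\<close> the gap of
  \<open>z\<close>, \<open>s = sqrt (2 * k)\<close> and \<open>e\<close> the excess; the
  second term is cancelled by the transport equation.
\<close>
lemma drift_identity:
  assumes inj: "inj_on x {1..N}" and r: "0 < r" and k: "0 \<le> k"
    and w': "\<And>i. i \<in> {1..N} \<Longrightarrow> r * w' i = stiffness w i"
  shows "(\<Sum>i=1..N. w' i * x i) + 2 * r * k * (\<Sum>i=1..N. w i * inv_gap_sum N x i)
    = 2 * sqrt (2 * k) * (\<Sum>i=1..N. w i * z i)
      + 1/2 * (\<Sum>i=1..N. \<Sum>j=1..N. (w i - w j) / (z i - z j) / r * excess k r x i j)"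
proof -
  define s where "s = sqrt (2 * k)"
  have s: "s\<^sup>2 = 2 * k" using k by (simp add: s_def)
  have pair: "(x i - x j) * (w i - w j) / (z i - z j)\<^sup>2 / r + 2 * r * k * ((w i - w j) / (x i - x j))
      = 2 * s * ((w i - w j) / (z i - z j)) + (w i - w j) / (z i - z j) / r * excess k r x i j"
    if "i \<in> {1..N}" "j \<in> {1..N}" for i j
  proof (cases "i = j")
    case False
    then have nz: "z i - z j \<noteq> 0" "x i - x j \<noteq> 0"
      using gap_eq_0_iff[OF that] inj_onD[OF inj] that by auto
    have "a * b / c\<^sup>2 / r + 2 * r * k * (b / a) = 2 * s * (b / c) + b / c / r * ((a - s * r * c)\<^sup>2 / (c * a))"
      if "c \<noteq> 0" "a \<noteq> 0" for a b c :: real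
    proof -
      have "(a - s * r * c)\<^sup>2 = a\<^sup>2 - 2 * s * r * c * a + 2 * k * r\<^sup>2 * c\<^sup>2"
        unfolding power2_diff power_mult_distrib s by (simp add: mult_ac)
      then show ?thesis using that r by (simp add: field_simps power2_eq_square)
    qed
    from this[OF nz, of "w i - w j"] show ?thesis by (simp add: excess_def s_def)
  qed (simp add: excess_def)
  have "(\<Sum>i=1..N. w' i * x i) = (\<Sum>i=1..N. x i * stiffness w i) / r"
  proof -
    have "w' i * x i = x i * stiffness w i / r" if "i \<in> {1..N}" for i
      using w'[OF that, symmetric] r by simp
    then show ?thesis by (simp add: sum_divide_distrib)
  qed
  also have "\<dots> = 1/2 * (\<Sum>i=1..N. \<Sum>j=1..N. (x i - x j) * (w i - w j) / (z i - z j)\<^sup>2 / r)"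
    unfolding stiffness_dirichlet by (simp add: sum_divide_distrib mult_ac)
  finally have 1: "(\<Sum>i=1..N. w' i * x i) = 1/2 * (\<Sum>i=1..N. \<Sum>j=1..N. (x i - x j) * (w i - w j) / (z i - z j)\<^sup>2 / r)" .
  have 2: "(\<Sum>i=1..N. \<Sum>j=1..N. (x i - x j) * (w i - w j) / (z i - z j)\<^sup>2 / r + 2 * r * k * ((w i - w j) / (x i - x j)))
      = (\<Sum>i=1..N. \<Sum>j=1..N. (x i - x j) * (w i - w j) / (z i - z j)\<^sup>2 / r)
        + 2 * r * k * (\<Sum>i=1..N. \<Sum>j=1..N. (w i - w j) / (x i - x j))"
    by (simp only: sum.distrib sum_distrib_left)
  have "(\<Sum>i=1..N. w' i * x i) + 2 * r * k * (\<Sum>i=1..N. w i * inv_gap_sum N x i)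
      = 1/2 * (\<Sum>i=1..N. \<Sum>j=1..N. (x i - x j) * (w i - w j) / (z i - z j)\<^sup>2 / r + 2 * r * k * ((w i - w j) / (x i - x j)))"
    unfolding 1 2 sum_inv_gap_mult by simp
  also have "\<dots> = 1/2 * (\<Sum>i=1..N. \<Sum>j=1..N. 2 * s * ((w i - w j) / (z i - z j)) + (w i - w j) / (z i - z j) / r * excess k r x i j)"
    using pair by (intro arg_cong[where f = "\<lambda>y. 1/2 * y"] sum.cong refl) auto
  also have "(\<Sum>i=1..N. \<Sum>j=1..N. 2 * s * ((w i - w j) / (z i - z j)) + (w i - w j) / (z i - z j) / r * excess k r x i j)
      = 2 * s * (\<Sum>i=1..N. \<Sum>j=1..N. (w i - w j) / (z i - z j))
        + (\<Sum>i=1..N. \<Sum>j=1..N. (w i - w j) / (z i - z j) / r * excess k r x i j)"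
    by (simp only: sum.distrib sum_distrib_left)
  also have "1/2 * (2 * s * (\<Sum>i=1..N. \<Sum>j=1..N. (w i - w j) / (z i - z j))
        + (\<Sum>i=1..N. \<Sum>j=1..N. (w i - w j) / (z i - z j) / r * excess k r x i j))
      = 2 * s * (1/2 * (\<Sum>i=1..N. \<Sum>j=1..N. (w i - w j) / (z i - z j)))
      + 1/2 * (\<Sum>i=1..N. \<Sum>j=1..N. (w i - w j) / (z i - z j) / r * excess k r x i j)"
    by simp
  finally show ?thesis unfolding sum_position_form s_def .
qed

text \<open>
  The nonnegative quantity that bounds the error of every transported linear form: the excess,
  and the contribution of the gradient of the wall profile.
\<close>
definition control :: "real \<Rightarrow> real \<Rightarrow> real \<Rightarrow> real \<Rightarrow> (nat \<Rightarrow> real) \<Rightarrow> real" where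
  "control k \<delta> R r x = cutoff N \<delta> R x * (1/2 * (\<Sum>i=1..N. \<Sum>j=1..N. excess k r x i j))
     + 2 * r\<^sup>2 * (wall_cutoff' \<delta> (vandermonde N x) * vandermonde N x * ball_cutoff R (sq_norm N x)
        * (\<Sum>i=1..N. z i * inv_gap_sum N x i))"

lemma cutoff_form_interior:
  assumes "vandermonde N x \<noteq> 0" "0 < r" "0 \<le> k"
    and "\<And>i. i \<in> {1..N} \<Longrightarrow> r * w' i = stiffness w i"
  shows "(\<Sum>i=1..N. w' i * x i) * cutoff N \<delta> R x + 2 * r * (k * (\<Sum>i=1..N. w i * (inv_gap_sum N x i * cutoff N \<delta> R x)))
    = cutoff N \<delta> R x * (2 * sqrt (2 * k) * (\<Sum>i=1..N. w i * z i)
      + 1/2 * (\<Sum>i=1..N. \<Sum>j=1..N. (w i - w j) / (z i - z j) / r * excess k r x i j))"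
proof -
  have e: "(\<Sum>i=1..N. w i * (inv_gap_sum N x i * cutoff N \<delta> R x)) = cutoff N \<delta> R x * (\<Sum>i=1..N. w i * inv_gap_sum N x i)"
    unfolding sum_distrib_left by (intro sum.cong refl) simp
  have inj: "inj_on x {1..N}" using assms(1) vandermonde_nonzero_iff by blast
  have "(\<Sum>i=1..N. w' i * x i) * cutoff N \<delta> R x + 2 * r * (k * (\<Sum>i=1..N. w i * (inv_gap_sum N x i * cutoff N \<delta> R x)))
    = cutoff N \<delta> R x * ((\<Sum>i=1..N. w' i * x i) + 2 * r * k * (\<Sum>i=1..N. w i * inv_gap_sum N x i))"
    unfolding e by (simp add: algebra_simps)
  then show ?thesis
    by (simp only: drift_identity[OF inj assms(2,3,4)])
qed

lemma ball_gradient_bound: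
  assumes "0 < \<delta>" "0 < R" "sq_norm N x \<le> R" "(\<Sum>i=1..N. (a i)\<^sup>2) \<le> A"
  shows "\<bar>2 * wall_cutoff \<delta> u * ball_cutoff' R (sq_norm N x) * (\<Sum>i=1..N. a i * x i)\<bar> \<le> 3 * (A + 1) / sqrt R"
proof -
  have "\<bar>2 * wall_cutoff \<delta> u * ball_cutoff' R (sq_norm N x)\<bar> \<le> 2 * 1 * (3 / R)"
    unfolding abs_mult using wall_cutoff_bounds(1,2)[OF assms(1), of u]
      ball_cutoff_bounds(3,4)[OF assms(2) sq_norm_nonneg[of N x]]
    by (intro mult_mono) auto
  then have "\<bar>2 * wall_cutoff \<delta> u * ball_cutoff' R (sq_norm N x)\<bar> * \<bar>\<Sum>i=1..N. a i * x i\<bar>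
      \<le> (2 * 1 * (3 / R)) * ((A + 1) / 2 * sqrt R)"
    using abs_linear_form_le[OF assms(2-4)] assms(2) by (intro mult_mono) auto
  also have "\<dots> = 3 * (A + 1) * (sqrt R / R)" by simp
  also have "sqrt R / R = 1 / sqrt R"
    using assms(2) by (simp add: field_simps)
  finally show ?thesis by (simp add: abs_mult)
qed

text \<open>
  For the curve \<open>r * z\<close> itself each difference quotient in
  \<open>drift_identity\<close> is \<open>r\<close>, so the excess enters with a positive
  sign. Nothing but the radial cut-off costs anything.
\<close>
lemma position_drift_lower_bound:
  assumes x: "x \<in> weyl_chamber_A N" and pos: "0 < \<delta>" "0 < R" "0 < r" and k: "5/2 \<le> k"
  defines "inertia \<equiv> \<Sum>i=1..N. (z i)\<^sup>2" and "e \<equiv> 3 * (real N + (k + 1) * real (N * (N - 1)))"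
  shows "2 * sqrt (2 * k) * r * inertia * cutoff N \<delta> R x + control k \<delta> R r x - r\<^sup>2 * (inertia + 1) * (e + 6) / sqrt R
    \<le> (\<Sum>i=1..N. z i * x i) * cutoff N \<delta> R x
      + 2 * r * ((\<Sum>i=1..N. (r * z i) * x i) * bessel_generator_A N k (cutoff N \<delta> R) x
        + k * (\<Sum>i=1..N. (r * z i) * (inv_gap_sum N x i * cutoff N \<delta> R x))
        + (\<Sum>i=1..N. (r * z i) * cutoff_grad N \<delta> R i x))"
proof -
  have inertia: "0 \<le> inertia" and e: "0 \<le> e" using k by (auto simp: inertia_def e_def sum_nonneg)
  have err: "0 \<le> r\<^sup>2 * (inertia + 1) * (e + 6) / sqrt R" using inertia e pos by simp
  consider "vandermonde N x = 0" | "R \<le> sq_norm N x" | "vandermonde N x \<noteq> 0" "sq_norm N x < R" by linarith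
  then show ?thesis
  proof cases
    case 1
    then show ?thesis
      using err by (simp add: control_def cutoff_def cutoff_grad_wall cutoff_generator_wall[OF pos(1,2)])
  next
    case 2
    then show ?thesis
      using err cutoff_outside[OF pos(1,2) 2] ball_cutoff_outside[OF pos(2) 2] by (simp add: control_def)
  next
    case 3
    define L where "L = bessel_generator_A N k (cutoff N \<delta> R) x"
    define S where "S = (\<Sum>i=1..N. z i * x i)"
    have rS: "(\<Sum>i=1..N. (r * z i) * x i) = r * S" by (simp add: S_def sum_distrib_left mult.assoc)
    have S: "0 \<le> S" "S \<le> (inertia + 1) / 2 * sqrt R"
      using position_form_nonneg[OF x] abs_linear_form_le[OF pos(2), of N x z inertia] 3(2) by (auto simp: S_def inertia_def)
    have sR: "sqrt R / R = 1 / sqrt R"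
      using pos(2) by (simp add: field_simps)
    have t1: "- (r\<^sup>2 * (inertia + 1) * e / sqrt R) \<le> 2 * r * (r * S * L)"
    proof -
      have "- (e / R) \<le> L"
        using cutoff_generator_lower_bound[OF pos(1,2) k, of N x] by (simp add: e_def L_def)
      then have "(2 * r\<^sup>2 * S) * (- (e / R)) \<le> (2 * r\<^sup>2 * S) * L"
        using S by (intro mult_left_mono) auto
      moreover have "(2 * r\<^sup>2 * (e / R)) * S \<le> (2 * r\<^sup>2 * (e / R)) * ((inertia + 1) / 2 * sqrt R)"
        using S(2) e pos by (intro mult_left_mono) auto
      moreover have "(2 * r\<^sup>2 * (e / R)) * ((inertia + 1) / 2 * sqrt R) = r\<^sup>2 * (inertia + 1) * e * (sqrt R / R)"
        by simp
      ultimately show ?thesis unfolding sR by (simp add: power2_eq_square mult_ac)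
    qed
    have main: "S * cutoff N \<delta> R x + 2 * r * (k * (\<Sum>i=1..N. (r * z i) * (inv_gap_sum N x i * cutoff N \<delta> R x)))
       = cutoff N \<delta> R x * (2 * sqrt (2 * k) * r * inertia + 1/2 * (\<Sum>i=1..N. \<Sum>j=1..N. excess k r x i j))"
    proof -
      have "r * z i = stiffness (\<lambda>i. r * z i) i" if "i \<in> {1..N}" for i
        using stiffness_inverse_gap_diff(1)[of "\<lambda>_. 0" "- r" z i] stiffness_position[OF that] by (simp add: stiffness_def)
      from cutoff_form_interior[OF 3(1) pos(3) _ this, where k = k and \<delta> = \<delta> and R = R] k
      have "S * cutoff N \<delta> R x + 2 * r * (k * (\<Sum>i=1..N. (r * z i) * (inv_gap_sum N x i * cutoff N \<delta> R x)))
       = cutoff N \<delta> R x * (2 * sqrt (2 * k) * (\<Sum>i=1..N. r * z i * z i)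
          + 1/2 * (\<Sum>i=1..N. \<Sum>j=1..N. (r * z i - r * z j) / (z i - z j) / r * excess k r x i j))"
        by (simp add: S_def)
      moreover have "(\<Sum>i=1..N. r * z i * z i) = r * inertia"
        by (simp add: inertia_def sum_distrib_left power2_eq_square mult.assoc)
      moreover have "(r * z i - r * z j) / (z i - z j) / r * excess k r x i j = excess k r x i j" for i j
        using pos(3) by (cases "z i = z j") (simp_all add: excess_def flip: right_diff_distrib)
      ultimately show ?thesis by (simp add: mult.assoc)
    qed
    have grad: "(\<Sum>i=1..N. (r * z i) * cutoff_grad N \<delta> R i x)
      = r * (wall_cutoff' \<delta> (vandermonde N x) * vandermonde N x * ball_cutoff R (sq_norm N x)
         * (\<Sum>i=1..N. z i * inv_gap_sum N x i))
      + r * (2 * wall_cutoff \<delta> (vandermonde N x) * ball_cutoff' R (sq_norm N x) * S)"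
    proof -
      have "(\<Sum>i=1..N. (r * z i) * cutoff_grad N \<delta> R i x) = r * (\<Sum>i=1..N. z i * cutoff_grad N \<delta> R i x)"
        by (simp add: sum_distrib_left mult.assoc)
      then show ?thesis unfolding cutoff_grad_interior[OF 3(1)] S_def by (simp only: distrib_left)
    qed
    have t2: "- (r\<^sup>2 * (inertia + 1) * 6 / sqrt R) \<le> 2 * r * (r * (2 * wall_cutoff \<delta> (vandermonde N x) * ball_cutoff' R (sq_norm N x) * S))"
    proof -
      have "- (3 * (inertia + 1) / sqrt R) \<le> 2 * wall_cutoff \<delta> (vandermonde N x) * ball_cutoff' R (sq_norm N x) * S"
        using ball_gradient_bound[OF pos(1,2), of x z inertia "vandermonde N x"] 3(2) by (simp add: S_def inertia_def abs_le_iff)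
      then have "(2 * r\<^sup>2) * - (3 * (inertia + 1) / sqrt R)
          \<le> (2 * r\<^sup>2) * (2 * wall_cutoff \<delta> (vandermonde N x) * ball_cutoff' R (sq_norm N x) * S)"
        by (intro mult_left_mono) auto
      then show ?thesis by (simp add: power2_eq_square mult_ac)
    qed
    have "r\<^sup>2 * (inertia + 1) * (e + 6) / sqrt R = r\<^sup>2 * (inertia + 1) * e / sqrt R + r\<^sup>2 * (inertia + 1) * 6 / sqrt R"
      by (simp add: add_divide_distrib distrib_left)
    then show ?thesis
      unfolding L_def[symmetric] S_def[symmetric] rS grad control_def
      using t1 t2 main by (simp add: algebra_simps power2_eq_square)
  qed
qed

text \<open>
  A direction whose gaps are at most \<open>C\<close> times those of \<open>r * z\<close>
  meets at most \<open>C\<close> times the error terms that \<open>r * z\<close> collects.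
\<close>
lemma transported_drift_bound:
  assumes x: "x \<in> weyl_chamber_A N" and pos: "0 < \<delta>" "0 < R" "0 < r" "0 \<le> k" and C: "0 \<le> C"
    and w': "\<And>i. i \<in> {1..N} \<Longrightarrow> r * w' i = stiffness w i"
    and orth: "(\<Sum>i=1..N. w i * z i) = 0"
    and gap: "\<And>i j. i \<in> {1..N} \<Longrightarrow> j \<in> {1..N} \<Longrightarrow> \<bar>w i - w j\<bar> \<le> C * r * \<bar>z i - z j\<bar>"
    and A: "(\<Sum>i=1..N. (w i)\<^sup>2) \<le> A"
  shows "\<bar>(\<Sum>i=1..N. w' i * x i) * cutoff N \<delta> R x
      + 2 * r * (k * (\<Sum>i=1..N. w i * (inv_gap_sum N x i * cutoff N \<delta> R x)) + (\<Sum>i=1..N. w i * cutoff_grad N \<delta> R i x))\<bar>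
    \<le> C * control k \<delta> R r x + 6 * r * (A + 1) / sqrt R"
proof -
  have "0 \<le> A" using A by (meson order_trans sum_nonneg zero_le_power2)
  then have err: "0 \<le> 6 * r * (A + 1) / sqrt R" using pos by simp
  consider "vandermonde N x = 0" | "R \<le> sq_norm N x" | "vandermonde N x \<noteq> 0" "sq_norm N x < R" by linarith
  then show ?thesis
  proof cases
    case 1
    then show ?thesis
      using err by (simp add: control_def cutoff_def cutoff_grad_wall)
  next
    case 2
    then show ?thesis
      using err cutoff_outside[OF pos(1,2) 2] ball_cutoff_outside[OF pos(2) 2] by (simp add: control_def)
  next
    case 3
    define H where "H = cutoff N \<delta> R x"
    define W where "W = wall_cutoff' \<delta> (vandermonde N x) * vandermonde N x * ball_cutoff R (sq_norm N x)"
    define B where "B = (\<Sum>i=1..N. z i * inv_gap_sum N x i)"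
    define Q where "Q = 2 * wall_cutoff \<delta> (vandermonde N x) * ball_cutoff' R (sq_norm N x) * (\<Sum>i=1..N. w i * x i)"
    have H: "0 \<le> H" unfolding H_def by (rule cutoff_bounds[OF pos(1,2)])
    have W: "0 \<le> W"
      unfolding W_def
      by (rule mult_nonneg_nonneg[OF wall_cutoff_bounds(3)[OF pos(1)] ball_cutoff_bounds(1)[OF pos(2) sq_norm_nonneg]])
    have t: "\<bar>(w i - w j) / (z i - z j) / r * excess k r x i j\<bar> \<le> C * excess k r x i j"
      if ij: "i \<in> {1..N}" "j \<in> {1..N}" for i j
    proof (cases "i = j")
      case False
      then have "0 < \<bar>z i - z j\<bar>" using gap_eq_0_iff[OF ij] by simp
      then have "\<bar>(w i - w j) / (z i - z j) / r\<bar> \<le> C"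
        using gap[OF ij] pos(3) by (simp add: abs_divide abs_mult divide_le_eq mult_ac)
      then show ?thesis
        using mult_right_mono[OF _ excess_nonneg[OF x ij, of k r], of "\<bar>(w i - w j) / (z i - z j) / r\<bar>" C]
          excess_nonneg[OF x ij, of k r]
        by (simp only: abs_mult[of "(w i - w j) / (z i - z j) / r"] abs_of_nonneg)
    qed (simp add: excess_def)
    have main: "(\<Sum>i=1..N. w' i * x i) * H + 2 * r * (k * (\<Sum>i=1..N. w i * (inv_gap_sum N x i * H)))
        = H * (1/2 * (\<Sum>i=1..N. \<Sum>j=1..N. (w i - w j) / (z i - z j) / r * excess k r x i j))"
      using cutoff_form_interior[OF 3(1) pos(3,4) w', of \<delta> R] orth by (simp add: H_def)
    have b1: "\<bar>H * (1/2 * (\<Sum>i=1..N. \<Sum>j=1..N. (w i - w j) / (z i - z j) / r * excess k r x i j))\<bar>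
        \<le> C * (H * (1/2 * (\<Sum>i=1..N. \<Sum>j=1..N. excess k r x i j)))"
    proof -
      have "\<bar>\<Sum>i=1..N. \<Sum>j=1..N. (w i - w j) / (z i - z j) / r * excess k r x i j\<bar>
          \<le> (\<Sum>i=1..N. \<Sum>j=1..N. C * excess k r x i j)"
        by (intro order_trans[OF sum_abs] sum_mono t)
      then have le: "H * (1/2 * \<bar>\<Sum>i=1..N. \<Sum>j=1..N. (w i - w j) / (z i - z j) / r * excess k r x i j\<bar>)
          \<le> H * (1/2 * (\<Sum>i=1..N. \<Sum>j=1..N. C * excess k r x i j))"
        using H by (intro mult_left_mono) auto
      have "\<bar>H * (1/2 * S)\<bar> = H * (1/2 * \<bar>S\<bar>)" for S
        using H by (simp add: abs_mult)
      then show ?thesis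
        using le by (simp only: sum_distrib_left[symmetric]) (simp add: mult_ac)
    qed
    have grad: "(\<Sum>i=1..N. w i * cutoff_grad N \<delta> R i x) = W * (\<Sum>i=1..N. w i * inv_gap_sum N x i) + Q"
      unfolding cutoff_grad_interior[OF 3(1)] W_def Q_def ..
    have b2: "\<bar>2 * r * (W * (\<Sum>i=1..N. w i * inv_gap_sum N x i))\<bar> \<le> C * (2 * r\<^sup>2 * (W * B))"
    proof -
      have "(2 * r * W) * \<bar>\<Sum>i=1..N. w i * inv_gap_sum N x i\<bar> \<le> (2 * r * W) * (C * r * B)"
        unfolding B_def using W pos(3) by (intro mult_left_mono inv_gap_form_le[OF x gap]) auto
      then show ?thesis using W pos(3) by (simp add: abs_mult power2_eq_square mult_ac)
    qed
    have b3: "\<bar>2 * r * Q\<bar> \<le> 6 * r * (A + 1) / sqrt R"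
    proof -
      have "\<bar>Q\<bar> \<le> 3 * (A + 1) / sqrt R"
        unfolding Q_def by (rule ball_gradient_bound[OF pos(1,2) _ A]) (use 3(2) in simp)
      then have "(2 * r) * \<bar>Q\<bar> \<le> (2 * r) * (3 * (A + 1) / sqrt R)"
        using pos(3) by (intro mult_left_mono) auto
      then show ?thesis using pos(3) by (simp add: abs_mult algebra_simps)
    qed
    have "(\<Sum>i=1..N. w' i * x i) * H + 2 * r * (k * (\<Sum>i=1..N. w i * (inv_gap_sum N x i * H)) + (\<Sum>i=1..N. w i * cutoff_grad N \<delta> R i x))
      = H * (1/2 * (\<Sum>i=1..N. \<Sum>j=1..N. (w i - w j) / (z i - z j) / r * excess k r x i j))
        + 2 * r * (W * (\<Sum>i=1..N. w i * inv_gap_sum N x i)) + 2 * r * Q"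
      unfolding main[symmetric] grad by (simp add: distrib_left)
    moreover have "C * control k \<delta> R r x = C * (H * (1/2 * (\<Sum>i=1..N. \<Sum>j=1..N. excess k r x i j))) + C * (2 * r\<^sup>2 * (W * B))"
      unfolding control_def H_def W_def B_def by (rule distrib_left)
    ultimately show ?thesis
      unfolding H_def[symmetric] using b1 b2 b3 by linarith
  qed
qed

end

section \<open>The transported wave\<close>

lemma increment_bound:
  fixes f g :: "real \<Rightarrow> real"
  assumes "a \<le> b"
    and f: "\<And>x. a \<le> x \<Longrightarrow> x \<le> b \<Longrightarrow> (f has_real_derivative f' x) (at x)"
    and g: "\<And>x. a \<le> x \<Longrightarrow> x \<le> b \<Longrightarrow> (g has_real_derivative g' x) (at x)"
    and le: "\<And>x. a \<le> x \<Longrightarrow> x \<le> b \<Longrightarrow> \<bar>f' x\<bar> \<le> g' x"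
  shows "\<bar>f b - f a\<bar> \<le> g b - g a"
proof -
  have "g a - f a \<le> g b - f b"
  proof (rule DERIV_nonneg_imp_nondecreasing[OF assms(1)])
    fix x assume "a \<le> x" "x \<le> b"
    then show "\<exists>y. ((\<lambda>x. g x - f x) has_real_derivative y) (at x) \<and> 0 \<le> y"
      using DERIV_diff[OF g f] le[of x] by (intro exI[of _ "g' x - f' x"]) auto
  qed
  moreover have "g a + f a \<le> g b + f b"
  proof (rule DERIV_nonneg_imp_nondecreasing[OF assms(1)])
    fix x assume "a \<le> x" "x \<le> b"
    then show "\<exists>y. ((\<lambda>x. g x + f x) has_real_derivative y) (at x) \<and> 0 \<le> y"
      using DERIV_add[OF g f] le[of x] by (intro exI[of _ "g' x + f' x"]) auto
  qed
  ultimately show ?thesis by linarith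
qed

text \<open>
  A solution of the transport equation that is orthogonal to \<open>z\<close>, with bounds for
  it on \<open>{0..T}\<close>. The frequency \<open>\<theta>\<close> and the phase
  \<open>\<alpha>\<close> are those of the wave.
\<close>
locale bessel_transport = bessel_zero M N k X + equilibrium N z
  for M :: "'w measure" and N k X z +
  fixes w w' :: "real \<Rightarrow> nat \<Rightarrow> real" and v :: "real \<Rightarrow> real" and T C A P \<theta> \<alpha> :: real
  assumes k_large: "5/2 \<le> k" and T_pos: "0 < T" and C_nonneg: "0 \<le> C"
    and w_deriv: "\<And>r i. ((\<lambda>r. w r i) has_real_derivative w' r i) (at r)"
    and w'_cont: "\<And>i. continuous_on UNIV (\<lambda>r. w' r i)"
    and w_eq: "\<And>r i. i \<in> {1..N} \<Longrightarrow> r * w' r i = stiffness (w r) i"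
    and w_orth: "\<And>r. (\<Sum>i=1..N. w r i * z i) = 0"
    and w_gap: "\<And>r i j. \<lbrakk>0 \<le> r; r \<le> T; i \<in> {1..N}; j \<in> {1..N}\<rbrakk> \<Longrightarrow> \<bar>w r i - w r j\<bar> \<le> C * r * \<bar>z i - z j\<bar>"
    and w_bound: "\<And>r. \<lbrakk>0 \<le> r; r \<le> T\<rbrakk> \<Longrightarrow> (\<Sum>i=1..N. (w r i)\<^sup>2) \<le> A"
    and v_deriv: "\<And>r. (v has_real_derivative 2 * r * (\<Sum>i=1..N. (w r i)\<^sup>2)) (at r)"
    and v_0: "v 0 = 0"
    and weight_le_P: "\<And>r. \<lbrakk>0 \<le> r; r \<le> T\<rbrakk> \<Longrightarrow> exp (\<theta>\<^sup>2 * v r / 2) \<le> P"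
begin

definition weight :: "real \<Rightarrow> real" where
  "weight r = exp (\<theta>\<^sup>2 * v r / 2)"

text \<open>
  The weight compensates the Gaussian decay, so that for the linearised process the
  expectation of the wave would be constant. The phase covers real and imaginary part of the
  characteristic function at once.
\<close>
definition wave :: "real \<Rightarrow> (nat \<Rightarrow> real) \<Rightarrow> real" where
  "wave r x = weight r * cos (\<theta> * (\<Sum>i=1..N. w r i * x i) + \<alpha>)"

lemma weight_bounds: "0 < weight r" "0 \<le> r \<Longrightarrow> r \<le> T \<Longrightarrow> weight r \<le> P"
  by (simp_all add: weight_def weight_le_P)

lemma weight_bound_pos: "0 < P"
  using weight_bounds[of 0] T_pos by linarith

lemma wave_bound: "0 \<le> r \<Longrightarrow> r \<le> T \<Longrightarrow> \<bar>wave r x\<bar> \<le> P"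
proof -
  assume "0 \<le> r" "r \<le> T"
  then have "weight r * \<bar>cos (\<theta> * (\<Sum>i=1..N. w r i * x i) + \<alpha>)\<bar> \<le> P * 1"
    using weight_bounds[of r] by (intro mult_mono) auto
  then show ?thesis using weight_bounds(1)[of r] by (simp add: wave_def abs_mult)
qed

lemma weight_deriv:
  "(weight has_real_derivative \<theta>\<^sup>2 * r * (\<Sum>i=1..N. (w r i)\<^sup>2) * weight r) (at r)"
proof -
  have "((\<lambda>r. \<theta>\<^sup>2 * v r / 2) has_real_derivative \<theta>\<^sup>2 * (2 * r * (\<Sum>i=1..N. (w r i)\<^sup>2)) / 2) (at r)"
    by (intro DERIV_cdivide DERIV_cmult v_deriv)
  from DERIV_chain2[OF DERIV_exp this]
  show ?thesis by (simp add: weight_def[abs_def] mult_ac)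
qed

lemma w_cont: "continuous_on UNIV (\<lambda>r. w r i)"
  using w_deriv by (intro DERIV_continuous_on) auto

lemma weight_cont: "continuous_on UNIV weight"
  using weight_deriv by (intro DERIV_continuous_on) auto

definition mass_mean :: "real \<Rightarrow> real \<Rightarrow> real \<Rightarrow> real" where
  "mass_mean \<delta> R r = expectation (\<lambda>\<omega>. cutoff N \<delta> R (X (r\<^sup>2) \<omega>))"

definition position_mean :: "real \<Rightarrow> real \<Rightarrow> real \<Rightarrow> real" where
  "position_mean \<delta> R r = expectation (\<lambda>\<omega>. (\<Sum>i=1..N. (r * z i) * X (r\<^sup>2) \<omega> i) * cutoff N \<delta> R (X (r\<^sup>2) \<omega>))"

definition wave_mean :: "real \<Rightarrow> real \<Rightarrow> real \<Rightarrow> real" where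
  "wave_mean \<delta> R r = expectation (\<lambda>\<omega>. wave r (X (r\<^sup>2) \<omega>) * cutoff N \<delta> R (X (r\<^sup>2) \<omega>))"

definition position_drift :: "real \<Rightarrow> real \<Rightarrow> real \<Rightarrow> (nat \<Rightarrow> real) \<Rightarrow> real" where
  "position_drift \<delta> R r x = (\<Sum>i=1..N. z i * x i) * cutoff N \<delta> R x
      + 2 * r * ((\<Sum>i=1..N. (r * z i) * x i) * bessel_generator_A N k (cutoff N \<delta> R) x
        + k * (\<Sum>i=1..N. (r * z i) * (inv_gap_sum N x i * cutoff N \<delta> R x))
        + (\<Sum>i=1..N. (r * z i) * cutoff_grad N \<delta> R i x))"

definition wave_drift :: "real \<Rightarrow> real \<Rightarrow> real \<Rightarrow> (nat \<Rightarrow> real) \<Rightarrow> real" where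
  "wave_drift \<delta> R r x = - (weight r * \<theta> * sin (\<theta> * (\<Sum>i=1..N. w r i * x i) + \<alpha>)) *
      ((\<Sum>i=1..N. w' r i * x i) * cutoff N \<delta> R x
      + 2 * r * (k * (\<Sum>i=1..N. w r i * (inv_gap_sum N x i * cutoff N \<delta> R x)) + (\<Sum>i=1..N. w r i * cutoff_grad N \<delta> R i x)))
    + 2 * r * (wave r x * bessel_generator_A N k (cutoff N \<delta> R) x)"

lemma position_mean_deriv:
  assumes "0 < \<delta>" "0 < R"
  shows "(position_mean \<delta> R has_real_derivative expectation (\<lambda>\<omega>. position_drift \<delta> R a (X (a\<^sup>2) \<omega>))) (at a)"
    and "integrable M (\<lambda>\<omega>. position_drift \<delta> R a (X (a\<^sup>2) \<omega>))"
proof -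
  have d: "\<And>r i. ((\<lambda>r. r * z i) has_real_derivative z i) (at r)"
    by (auto intro!: derivative_eq_intros)
  have c: "\<And>y. ((\<lambda>y. 1 :: real) has_real_derivative 0) (at y)" "\<And>y. ((\<lambda>y. y) has_real_derivative 1) (at (y :: real))"
    "continuous_on UNIV (\<lambda>y :: real. 0 :: real)" "\<And>i. continuous_on UNIV (\<lambda>y :: real. z i)"
    by (auto intro: DERIV_ident)
  note test = cutoff_test_derivative[OF assms c(2,1,3) c(1,3) d c(4), where a = a]
  show "(position_mean \<delta> R has_real_derivative expectation (\<lambda>\<omega>. position_drift \<delta> R a (X (a\<^sup>2) \<omega>))) (at a)"
    using test(1) by (simp add: position_mean_def[abs_def] position_drift_def)
  show "integrable M (\<lambda>\<omega>. position_drift \<delta> R a (X (a\<^sup>2) \<omega>))"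
    using test(2) by (simp add: position_drift_def)
qed

lemma wave_mean_deriv:
  assumes "0 < \<delta>" "0 < R"
  shows "(wave_mean \<delta> R has_real_derivative expectation (\<lambda>\<omega>. wave_drift \<delta> R a (X (a\<^sup>2) \<omega>))) (at a)"
    and "integrable M (\<lambda>\<omega>. wave_drift \<delta> R a (X (a\<^sup>2) \<omega>))"
proof -
  define p' where "p' r = \<theta>\<^sup>2 * r * (\<Sum>i=1..N. (w r i)\<^sup>2) * weight r" for r
  have p': "continuous_on UNIV p'"
    unfolding p'_def[abs_def] by (intro continuous_intros w_cont weight_cont)
  define \<phi> where "\<phi> y = cos (\<theta> * y + \<alpha>)" for y
  define \<phi>' where "\<phi>' y = - (\<theta> * sin (\<theta> * y + \<alpha>))" for y
  define \<phi>'' where "\<phi>'' y = - (\<theta>\<^sup>2 * cos (\<theta> * y + \<alpha>))" for y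
  have \<phi>: "(\<phi> has_real_derivative \<phi>' y) (at y)" "(\<phi>' has_real_derivative \<phi>'' y) (at y)" "continuous_on UNIV \<phi>''" for y
    unfolding \<phi>_def[abs_def] \<phi>'_def[abs_def] \<phi>''_def[abs_def]
    by (auto intro!: derivative_eq_intros continuous_intros simp: power2_eq_square)
  define I where "I x = (let y = (\<Sum>i=1..N. w a i * x i) in
      (p' a * \<phi> y + weight a * (\<phi>' y * (\<Sum>i=1..N. w' a i * x i))) * cutoff N \<delta> R x
      + 2 * a * (weight a * \<phi> y * bessel_generator_A N k (cutoff N \<delta> R) x
        + (weight a * \<phi>'' y / 2 * (\<Sum>i=1..N. (w a i)\<^sup>2) * cutoff N \<delta> R x
            + k * (weight a * \<phi>' y) * (\<Sum>i=1..N. w a i * (inv_gap_sum N x i * cutoff N \<delta> R x)))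
        + weight a * \<phi>' y * (\<Sum>i=1..N. w a i * cutoff_grad N \<delta> R i x)))" for x
  note test = cutoff_test_derivative[OF assms \<phi> weight_deriv[folded p'_def] p' w_deriv w'_cont, where a = a]
  have collect: "(\<theta>\<^sup>2 * a * S2 * p * c + p * (- (\<theta> * s) * S1)) * H
      + 2 * a * (p * c * L + (p * - (\<theta>\<^sup>2 * c) / 2 * S2 * H + k * (p * - (\<theta> * s)) * S3) + p * - (\<theta> * s) * S4)
    = - (p * \<theta> * s) * (S1 * H + 2 * a * (k * S3 + S4)) + 2 * a * (p * c * L)" for S1 S2 S3 S4 p c s H L :: real
    by (simp add: algebra_simps)
  have I: "I x = wave_drift \<delta> R a x" for x
    unfolding I_def wave_drift_def wave_def Let_def p'_def \<phi>_def \<phi>'_def \<phi>''_def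
    by (rule collect)
  show "(wave_mean \<delta> R has_real_derivative expectation (\<lambda>\<omega>. wave_drift \<delta> R a (X (a\<^sup>2) \<omega>))) (at a)"
    using test(1) unfolding I[symmetric] I_def wave_mean_def[abs_def] wave_def Let_def \<phi>_def .
  show "integrable M (\<lambda>\<omega>. wave_drift \<delta> R a (X (a\<^sup>2) \<omega>))"
    using test(2) unfolding I[symmetric] I_def Let_def .
qed

definition loss :: real where
  "loss = 3 * (real N + (k + 1) * real (N * (N - 1)))"

lemma loss_nonneg: "0 \<le> loss"
  using k_large by (simp add: loss_def)

definition inertia :: real where
  "inertia = (\<Sum>i=1..N. (z i)\<^sup>2)"

lemma inertia_eq: "2 * inertia = real (N * (N - 1))"
  by (simp only: inertia_def sum_z_squared)

lemma inertia_nonneg: "0 \<le> inertia"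
  by (simp add: inertia_def sum_nonneg)

definition error1 :: "real \<Rightarrow> real" where
  "error1 R = T\<^sup>2 * (inertia + 1) * (loss + 6) / sqrt R"

definition error2 :: "real \<Rightarrow> real" where
  "error2 R = P * \<bar>\<theta>\<bar> * (6 * T * (A + 1) / sqrt R) + 4 * T * P * (loss / R)"

text \<open>
  The second derivative of the cosine cancels against the weight. What remains is bounded by
  the drifts of the position and of the cut-off, of which one knows the total increments; this
  comparison replaces any estimate of the excess alone.
\<close>
lemma wave_drift_bound:
  assumes x: "x \<in> weyl_chamber_A N" and pos: "0 < \<delta>" "0 < R" "0 < r" and r: "r \<le> T"
  shows "\<bar>wave_drift \<delta> R r x\<bar>
    \<le> P * \<bar>\<theta>\<bar> * C * (position_drift \<delta> R r x - 2 * sqrt (2 * k) * r * inertia * cutoff N \<delta> R x + error1 R)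
      + P * (2 * r * bessel_generator_A N k (cutoff N \<delta> R) x) + error2 R"
proof -
  define L where "L = bessel_generator_A N k (cutoff N \<delta> R) x"
  define D where "D = (\<Sum>i=1..N. w' r i * x i) * cutoff N \<delta> R x
      + 2 * r * (k * (\<Sum>i=1..N. w r i * (inv_gap_sum N x i * cutoff N \<delta> R x)) + (\<Sum>i=1..N. w r i * cutoff_grad N \<delta> R i x))"
  define s where "s = - (weight r * \<theta> * sin (\<theta> * (\<Sum>i=1..N. w r i * x i) + \<alpha>))"
  have "0 \<le> (\<Sum>i=1..N. (w r i)\<^sup>2)" by (simp add: sum_nonneg)
  then have A: "0 \<le> A" using w_bound[of r] pos r by linarith
  have sR: "0 < sqrt R" using pos by simp
  have 1: "control k \<delta> R r x \<le> position_drift \<delta> R r x - 2 * sqrt (2 * k) * r * inertia * cutoff N \<delta> R x + error1 R"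
  proof -
    have "r\<^sup>2 * (inertia + 1) * (loss + 6) / sqrt R \<le> error1 R"
      unfolding error1_def using inertia_nonneg loss_nonneg r pos
      by (intro divide_right_mono mult_right_mono power_mono) auto
    then show ?thesis
      using position_drift_lower_bound[OF x pos k_large] unfolding position_drift_def inertia_def loss_def by linarith
  qed
  have 2: "\<bar>D\<bar> \<le> C * control k \<delta> R r x + 6 * T * (A + 1) / sqrt R"
  proof -
    have "\<bar>D\<bar> \<le> C * control k \<delta> R r x + 6 * r * (A + 1) / sqrt R"
      unfolding D_def
      by (rule transported_drift_bound[OF x pos _ C_nonneg w_eq w_orth w_gap w_bound]) (use k_large pos r in auto)
    moreover have "6 * r * (A + 1) / sqrt R \<le> 6 * T * (A + 1) / sqrt R"
      using r A sR by (intro divide_right_mono mult_right_mono) auto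
    ultimately show ?thesis by linarith
  qed
  have s: "\<bar>s\<bar> \<le> P * \<bar>\<theta>\<bar>"
  proof -
    have "\<bar>s\<bar> = (weight r * \<bar>\<theta>\<bar>) * \<bar>sin (\<theta> * (\<Sum>i=1..N. w r i * x i) + \<alpha>)\<bar>"
      using weight_bounds(1)[of r] by (simp add: s_def abs_mult)
    also have "\<dots> \<le> (P * \<bar>\<theta>\<bar>) * 1"
      using weight_bounds[of r] pos r weight_bound_pos by (intro mult_mono mult_right_mono) auto
    finally show ?thesis by simp
  qed
  have L: "- (loss / R) \<le> L"
    using cutoff_generator_lower_bound[OF pos(1,2) k_large, of N x] by (simp add: loss_def L_def)
  then have absL: "\<bar>L\<bar> \<le> L + 2 * (loss / R)"
    using loss_nonneg pos divide_nonneg_pos[of loss R] by (simp add: abs_le_iff)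
  have 3: "\<bar>2 * r * (wave r x * L)\<bar> \<le> P * (2 * r * L) + 4 * T * P * (loss / R)"
  proof -
    have "\<bar>2 * r * (wave r x * L)\<bar> = (2 * r) * (\<bar>wave r x\<bar> * \<bar>L\<bar>)"
      using pos by (simp add: abs_mult)
    also have "\<dots> \<le> (2 * r) * (P * (L + 2 * (loss / R)))"
      using wave_bound[of r x] absL weight_bound_pos pos r by (intro mult_left_mono mult_mono) auto
    also have "\<dots> = P * (2 * r * L) + 4 * P * (loss / R) * r"
      by (simp add: algebra_simps)
    also have "\<dots> \<le> P * (2 * r * L) + 4 * P * (loss / R) * T"
      using r weight_bound_pos loss_nonneg pos by (intro add_left_mono mult_left_mono) auto
    finally show ?thesis by (simp add: mult_ac)
  qed
  have "\<bar>s * D\<bar> \<le> (P * \<bar>\<theta>\<bar>) * (C * control k \<delta> R r x + 6 * T * (A + 1) / sqrt R)"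
    unfolding abs_mult using s 2 weight_bound_pos by (intro mult_mono) auto
  also have "\<dots> \<le> (P * \<bar>\<theta>\<bar>) * (C * (position_drift \<delta> R r x - 2 * sqrt (2 * k) * r * inertia * cutoff N \<delta> R x + error1 R)
      + 6 * T * (A + 1) / sqrt R)"
    using 1 weight_bound_pos C_nonneg by (intro mult_left_mono add_right_mono) auto
  finally have 4: "\<bar>s * D\<bar> \<le> (P * \<bar>\<theta>\<bar>) * (C * (position_drift \<delta> R r x - 2 * sqrt (2 * k) * r * inertia * cutoff N \<delta> R x + error1 R)
      + 6 * T * (A + 1) / sqrt R)" .
  have "wave_drift \<delta> R r x = s * D + 2 * r * (wave r x * L)"
    by (simp add: wave_drift_def s_def D_def L_def)
  then have "\<bar>wave_drift \<delta> R r x\<bar> \<le> \<bar>s * D\<bar> + \<bar>2 * r * (wave r x * L)\<bar>"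
    by simp
  then show ?thesis
    using 3 4 unfolding error2_def L_def[symmetric] by (simp add: distrib_left mult.assoc)
qed

text \<open>
  Young's inequality with the weight \<open>sqrt (2 * k) * r\<close>, for which equality holds
  on the deterministic curve, combined with the second moment bound.
\<close>
lemma position_mean_end:
  assumes "0 < \<delta>" "0 < R" "0 < r"
  shows "0 \<le> position_mean \<delta> R r"
    and "position_mean \<delta> R r \<le> r\<^sup>2 * (real N / (2 * sqrt (2 * k)) + sqrt (2 * k) * inertia)"
proof -
  define s where "s = sqrt (2 * k)"
  have s: "0 < s" "s\<^sup>2 = 2 * k" using k_large by (simp_all add: s_def)
  define H where "H = cutoff N \<delta> R"
  have H: "0 \<le> H x" "H x \<le> 1" for x unfolding H_def by (intro cutoff_bounds assms)+
  have cH: "continuous_on UNIV H" unfolding H_def by (rule continuous_cutoff[OF assms(1,2)])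
  have form: "(\<Sum>i=1..N. (r * z i) * x i) = r * (\<Sum>i=1..N. z i * x i)" for x
    by (simp add: sum_distrib_left mult.assoc)
  show "0 \<le> position_mean \<delta> R r"
    unfolding position_mean_def form H_def[symmetric] using H assms(3) position_form_nonneg[OF in_chamber]
    by (intro integral_nonneg_AE AE_I2 mult_nonneg_nonneg) auto
  have le: "(\<Sum>i=1..N. (r * z i) * x i) * H x \<le> sq_norm N x * H x / (2 * s) + r\<^sup>2 * s * inertia / 2 * H x" for x
  proof -
    have "(r * z i) * x i \<le> (x i)\<^sup>2 / (2 * s) + r\<^sup>2 * s / 2 * (z i)\<^sup>2" for i
    proof -
      have "0 \<le> (x i - s * r * z i)\<^sup>2" by simp
      then have "2 * s * ((r * z i) * x i) \<le> (x i)\<^sup>2 + s\<^sup>2 * r\<^sup>2 * (z i)\<^sup>2"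
        by (simp add: power2_diff power_mult_distrib mult_ac)
      then show ?thesis using s(1) by (simp add: field_simps power2_eq_square)
    qed
    then have "(\<Sum>i=1..N. (r * z i) * x i) \<le> (\<Sum>i=1..N. (x i)\<^sup>2 / (2 * s) + r\<^sup>2 * s / 2 * (z i)\<^sup>2)"
      by (intro sum_mono)
    also have "\<dots> = sq_norm N x / (2 * s) + r\<^sup>2 * s * inertia / 2"
      by (simp add: sq_norm_def inertia_def sum.distrib sum_distrib_left sum_divide_distrib)
    finally have "(\<Sum>i=1..N. (r * z i) * x i) * H x \<le> (sq_norm N x / (2 * s) + r\<^sup>2 * s * inertia / 2) * H x"
      using H by (intro mult_right_mono) auto
    then show ?thesis by (simp add: algebra_simps)
  qed
  have int1: "integrable M (\<lambda>\<omega>. sq_norm N (X (r\<^sup>2) \<omega>) * H (X (r\<^sup>2) \<omega>))"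
  proof (rule integrable_continuous[where K = R])
    show "continuous_on UNIV (\<lambda>x. sq_norm N x * H x)"
      by (intro continuous_on_mult continuous_sq_norm cH)
    show "\<bar>sq_norm N x * H x\<bar> \<le> R" for x
    proof (cases "R \<le> sq_norm N x")
      case True
      then show ?thesis using cutoff_outside(1)[OF assms(1,2) True] assms(2) by (simp add: H_def)
    next
      case False
      then show ?thesis using H[of x] sq_norm_nonneg[of N x] mult_mono[of "sq_norm N x" R "H x" 1] by (simp add: abs_mult)
    qed
  qed simp
  have int2: "integrable M (\<lambda>\<omega>. H (X (r\<^sup>2) \<omega>))"
    unfolding H_def by (rule integrable_cutoff[OF assms(1,2)]) simp
  have int3: "integrable M (\<lambda>\<omega>. (\<Sum>i=1..N. (r * z i) * X (r\<^sup>2) \<omega> i) * H (X (r\<^sup>2) \<omega>))"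
  proof (rule integrable_continuous[where f = "\<lambda>x. (\<Sum>i=1..N. (r * z i) * x i) * H x" and K = "((\<Sum>i=1..N. (r * z i)\<^sup>2) + 1) / 2 * sqrt R"])
    show "continuous_on UNIV (\<lambda>x. (\<Sum>i=1..N. (r * z i) * x i) * H x)"
      by (intro continuous_on_mult continuous_on_linear_form cH)
    have B: "0 \<le> ((\<Sum>i=1..N. (r * z i)\<^sup>2) + 1) / 2 * sqrt R"
      using assms(2) by (intro mult_nonneg_nonneg divide_nonneg_nonneg add_nonneg_nonneg sum_nonneg) auto
    show "\<bar>(\<Sum>i=1..N. (r * z i) * x i) * H x\<bar> \<le> ((\<Sum>i=1..N. (r * z i)\<^sup>2) + 1) / 2 * sqrt R" for x
    proof (cases "R \<le> sq_norm N x")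
      case True
      then show ?thesis using cutoff_outside(1)[OF assms(1,2) True] B by (simp add: H_def)
    next
      case False
      have "\<bar>\<Sum>i=1..N. (r * z i) * x i\<bar> * \<bar>H x\<bar> \<le> (((\<Sum>i=1..N. (r * z i)\<^sup>2) + 1) / 2 * sqrt R) * 1"
        using abs_linear_form_le[OF assms(2), of N x "\<lambda>i. r * z i" "\<Sum>i=1..N. (r * z i)\<^sup>2"] False H[of x] B
        by (intro mult_mono) auto
      then show ?thesis by (simp add: abs_mult)
    qed
  qed simp
  have "position_mean \<delta> R r \<le> expectation (\<lambda>\<omega>. sq_norm N (X (r\<^sup>2) \<omega>) * H (X (r\<^sup>2) \<omega>) / (2 * s) + r\<^sup>2 * s * inertia / 2 * H (X (r\<^sup>2) \<omega>))"
    unfolding position_mean_def H_def[symmetric]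
    using int1 int2 le by (intro integral_mono[OF int3]) auto
  also have "\<dots> = expectation (\<lambda>\<omega>. sq_norm N (X (r\<^sup>2) \<omega>) * H (X (r\<^sup>2) \<omega>)) / (2 * s)
      + r\<^sup>2 * s * inertia / 2 * expectation (\<lambda>\<omega>. H (X (r\<^sup>2) \<omega>))"
    using int1 int2 by simp
  also have "\<dots> \<le> r\<^sup>2 * (real N + k * (2 * inertia)) / (2 * s) + r\<^sup>2 * s * inertia / 2 * 1"
  proof (intro add_mono divide_right_mono mult_left_mono)
    show "expectation (\<lambda>\<omega>. sq_norm N (X (r\<^sup>2) \<omega>) * H (X (r\<^sup>2) \<omega>)) \<le> r\<^sup>2 * (real N + k * (2 * inertia))"
      unfolding H_def inertia_eq by (rule second_moment[OF assms(1,2)]) (use k_large in auto)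
    show "expectation (\<lambda>\<omega>. H (X (r\<^sup>2) \<omega>)) \<le> 1"
      using int2 H by (intro integral_le_const) auto
  qed (use s inertia_nonneg in auto)
  also have "\<dots> = r\<^sup>2 * (real N / (2 * s) + s * inertia)"
  proof -
    have "k * (2 * inertia) = s * (s * inertia)" using s(2) by (simp add: power2_eq_square)
    then show ?thesis using s(1) by (simp add: field_simps power2_eq_square)
  qed
  finally show "position_mean \<delta> R r \<le> r\<^sup>2 * (real N / (2 * sqrt (2 * k)) + sqrt (2 * k) * inertia)"
    by (simp add: s_def)
qed

end

context bessel_transport begin

lemma wave_increment:
  assumes "0 < \<delta>" "0 < R" "0 < r0" "r0 \<le> T"
    and mass: "\<And>r. r0 \<le> r \<Longrightarrow> r \<le> T \<Longrightarrow> 1 - q \<le> mass_mean \<delta> R r"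
  shows "\<bar>wave_mean \<delta> R T - wave_mean \<delta> R r0\<bar>
    \<le> P * \<bar>\<theta>\<bar> * C * (position_mean \<delta> R T - position_mean \<delta> R r0
          - sqrt (2 * k) * inertia * (1 - q) * (T\<^sup>2 - r0\<^sup>2) + error1 R * (T - r0))
      + P * (mass_mean \<delta> R T - mass_mean \<delta> R r0) + error2 R * (T - r0)"
proof -
  define Q where "Q = P * \<bar>\<theta>\<bar> * C"
  define s where "s = sqrt (2 * k)"
  have Q: "0 \<le> Q" using weight_bound_pos C_nonneg by (simp add: Q_def)
  have s: "0 \<le> s" using k_large by (simp add: s_def)
  define pd where "pd r = expectation (\<lambda>\<omega>. position_drift \<delta> R r (X (r\<^sup>2) \<omega>))" for r
  define gd where "gd r = expectation (\<lambda>\<omega>. bessel_generator_A N k (cutoff N \<delta> R) (X (r\<^sup>2) \<omega>))" for r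
  define g where "g r = Q * (position_mean \<delta> R r - s * inertia * (1 - q) * r\<^sup>2 + error1 R * r) + P * mass_mean \<delta> R r + error2 R * r" for r
  define g' where "g' r = Q * (pd r - s * inertia * (1 - q) * (2 * r) + error1 R) + P * (2 * r * gd r) + error2 R" for r
  have "\<bar>wave_mean \<delta> R T - wave_mean \<delta> R r0\<bar> \<le> g T - g r0"
  proof (rule increment_bound[OF assms(4) wave_mean_deriv(1)[OF assms(1,2)]])
    fix r assume r: "r0 \<le> r" "r \<le> T"
    have dm: "(mass_mean \<delta> R has_real_derivative 2 * r * gd r) (at r)"
      unfolding mass_mean_def[abs_def] gd_def by (rule cutoff_derivative[OF assms(1,2)])
    have dp: "(position_mean \<delta> R has_real_derivative pd r) (at r)"
      unfolding pd_def by (rule position_mean_deriv(1)[OF assms(1,2)])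
    show "(g has_real_derivative g' r) (at r)"
      unfolding g_def[abs_def] g'_def
      by (rule derivative_eq_intros dm dp refl)+ simp
    have r': "0 < r" using r assms(3) by linarith
    note int_p = position_mean_deriv(2)[OF assms(1,2), of r] and int_w = wave_mean_deriv(2)[OF assms(1,2), of r]
    have int_g: "integrable M (\<lambda>\<omega>. bessel_generator_A N k (cutoff N \<delta> R) (X (r\<^sup>2) \<omega>))"
      by (rule integrable_cutoff_generator[OF assms(1,2)]) simp
    have int_c: "integrable M (\<lambda>\<omega>. cutoff N \<delta> R (X (r\<^sup>2) \<omega>))"
      by (rule integrable_cutoff[OF assms(1,2)]) simp
    have "\<bar>expectation (\<lambda>\<omega>. wave_drift \<delta> R r (X (r\<^sup>2) \<omega>))\<bar> \<le> expectation (\<lambda>\<omega>. \<bar>wave_drift \<delta> R r (X (r\<^sup>2) \<omega>)\<bar>)"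
      by (rule integral_abs_bound)
    also have "\<dots> \<le> expectation (\<lambda>\<omega>. Q * (position_drift \<delta> R r (X (r\<^sup>2) \<omega>)
        - 2 * s * r * inertia * cutoff N \<delta> R (X (r\<^sup>2) \<omega>) + error1 R)
        + P * (2 * r * bessel_generator_A N k (cutoff N \<delta> R) (X (r\<^sup>2) \<omega>)) + error2 R)"
    proof (rule integral_mono[OF integrable_abs[OF int_w]])
      show "integrable M (\<lambda>\<omega>. Q * (position_drift \<delta> R r (X (r\<^sup>2) \<omega>)
        - 2 * s * r * inertia * cutoff N \<delta> R (X (r\<^sup>2) \<omega>) + error1 R)
        + P * (2 * r * bessel_generator_A N k (cutoff N \<delta> R) (X (r\<^sup>2) \<omega>)) + error2 R)"
        by (intro Bochner_Integration.integrable_add Bochner_Integration.integrable_diff integrable_mult_right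
            int_p int_g int_c integrable_const)
      show "\<bar>wave_drift \<delta> R r (X (r\<^sup>2) \<omega>)\<bar> \<le> Q * (position_drift \<delta> R r (X (r\<^sup>2) \<omega>)
        - 2 * s * r * inertia * cutoff N \<delta> R (X (r\<^sup>2) \<omega>) + error1 R)
        + P * (2 * r * bessel_generator_A N k (cutoff N \<delta> R) (X (r\<^sup>2) \<omega>)) + error2 R"
        if "\<omega> \<in> space M" for \<omega>
        unfolding Q_def s_def by (rule wave_drift_bound[OF in_chamber[OF that] assms(1,2) r' r(2)]) simp
    qed
    also have "\<dots> = Q * (pd r - 2 * s * r * inertia * mass_mean \<delta> R r + error1 R) + P * (2 * r * gd r) + error2 R"
      using int_p int_g int_c by (simp add: pd_def gd_def mass_mean_def prob_space)
    also have "\<dots> \<le> g' r"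
    proof -
      have "(2 * s * r * inertia) * (1 - q) \<le> (2 * s * r * inertia) * mass_mean \<delta> R r"
        using s r' inertia_nonneg by (intro mult_left_mono mass r) auto
      then show ?thesis
        unfolding g'_def using Q by (intro add_right_mono mult_left_mono) (auto simp: mult_ac)
    qed
    finally show "\<bar>expectation (\<lambda>\<omega>. wave_drift \<delta> R r (X (r\<^sup>2) \<omega>))\<bar> \<le> g' r" .
  qed
  then show ?thesis
    unfolding g_def Q_def s_def by (simp add: algebra_simps)
qed

lemma continuous_wave: "continuous_on UNIV (wave r)"
  unfolding wave_def[abs_def] by (intro continuous_intros)

lemma integrable_wave: "0 \<le> r \<Longrightarrow> r \<le> T \<Longrightarrow> integrable M (\<lambda>\<omega>. wave r (X (r\<^sup>2) \<omega>))"
  by (rule integrable_continuous[OF continuous_wave, where K = P]) (simp_all add: wave_bound)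

lemma wave_mean_close:
  assumes "0 < \<delta>" "0 < R" "0 \<le> r" "r \<le> T"
  shows "\<bar>wave_mean \<delta> R r - expectation (\<lambda>\<omega>. wave r (X (r\<^sup>2) \<omega>))\<bar> \<le> P * (1 - mass_mean \<delta> R r)"
proof -
  have int_c: "integrable M (\<lambda>\<omega>. cutoff N \<delta> R (X (r\<^sup>2) \<omega>))"
    by (rule integrable_cutoff[OF assms(1,2)]) simp
  have bound: "\<bar>wave r x * (cutoff N \<delta> R x - 1)\<bar> \<le> P * (1 - cutoff N \<delta> R x)" for x
  proof -
    have "\<bar>cutoff N \<delta> R x - 1\<bar> = 1 - cutoff N \<delta> R x"
      using cutoff_bounds(2)[OF assms(1,2), of N x] by simp
    then show ?thesis
      unfolding abs_mult by (simp only:) (rule mult_right_mono[OF wave_bound[OF assms(3,4)]],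
        use cutoff_bounds(2)[OF assms(1,2), of N x] in linarith)
  qed
  have int_wc: "integrable M (\<lambda>\<omega>. wave r (X (r\<^sup>2) \<omega>) * (cutoff N \<delta> R (X (r\<^sup>2) \<omega>) - 1))"
  proof (rule integrable_continuous[where f = "\<lambda>x. wave r x * (cutoff N \<delta> R x - 1)" and K = P])
    show "continuous_on UNIV (\<lambda>x. wave r x * (cutoff N \<delta> R x - 1))"
      by (rule continuous_on_mult[OF continuous_wave
            continuous_on_diff[OF continuous_cutoff(1)[OF assms(1,2)] continuous_on_const]])
    show "\<bar>wave r x * (cutoff N \<delta> R x - 1)\<bar> \<le> P" for x
    proof -
      have "P * (1 - cutoff N \<delta> R x) \<le> P * 1"
        using cutoff_bounds[OF assms(1,2), of N x] weight_bound_pos by (intro mult_left_mono) auto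
      then show ?thesis using order_trans[OF bound[of x], of P] by (simp only: mult_1_right)
    qed
  qed simp
  have "wave_mean \<delta> R r
      = expectation (\<lambda>\<omega>. wave r (X (r\<^sup>2) \<omega>) * (cutoff N \<delta> R (X (r\<^sup>2) \<omega>) - 1) + wave r (X (r\<^sup>2) \<omega>))"
    unfolding wave_mean_def by (rule arg_cong[where f = expectation]) (intro ext, simp only: right_diff_distrib mult_1_right diff_add_cancel)
  also have "\<dots> = expectation (\<lambda>\<omega>. wave r (X (r\<^sup>2) \<omega>) * (cutoff N \<delta> R (X (r\<^sup>2) \<omega>) - 1))
      + expectation (\<lambda>\<omega>. wave r (X (r\<^sup>2) \<omega>))"
    by (rule Bochner_Integration.integral_add[OF int_wc integrable_wave[OF assms(3,4)]])
  finally have "\<bar>wave_mean \<delta> R r - expectation (\<lambda>\<omega>. wave r (X (r\<^sup>2) \<omega>))\<bar>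
      = \<bar>expectation (\<lambda>\<omega>. wave r (X (r\<^sup>2) \<omega>) * (cutoff N \<delta> R (X (r\<^sup>2) \<omega>) - 1))\<bar>"
    by (simp only: add_diff_cancel_right')
  also have "\<dots> \<le> expectation (\<lambda>\<omega>. \<bar>wave r (X (r\<^sup>2) \<omega>) * (cutoff N \<delta> R (X (r\<^sup>2) \<omega>) - 1)\<bar>)"
    by (rule integral_abs_bound)
  also have "\<dots> \<le> expectation (\<lambda>\<omega>. P * (1 - cutoff N \<delta> R (X (r\<^sup>2) \<omega>)))"
    by (rule integral_mono[OF integrable_abs[OF int_wc]]) (auto intro: int_c bound)
  also have "\<dots> = P * (1 - mass_mean \<delta> R r)"
    using int_c by (simp add: mass_mean_def prob_space)
  finally show ?thesis .
qed

text \<open>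
  Removal of the cut-offs for fixed \<open>k\<close>, with \<open>\<delta> = 1 / (n +
  1)\<close>, \<open>R = n + 1\<close> and \<open>n \<rightarrow> \<infinity>\<close>. The
  upper bound for the mean position at time \<open>T\<close> and the lower bound for its
  growth share the leading term \<open>sqrt (2 * k) * inertia * T\<^sup>2\<close>, which
  cancels except for the initial interval up to \<open>r0\<close>.
\<close>
lemma wave_expectation_increment:
  assumes r0: "0 < r0" "r0 \<le> T"
  shows "\<bar>expectation (\<lambda>\<omega>. wave T (X (T\<^sup>2) \<omega>)) - expectation (\<lambda>\<omega>. wave r0 (X (r0\<^sup>2) \<omega>))\<bar>
    \<le> P * \<bar>\<theta>\<bar> * C * (T\<^sup>2 * real N / (2 * sqrt (2 * k)) + sqrt (2 * k) * inertia * r0\<^sup>2)"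
proof -
  define \<delta> R where "\<delta> n = 1 / real (Suc n)" and "R n = real (Suc n)" for n :: nat
  have pos: "0 < \<delta> n" "0 < R n" for n by (simp_all add: \<delta>_def R_def)
  define m where "m n r = mass_mean (\<delta> n) (R n) r" for n r
  define s where "s = sqrt (2 * k)"
  have s: "0 < s" using k_large by (simp add: s_def)
  have m_lim: "(\<lambda>n. m n r) \<longlonglongrightarrow> 1" if "0 < r" for r
    unfolding m_def mass_mean_def \<delta>_def R_def by (rule cutoff_expectation_tendsto_1[OF k_large that])
  have m_le: "m n r \<le> 1" for n r
    unfolding m_def mass_mean_def
    by (intro integral_le_const integrable_cutoff[OF pos] AE_I2 cutoff_bounds pos) simp
  \<comment> \<open>the mass that the cut-off misses at any time between \<open>r0\<close> and
    \<open>T\<close>, by almost monotonicity\<close>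
  define q where "q n = 1 - m n r0 + loss / R n * T\<^sup>2" for n
  have q: "1 - q n \<le> m n r" if r: "r0 \<le> r" "r \<le> T" for n r
  proof -
    have "m n r0 \<le> m n r + 3 / R n * (real N + (k + 1) * real (N * (N - 1))) * (r\<^sup>2 - r0\<^sup>2)"
      unfolding m_def mass_mean_def by (rule cutoff_expectation_almost_mono[OF pos k_large]) (use r r0 in auto)
    also have "3 / R n * (real N + (k + 1) * real (N * (N - 1))) = loss / R n"
      by (simp add: loss_def)
    also have "loss / R n * (r\<^sup>2 - r0\<^sup>2) \<le> loss / R n * T\<^sup>2"
    proof (rule mult_left_mono)
      have "r\<^sup>2 \<le> T\<^sup>2" using r r0 by (intro power_mono) auto
      then show "r\<^sup>2 - r0\<^sup>2 \<le> T\<^sup>2" by (simp add: add_increasing2 diff_le_eq)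
    qed (use loss_nonneg pos[of n] in auto)
    finally show ?thesis by (simp add: q_def)
  qed
  define err where "err n = P * (1 - m n T) + P * (1 - m n r0)
     + P * (1 - m n r0) + \<bar>error2 (R n) * (T - r0)\<bar> + P * \<bar>\<theta>\<bar> * C * \<bar>error1 (R n) * (T - r0)\<bar>" for n
  define bd where "bd n = P * \<bar>\<theta>\<bar> * C * (T\<^sup>2 * (real N / (2 * s) + s * inertia) - s * inertia * (1 - q n) * (T\<^sup>2 - r0\<^sup>2)) + err n" for n
  have Q: "0 \<le> P * \<bar>\<theta>\<bar> * C" using weight_bound_pos C_nonneg by simp
  have le: "\<bar>expectation (\<lambda>\<omega>. wave T (X (T\<^sup>2) \<omega>)) - expectation (\<lambda>\<omega>. wave r0 (X (r0\<^sup>2) \<omega>))\<bar> \<le> bd n" for n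
  proof -
    let ?Q = "P * \<bar>\<theta>\<bar> * C" and ?E = "\<lambda>r. expectation (\<lambda>\<omega>. wave r (X (r\<^sup>2) \<omega>))"
    let ?Y = "error1 (R n) * (T - r0)" and ?Z = "error2 (R n) * (T - r0)"
    let ?W = "T\<^sup>2 * (real N / (2 * s) + s * inertia) - s * inertia * (1 - q n) * (T\<^sup>2 - r0\<^sup>2)"
    have 1: "\<bar>wave_mean (\<delta> n) (R n) T - wave_mean (\<delta> n) (R n) r0\<bar>
      \<le> ?Q * (position_mean (\<delta> n) (R n) T - position_mean (\<delta> n) (R n) r0
          - s * inertia * (1 - q n) * (T\<^sup>2 - r0\<^sup>2) + ?Y) + P * (m n T - m n r0) + ?Z"
      unfolding m_def s_def by (rule wave_increment[OF pos r0 q[unfolded m_def]])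
    have 2: "?Q * (position_mean (\<delta> n) (R n) T - position_mean (\<delta> n) (R n) r0
          - s * inertia * (1 - q n) * (T\<^sup>2 - r0\<^sup>2) + ?Y) \<le> ?Q * (?W + \<bar>?Y\<bar>)"
    proof (rule mult_left_mono[OF _ Q])
      have "position_mean (\<delta> n) (R n) T \<le> T\<^sup>2 * (real N / (2 * s) + s * inertia)"
        unfolding s_def by (rule position_mean_end(2)[OF pos T_pos])
      moreover have "0 \<le> position_mean (\<delta> n) (R n) r0"
        by (rule position_mean_end(1)[OF pos r0(1)])
      ultimately show "position_mean (\<delta> n) (R n) T - position_mean (\<delta> n) (R n) r0
          - s * inertia * (1 - q n) * (T\<^sup>2 - r0\<^sup>2) + ?Y \<le> ?W + \<bar>?Y\<bar>"
        using abs_ge_self[of ?Y] by linarith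
    qed
    have 3: "P * (m n T - m n r0) \<le> P * (1 - m n r0)"
      using m_le[of n T] weight_bound_pos by (intro mult_left_mono) auto
    have 4: "\<bar>wave_mean (\<delta> n) (R n) T - ?E T\<bar> \<le> P * (1 - m n T)"
      unfolding m_def by (rule wave_mean_close[OF pos]) (use T_pos in auto)
    have 5: "\<bar>wave_mean (\<delta> n) (R n) r0 - ?E r0\<bar> \<le> P * (1 - m n r0)"
      unfolding m_def by (rule wave_mean_close[OF pos]) (use r0 in auto)
    have "bd n = ?Q * (?W + \<bar>?Y\<bar>) + P * (1 - m n T) + P * (1 - m n r0) + P * (1 - m n r0) + \<bar>?Z\<bar>"
      unfolding bd_def err_def distrib_left[of ?Q ?W "\<bar>?Y\<bar>"] by simp
    moreover have "\<bar>?E T - ?E r0\<bar> \<le> \<bar>wave_mean (\<delta> n) (R n) T - ?E T\<bar>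
        + \<bar>wave_mean (\<delta> n) (R n) T - wave_mean (\<delta> n) (R n) r0\<bar> + \<bar>wave_mean (\<delta> n) (R n) r0 - ?E r0\<bar>"
      by linarith
    ultimately show ?thesis
      using 1 2 3 4 5 abs_ge_self[of ?Z] by linarith
  qed
  have inv: "(\<lambda>n. 1 / R n) \<longlonglongrightarrow> 0"
    unfolding R_def by (rule LIMSEQ_Suc[OF lim_1_over_n])
  then have inv_sqrt: "(\<lambda>n. 1 / sqrt (R n)) \<longlonglongrightarrow> 0"
    using tendsto_real_sqrt[OF inv] by (simp add: real_sqrt_divide)
  have e1: "(\<lambda>n. error1 (R n)) \<longlonglongrightarrow> 0"
    using tendsto_mult_right_zero[OF inv_sqrt, of "T\<^sup>2 * (inertia + 1) * (loss + 6)"] by (simp add: error1_def)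
  have e2: "(\<lambda>n. error2 (R n)) \<longlonglongrightarrow> 0"
  proof -
    have "(\<lambda>n. P * \<bar>\<theta>\<bar> * (6 * T * (A + 1) * (1 / sqrt (R n))) + 4 * T * P * (loss * (1 / R n)))
        \<longlonglongrightarrow> P * \<bar>\<theta>\<bar> * (6 * T * (A + 1) * 0) + 4 * T * P * (loss * 0)"
      by (intro tendsto_intros inv inv_sqrt)
    then show ?thesis by (simp add: error2_def)
  qed
  have "err \<longlonglongrightarrow> P * (1 - 1) + P * (1 - 1) + P * (1 - 1) + \<bar>0 * (T - r0)\<bar> + P * \<bar>\<theta>\<bar> * C * \<bar>0 * (T - r0)\<bar>"
    unfolding err_def[abs_def] by (intro tendsto_intros m_lim e1 e2 r0 T_pos)
  then have err: "err \<longlonglongrightarrow> 0" by simp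
  have "(\<lambda>n. 1 - m n r0 + loss * (1 / R n) * T\<^sup>2) \<longlonglongrightarrow> 1 - 1 + loss * 0 * T\<^sup>2"
    by (intro tendsto_intros m_lim inv r0)
  then have q_lim: "q \<longlonglongrightarrow> 0" by (simp add: q_def[abs_def])
  have "bd \<longlonglongrightarrow> P * \<bar>\<theta>\<bar> * C * (T\<^sup>2 * (real N / (2 * s) + s * inertia) - s * inertia * (1 - 0) * (T\<^sup>2 - r0\<^sup>2)) + 0"
    unfolding bd_def[abs_def] by (intro tendsto_intros err q_lim)
  then have "\<bar>expectation (\<lambda>\<omega>. wave T (X (T\<^sup>2) \<omega>)) - expectation (\<lambda>\<omega>. wave r0 (X (r0\<^sup>2) \<omega>))\<bar>
     \<le> P * \<bar>\<theta>\<bar> * C * (T\<^sup>2 * (real N / (2 * s) + s * inertia) - s * inertia * (1 - 0) * (T\<^sup>2 - r0\<^sup>2)) + 0"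
    by (rule LIMSEQ_le_const) (use le in blast)
  also have "\<dots> = P * \<bar>\<theta>\<bar> * C * (T\<^sup>2 * real N / (2 * s) + s * inertia * r0\<^sup>2)"
    by (simp add: algebra_simps)
  finally show ?thesis by (simp add: s_def)
qed

text \<open>
  The process starts in \<open>0\<close>, where the wave has the value \<open>cos
  \<alpha>\<close>; so \<open>r0\<close> may tend to \<open>0\<close>.
\<close>
lemma wave_expectation:
  "\<bar>expectation (\<lambda>\<omega>. wave T (X (T\<^sup>2) \<omega>)) - cos \<alpha>\<bar> \<le> P * \<bar>\<theta>\<bar> * C * (T\<^sup>2 * real N / (2 * sqrt (2 * k)))"
proof -
  define r where "r n = T / real (Suc n)" for n
  have r: "0 < r n" "r n \<le> T" for n
    using T_pos by (simp_all add: r_def divide_le_eq mult_le_cancel_left1)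
  have "(\<lambda>n. T * (1 / real (Suc n))) \<longlonglongrightarrow> T * 0"
    by (intro tendsto_intros LIMSEQ_Suc[OF lim_1_over_n])
  then have r0: "r \<longlonglongrightarrow> 0" by (simp add: r_def[abs_def])
  have "(\<lambda>n. expectation (\<lambda>\<omega>. wave (r n) (X ((r n)\<^sup>2) \<omega>))) \<longlonglongrightarrow> expectation (\<lambda>_. cos \<alpha>)"
  proof (rule integral_dominated_convergence[where w = "\<lambda>_. P"])
    show "AE \<omega> in M. (\<lambda>n. wave (r n) (X ((r n)\<^sup>2) \<omega>)) \<longlonglongrightarrow> cos \<alpha>"
      using start_AE AE_space
    proof eventually_elim
      case (elim \<omega>)
      have "(\<lambda>n. X ((r n)\<^sup>2) \<omega>) \<longlonglongrightarrow> X 0 \<omega>"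
        by (rule continuous_on_tendsto_compose[OF continuous_paths[OF elim(2)]])
           (use tendsto_power[OF r0, of 2] in auto)
      then have lim_X: "(\<lambda>n. X ((r n)\<^sup>2) \<omega> i) \<longlonglongrightarrow> X 0 \<omega> i" for i
        using continuous_on_tendsto_compose[OF continuous_on_coordinate[of UNIV i]] by simp
      have lim_w: "(\<lambda>n. w (r n) i) \<longlonglongrightarrow> w 0 i" for i
        by (rule continuous_on_tendsto_compose[OF w_cont r0]) auto
      have lim_p: "(\<lambda>n. weight (r n)) \<longlonglongrightarrow> weight 0"
        by (rule continuous_on_tendsto_compose[OF weight_cont r0]) auto
      have "(\<lambda>n. wave (r n) (X ((r n)\<^sup>2) \<omega>)) \<longlonglongrightarrow> weight 0 * cos (\<theta> * (\<Sum>i=1..N. w 0 i * X 0 \<omega> i) + \<alpha>)"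
        unfolding wave_def by (intro tendsto_intros lim_X lim_w lim_p)
      then show ?case using elim(1) by (simp add: weight_def v_0)
    qed
    fix n
    show "(\<lambda>\<omega>. wave (r n) (X ((r n)\<^sup>2) \<omega>)) \<in> borel_measurable M"
      by (rule measurable_continuous[OF continuous_wave]) simp
    show "AE \<omega> in M. norm (wave (r n) (X ((r n)\<^sup>2) \<omega>)) \<le> P"
      using wave_bound[of "r n"] r[of n] by (simp add: less_imp_le)
  qed simp_all
  then have start: "(\<lambda>n. expectation (\<lambda>\<omega>. wave (r n) (X ((r n)\<^sup>2) \<omega>))) \<longlonglongrightarrow> cos \<alpha>"
    by (simp add: prob_space)
  have "(\<lambda>n. \<bar>expectation (\<lambda>\<omega>. wave T (X (T\<^sup>2) \<omega>)) - expectation (\<lambda>\<omega>. wave (r n) (X ((r n)\<^sup>2) \<omega>))\<bar>)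
     \<longlonglongrightarrow> \<bar>expectation (\<lambda>\<omega>. wave T (X (T\<^sup>2) \<omega>)) - cos \<alpha>\<bar>"
    by (intro tendsto_intros start)
  moreover have "(\<lambda>n. P * \<bar>\<theta>\<bar> * C * (T\<^sup>2 * real N / (2 * sqrt (2 * k)) + sqrt (2 * k) * inertia * (r n)\<^sup>2))
     \<longlonglongrightarrow> P * \<bar>\<theta>\<bar> * C * (T\<^sup>2 * real N / (2 * sqrt (2 * k)) + sqrt (2 * k) * inertia * 0\<^sup>2)"
    by (intro tendsto_intros r0)
  ultimately have "\<bar>expectation (\<lambda>\<omega>. wave T (X (T\<^sup>2) \<omega>)) - cos \<alpha>\<bar>
     \<le> P * \<bar>\<theta>\<bar> * C * (T\<^sup>2 * real N / (2 * sqrt (2 * k)) + sqrt (2 * k) * inertia * 0\<^sup>2)"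
    by (rule LIMSEQ_le) (use wave_expectation_increment[OF r] in blast)
  then show ?thesis by simp
qed

end

section \<open>Convergence in distribution\<close>

text \<open>
  The constants \<open>P\<close> and \<open>C\<close> do not depend on \<open>k\<close>, so
  \<open>wave_expectation\<close> gives the rate \<open>1 / sqrt k\<close>.
\<close>
lemma middle_particle_cosine_limit:
  fixes M :: "real \<Rightarrow> 'w measure" and X :: "real \<Rightarrow> real \<Rightarrow> 'w \<Rightarrow> nat \<Rightarrow> real"
  assumes L: "1 \<le> L" and t: "0 < t"
    and process: "\<And>k. 0 \<le> k \<Longrightarrow> bessel_process_A (2 * L - 1) k (M k) (X k)"
    and start: "\<And>k. 0 \<le> k \<Longrightarrow> started_at_zero (2 * L - 1) (M k) (X k)"
  defines "V \<equiv> t * ((\<Sum>m<L. middle_weight L m / real (2 * m + 1)) / real (2 * L - 1))"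
  shows "((\<lambda>k. \<integral>\<omega>. cos (\<theta> * X k t \<omega> L + \<alpha>) \<partial>M k) \<longlongrightarrow> exp (- (\<theta>\<^sup>2 * V / 2)) * cos \<alpha>) at_top"
proof -
  define N where "N = 2 * L - 1"
  define T where "T = sqrt t"
  have T: "0 < T" "T\<^sup>2 = t" using t by (simp_all add: T_def)
  obtain z where "equilibrium N z" using exists_equilibrium by blast
  then interpret odd_equilibrium N z L
    by (intro odd_equilibrium.intro odd_equilibrium_axioms.intro) (use L in \<open>simp_all add: N_def\<close>)
  obtain C where C: "0 \<le> C"
    "\<And>r i j. \<lbrakk>0 \<le> r; r \<le> T; i \<in> {1..N}; j \<in> {1..N}\<rbrakk> \<Longrightarrow> \<bar>path T r i - path T r j\<bar> \<le> C * r * \<bar>z i - z j\<bar>"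
    by (rule path_gap_bound[OF T(1)]) (rule that)
  have bounded: "\<exists>B. \<forall>r. 0 \<le> r \<longrightarrow> r \<le> T \<longrightarrow> f r \<le> B" if "continuous_on UNIV f" for f :: "real \<Rightarrow> real"
  proof -
    have "\<exists>x\<in>{0..T}. \<forall>y\<in>{0..T}. f y \<le> f x"
      using T(1) by (intro continuous_attains_sup continuous_on_subset[OF that]) auto
    then obtain x where "\<forall>y\<in>{0..T}. f y \<le> f x" by blast
    then show ?thesis by (intro exI[of _ "f x"]) simp
  qed
  have cp: "continuous_on UNIV (\<lambda>r. path T r i)" for i
    using path_has_derivative[OF T(1)] by (intro DERIV_continuous_on) auto
  have cn: "continuous_on UNIV (\<lambda>r. \<Sum>i=1..N. (path T r i)\<^sup>2)"
    by (intro continuous_intros cp)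
  obtain A where A: "\<forall>r. 0 \<le> r \<longrightarrow> r \<le> T \<longrightarrow> (\<Sum>i=1..N. (path T r i)\<^sup>2) \<le> A"
    using bounded[OF cn] ..
  have cv: "continuous_on UNIV (path_variance T)"
    using path_variance_has_derivative[OF T(1)] by (intro DERIV_continuous_on) auto
  have ce: "continuous_on UNIV (\<lambda>r. exp (\<theta>\<^sup>2 * path_variance T r / 2))"
    by (intro continuous_intros cv) simp
  obtain P where P: "\<forall>r. 0 \<le> r \<longrightarrow> r \<le> T \<longrightarrow> exp (\<theta>\<^sup>2 * path_variance T r / 2) \<le> P"
    using bounded[OF ce] ..
  have V: "path_variance T T = V"
    unfolding path_variance_end[OF T(1)] V_def T(2) by (simp only: N_def)
  define E where "E k = (\<integral>\<omega>. cos (\<theta> * X k t \<omega> L + \<alpha>) \<partial>M k)" for k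
  define B where "B = P * \<bar>\<theta>\<bar> * C * (T\<^sup>2 * real N / 2)"
  have bound: "\<bar>exp (\<theta>\<^sup>2 * V / 2) * E k - cos \<alpha>\<bar> \<le> B / sqrt (2 * k)" if k: "5/2 \<le> k" for k
  proof -
    have k0: "0 \<le> k" using k by simp
    have ps: "prob_space (M k)" using process[OF k0] by (simp add: bessel_process_A_def)
    interpret bessel_transport "M k" N k "X k" z "path T" "path_velocity T" "path_variance T" T C A P \<theta> \<alpha>
      by (intro bessel_transport.intro bessel_zero.intro bessel_zero_axioms.intro bessel_transport_axioms.intro
          ps process[OF k0, folded N_def] start[OF k0, folded N_def] equilibrium_axioms k T(1) C
          A[rule_format] P[rule_format] path_has_derivative[OF T(1)] continuous_path_velocity
          path_equation[OF _ T(1)] path_orthogonal_to_position path_variance_has_derivative[OF T(1)] path_variance_0)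
    have "wave T x = exp (\<theta>\<^sup>2 * V / 2) * cos (\<theta> * x L + \<alpha>)" for x
    proof -
      have "(\<Sum>i=1..N. path T T i * x i) = (\<Sum>i=1..N. if i = L then x i else 0)"
        by (intro sum.cong refl) (simp add: path_at_end[OF T(1)])
      also have "\<dots> = x L" using L_in by simp
      finally show ?thesis by (simp add: wave_def weight_def V)
    qed
    then show ?thesis
      using wave_expectation by (simp add: E_def B_def T(2))
  qed
  have "((\<lambda>k. exp (\<theta>\<^sup>2 * V / 2) * E k - cos \<alpha>) \<longlongrightarrow> 0) at_top"
  proof (rule Lim_null_comparison)
    show "\<forall>\<^sub>F k in at_top. norm (exp (\<theta>\<^sup>2 * V / 2) * E k - cos \<alpha>) \<le> B / sqrt (2 * k)"
      using eventually_ge_at_top[of "5/2"] by eventually_elim (use bound in simp)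
    have "filterlim (\<lambda>k::real. sqrt (2 * k)) at_top at_top"
      by (intro filterlim_compose[OF sqrt_at_top] filterlim_tendsto_pos_mult_at_top[OF tendsto_const]) (auto intro: filterlim_ident)
    then show "((\<lambda>k. B / sqrt (2 * k)) \<longlongrightarrow> 0) at_top"
      by (intro tendsto_divide_0[OF tendsto_const] filterlim_at_top_imp_at_infinity)
  qed
  then have "((\<lambda>k. exp (- (\<theta>\<^sup>2 * V / 2)) * ((exp (\<theta>\<^sup>2 * V / 2) * E k - cos \<alpha>) + cos \<alpha>)) \<longlongrightarrow> exp (- (\<theta>\<^sup>2 * V / 2)) * (0 + cos \<alpha>)) at_top"
    by (intro tendsto_intros)
  moreover have "exp (- (\<theta>\<^sup>2 * V / 2)) * ((exp (\<theta>\<^sup>2 * V / 2) * y - cos \<alpha>) + cos \<alpha>) = y" for y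
    by (simp add: exp_minus)
  ultimately have "(E \<longlongrightarrow> exp (- (\<theta>\<^sup>2 * V / 2)) * cos \<alpha>) at_top"
    by (simp only: add_0_left)
  then show ?thesis by (simp add: E_def[abs_def])
qed

lemma char_distr_cos:
  assumes "prob_space M" and Y: "Y \<in> borel_measurable M"
  shows "char (distr M borel Y) \<theta> = Complex (\<integral>\<omega>. cos (\<theta> * Y \<omega>) \<partial>M) (\<integral>\<omega>. cos (\<theta> * Y \<omega> - pi / 2) \<partial>M)"
proof -
  interpret prob_space M by fact
  have c: "char (distr M borel Y) \<theta> = (\<integral>\<omega>. iexp (\<theta> * Y \<omega>) \<partial>M)"
    unfolding char_def using Y by (subst integral_distr) auto
  have int: "integrable M (\<lambda>\<omega>. iexp (\<theta> * Y \<omega>))"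
    using Y by (intro integrable_const_bound[of _ 1]) auto
  show ?thesis
  proof (rule complex_eqI)
    show "Re (char (distr M borel Y) \<theta>) = Re (Complex (\<integral>\<omega>. cos (\<theta> * Y \<omega>) \<partial>M) (\<integral>\<omega>. cos (\<theta> * Y \<omega> - pi / 2) \<partial>M))"
      unfolding c integral_Re[OF int, symmetric] by (simp add: Re_exp)
    show "Im (char (distr M borel Y) \<theta>) = Im (Complex (\<integral>\<omega>. cos (\<theta> * Y \<omega>) \<partial>M) (\<integral>\<omega>. cos (\<theta> * Y \<omega> - pi / 2) \<partial>M))"
      unfolding c integral_Im[OF int, symmetric] by (simp add: Im_exp cos_diff)
  qed
qed

lemma char_scaled_normal:
  "char (distr std_normal_distribution borel (\<lambda>x. \<sigma> * x)) \<theta> = complex_of_real (exp (- (\<sigma>\<^sup>2 * \<theta>\<^sup>2) / 2))"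
proof -
  have "char (distr std_normal_distribution borel (\<lambda>x. \<sigma> * x)) \<theta> = (\<integral>x. iexp (\<theta> * (\<sigma> * x)) \<partial>std_normal_distribution)"
    unfolding char_def by (subst integral_distr) auto
  also have "\<dots> = char std_normal_distribution (\<theta> * \<sigma>)"
    unfolding char_def by (simp add: mult.assoc)
  finally show ?thesis
    by (simp add: char_std_normal_distribution power_mult_distrib mult.commute)
qed

lemma real_distribution_scaled_normal:
  "real_distribution (distr std_normal_distribution borel (\<lambda>x. \<sigma> * x))"
proof -
  interpret real_distribution std_normal_distribution by (rule real_dist_normal_dist)
  show ?thesis by (rule real_distribution_distr) simp
qed

text \<open>
  Convergence along \<open>at_top\<close> is tested on sequences; replacing negative
  parameters by \<open>0\<close> changes only finitely many terms and makes all measures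
  distributions.
\<close>
lemma weak_conv_along_at_top_levy:
  fixes \<mu> :: "real \<Rightarrow> real measure"
  assumes \<mu>: "\<And>k. 0 \<le> k \<Longrightarrow> real_distribution (\<mu> k)" and \<nu>: "real_distribution \<nu>"
    and char: "\<And>\<theta>. ((\<lambda>k. char (\<mu> k) \<theta>) \<longlongrightarrow> char \<nu> \<theta>) at_top"
  shows "weak_conv_along \<mu> \<nu> at_top"
  unfolding weak_conv_along_def
proof (intro allI impI)
  fix x assume x: "isCont (cdf \<nu>) x"
  show "((\<lambda>k. cdf (\<mu> k) x) \<longlongrightarrow> cdf \<nu> x) at_top"
  proof (rule tendsto_at_topI_sequentially)
    fix s :: "nat \<Rightarrow> real" assume s: "filterlim s at_top sequentially"
    define s' where "s' n = max 0 (s n)" for n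
    have eq: "\<forall>\<^sub>F n in sequentially. s' n = s n"
      using filterlim_at_top_dense[THEN iffD1, OF s, rule_format, of 0]
      by eventually_elim (simp add: s'_def)
    have "weak_conv_m (\<lambda>n. \<mu> (s' n)) \<nu>"
    proof (rule levy_continuity[OF _ \<nu>])
      show "real_distribution (\<mu> (s' n))" for n by (rule \<mu>) (simp add: s'_def)
      show "(\<lambda>n. char (\<mu> (s' n)) \<theta>) \<longlonglongrightarrow> char \<nu> \<theta>" for \<theta>
      proof (rule Lim_transform_eventually[OF filterlim_compose[OF char s]])
        show "\<forall>\<^sub>F n in sequentially. char (\<mu> (s n)) \<theta> = char (\<mu> (s' n)) \<theta>"
          using eq by eventually_elim simp
      qed
    qed
    then have "(\<lambda>n. cdf (\<mu> (s' n)) x) \<longlonglongrightarrow> cdf \<nu> x"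
      using x by (simp add: weak_conv_m_def weak_conv_def)
    then show "(\<lambda>n. cdf (\<mu> (s n)) x) \<longlonglongrightarrow> cdf \<nu> x"
    proof (rule Lim_transform_eventually)
      show "\<forall>\<^sub>F n in sequentially. cdf (\<mu> (s' n)) x = cdf (\<mu> (s n)) x"
        using eq by eventually_elim simp
    qed
  qed
qed

theorem corollary3p5:
  fixes M :: "nat \<Rightarrow> real \<Rightarrow> 'w measure"
    and X :: "nat \<Rightarrow> real \<Rightarrow> real \<Rightarrow> 'w \<Rightarrow> nat \<Rightarrow> real"
    and t :: real
  assumes bessel: "\<And>L k. 1 \<le> L \<Longrightarrow> 0 \<le> k \<Longrightarrow> bessel_process_A (2 * L - 1) k (M L k) (X L k)"
    and start: "\<And>L k. 1 \<le> L \<Longrightarrow> 0 \<le> k \<Longrightarrow> started_at_zero (2 * L - 1) (M L k) (X L k)"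
    and t: "0 < t"
  shows "\<exists>\<rho> :: nat \<Rightarrow> real measure.
           (\<forall>L\<ge>2. real_distribution (\<rho> L) \<and>
              weak_conv_along
                (\<lambda>k. distr (M L k) borel
                       (\<lambda>\<omega>. 2 * sqrt (real L) / sqrt (t * ln (real L)) * X L k t \<omega> L))
                (\<rho> L) at_top) \<and>
           weak_conv_m \<rho> std_normal_distribution"
proof -
  define S where "S L = (\<Sum>m<L. middle_weight L m / real (2 * m + 1)) / real (2 * L - 1)" for L
  define \<sigma> where "\<sigma> L = sqrt (4 * real L / ln (real L) * S L)" for L
  define \<rho> where "\<rho> L = distr std_normal_distribution borel (\<lambda>x. \<sigma> L * x)" for L
  have dist_\<rho>: "real_distribution (\<rho> L)" for L
    unfolding \<rho>_def by (rule real_distribution_scaled_normal)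
  have S: "0 \<le> S L" for L
  proof -
    have "0 \<le> middle_weight L m" if "m < L" for m
      using middle_weight_ge_1[OF that] by linarith
    then show ?thesis unfolding S_def by (intro divide_nonneg_nonneg sum_nonneg) auto
  qed
  have conv: "weak_conv_along (\<lambda>k. distr (M L k) borel (\<lambda>\<omega>. 2 * sqrt (real L) / sqrt (t * ln (real L)) * X L k t \<omega> L)) (\<rho> L) at_top"
    if L: "2 \<le> L" for L
  proof -
    define c where "c = 2 * sqrt (real L) / sqrt (t * ln (real L))"
    have lnL: "0 < ln (real L)" using L by simp
    have \<sigma>2: "(\<sigma> L)\<^sup>2 = c\<^sup>2 * (t * S L)"
      using t lnL S[of L] by (simp add: \<sigma>_def c_def power_divide power_mult_distrib)
    have prob: "prob_space (M L k)" and meas: "(\<lambda>\<omega>. X L k t \<omega> L) \<in> borel_measurable (M L k)" if k: "0 \<le> k" for k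
    proof -
      have b: "bessel_process_A (2 * L - 1) k (M L k) (X L k)" using bessel[of L k] L k by simp
      then show "prob_space (M L k)" by (simp add: bessel_process_A_def)
      have "X L k t \<in> M L k \<rightarrow>\<^sub>M (\<Pi>\<^sub>M i\<in>{1..2 * L - 1}. borel)"
        using b t by (simp add: bessel_process_A_def)
      moreover have "L \<in> {1..2 * L - 1}" using L by auto
      ultimately show "(\<lambda>\<omega>. X L k t \<omega> L) \<in> borel_measurable (M L k)"
        by (rule measurable_component_singleton[THEN measurable_compose[rotated], rotated])
    qed
    show ?thesis
      unfolding c_def[symmetric]
    proof (rule weak_conv_along_at_top_levy[OF _ dist_\<rho>])
      show "real_distribution (distr (M L k) borel (\<lambda>\<omega>. c * X L k t \<omega> L))" if "0 \<le> k" for k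
        using prob_space.real_distribution_distr[OF prob[OF that]] meas[OF that] by simp
      fix \<theta>
      have lim: "((\<lambda>k. \<integral>\<omega>. cos ((\<theta> * c) * X L k t \<omega> L + \<alpha>) \<partial>M L k) \<longlongrightarrow> exp (- ((\<theta> * c)\<^sup>2 * (t * S L) / 2)) * cos \<alpha>) at_top" for \<alpha>
        unfolding S_def using L
        by (intro middle_particle_cosine_limit t bessel start) auto
      let ?g = "exp (- ((\<theta> * c)\<^sup>2 * (t * S L) / 2))"
      have eq: "Complex (?g * cos 0) (?g * cos (- (pi / 2))) = char (\<rho> L) \<theta>"
      proof -
        have "(\<theta> * c)\<^sup>2 * (t * S L) / 2 = c\<^sup>2 * (t * S L) * \<theta>\<^sup>2 / 2"
          by (simp add: power_mult_distrib)
        then show ?thesis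
          unfolding \<rho>_def char_scaled_normal \<sigma>2 by (simp add: complex_eq_iff)
      qed
      have "((\<lambda>k. Complex (\<integral>\<omega>. cos ((\<theta> * c) * X L k t \<omega> L + 0) \<partial>M L k) (\<integral>\<omega>. cos ((\<theta> * c) * X L k t \<omega> L + - (pi / 2)) \<partial>M L k))
          \<longlongrightarrow> char (\<rho> L) \<theta>) at_top"
        unfolding eq[symmetric] by (intro tendsto_Complex lim)
      moreover have "\<forall>\<^sub>F k in at_top. Complex (\<integral>\<omega>. cos ((\<theta> * c) * X L k t \<omega> L + 0) \<partial>M L k) (\<integral>\<omega>. cos ((\<theta> * c) * X L k t \<omega> L + - (pi / 2)) \<partial>M L k)
          = char (distr (M L k) borel (\<lambda>\<omega>. c * X L k t \<omega> L)) \<theta>"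
        using eventually_ge_at_top[of 0]
      proof eventually_elim
        case (elim k)
        have "(\<lambda>\<omega>. c * X L k t \<omega> L) \<in> borel_measurable (M L k)"
          using meas[OF elim] by simp
        from char_distr_cos[OF prob[OF elim] this, of \<theta>] show ?case
          by (simp add: mult.assoc)
      qed
      ultimately show "((\<lambda>k. char (distr (M L k) borel (\<lambda>\<omega>. c * X L k t \<omega> L)) \<theta>) \<longlongrightarrow> char (\<rho> L) \<theta>) at_top"
        by (rule Lim_transform_eventually)
    qed
  qed
  have "weak_conv_m \<rho> std_normal_distribution"
  proof (rule levy_continuity[OF dist_\<rho> real_dist_normal_dist])
    fix \<theta>
    have lim: "(\<lambda>L. 4 * real L / ln (real L) * S L) \<longlonglongrightarrow> 1"
      unfolding S_def by (rule middle_weight_sum_asymp)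
    have "(\<lambda>L. complex_of_real (exp (- (4 * real L / ln (real L) * S L * \<theta>\<^sup>2) / 2))) \<longlonglongrightarrow> complex_of_real (exp (- (1 * \<theta>\<^sup>2) / 2))"
      by (intro tendsto_intros lim) simp
    moreover have "\<forall>\<^sub>F L in sequentially. complex_of_real (exp (- (4 * real L / ln (real L) * S L * \<theta>\<^sup>2) / 2)) = char (\<rho> L) \<theta>"
      using eventually_ge_at_top[of 2]
    proof eventually_elim
      case (elim L)
      then have "0 \<le> 4 * real L / ln (real L) * S L" using S[of L] by (intro mult_nonneg_nonneg divide_nonneg_nonneg) auto
      then have "(\<sigma> L)\<^sup>2 = 4 * real L / ln (real L) * S L" by (simp add: \<sigma>_def)
      then show ?case by (simp only: \<rho>_def char_scaled_normal)
    qed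
    ultimately have "(\<lambda>L. char (\<rho> L) \<theta>) \<longlonglongrightarrow> complex_of_real (exp (- (1 * \<theta>\<^sup>2) / 2))"
      by (rule Lim_transform_eventually)
    then show "(\<lambda>L. char (\<rho> L) \<theta>) \<longlonglongrightarrow> char std_normal_distribution \<theta>"
      by (simp add: char_std_normal_distribution)
  qed
  then show ?thesis using dist_\<rho> conv by blast
qed

end
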